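(* Let $a\in(0,\infty)$, $b\in[0,1]$ and $c\in[0,\infty)$ be real numbers. Let $F:\Sigma\to S^3$ be a smooth embedding of a two-dimensional torus $\Sigma$ whose principal curvatures $\lambda_1\geq\lambda_2$ (with respect to some choice of unit normal vector field) satisfy $(\lambda_1+\lambda_2-c)^2=a+b\,(\lambda_1-\lambda_2)^2$ and $\lambda_1+\lambda_2\geq c$ at every point of $\Sigma$. Then $F$ is rotationally symmetric in the following sense: there exists an anti-symmetric matrix $Q\in\mathfrak{so}(4)$ of rank $2$ such that $Q\,F(x)\in \mathrm{span}\{\frac{\partial F}{\partial x_1}(x),\frac{\partial F}{\partial x_2}(x)\}$ for all $x\in\Sigma$, where $(x_1,x_2)$ denote local coordinates on $\Sigma$ around $x$.
   Context: $S^3\subset\mathbb{R}^4$ is the unit sphere with its round metric, and $F$ is regarded as an $\mathbb{R}^4$-valued map. $\nu$ is a unit normal vector field along $F$ (tangent to $S^3$, normal to the surface), the second fundamental form is $h_{ij}=\langle \frac{\partial \nu}{\partial x_i},\frac{\partial F}{\partial x_j}\rangle$, and the principal curvatures $\lambda_1\ge\lambda_2$ are the eigenvalues of $h$ with respect to the induced metric. The span in the conclusion is the tangent plane of the surface at $F(x)$, regarded as a linear subspace of $\mathbb{R}^4$. *)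

theory Defs
  imports "HOL-Analysis.Analysis"
begin

definition torus :: "(complex \<times> complex) set" where
  "torus = sphere 0 1 \<times> sphere 0 1"

text \<open>Angular coordinates of the torus centred at \<open>p\<close> (so \<open>torus_chart p 0 = p\<close>). The map is
  injective on \<open>(-pi, pi) \<times> (-pi, pi)\<close>; it is the inverse of a coordinate chart there, and on all
  of the plane it is a covering map of the torus.\<close>

definition torus_chart :: "complex \<times> complex \<Rightarrow> real^2 \<Rightarrow> complex \<times> complex" where
  "torus_chart p x = (fst p * cis (x $ 1), snd p * cis (x $ 2))"

primrec times_differentiable :: "nat \<Rightarrow> ('a::real_normed_vector \<Rightarrow> 'b::real_normed_vector) \<Rightarrow> bool" where
  "times_differentiable 0 f \<longleftrightarrow> continuous_on UNIV f"
| "times_differentiable (Suc n) f \<longleftrightarrow>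
     (\<forall>x. f differentiable (at x)) \<and>
     (\<forall>v. times_differentiable n (\<lambda>x. frechet_derivative f (at x) v))"

definition smooth :: "('a::real_normed_vector \<Rightarrow> 'b::real_normed_vector) \<Rightarrow> bool" where
  "smooth f \<longleftrightarrow> (\<forall>n. times_differentiable n f)"

definition smooth_on_torus :: "(complex \<times> complex \<Rightarrow> 'b::real_normed_vector) \<Rightarrow> bool" where
  "smooth_on_torus f \<longleftrightarrow> (\<forall>p\<in>torus. smooth (f \<circ> torus_chart p))"

definition pd :: "2 \<Rightarrow> (complex \<times> complex \<Rightarrow> 'b::real_normed_vector) \<Rightarrow> complex \<times> complex \<Rightarrow> 'b" where
  "pd i f p = frechet_derivative (f \<circ> torus_chart p) (at 0) (axis i 1)"

text \<open>A smooth embedding is a smooth immersion that is a homeomorphism onto its image. The values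
  of \<open>F\<close> outside \<open>torus\<close> play no role.\<close>

definition smooth_embedding_S3 :: "(complex \<times> complex \<Rightarrow> real^4) \<Rightarrow> bool" where
  "smooth_embedding_S3 F \<longleftrightarrow>
     F \<in> torus \<rightarrow> sphere 0 1 \<and>
     smooth_on_torus F \<and>
     (\<forall>p\<in>torus. inj (frechet_derivative (F \<circ> torus_chart p) (at 0))) \<and>
     (\<exists>G. homeomorphism torus (F ` torus) F G)"

definition unit_normal_field ::
  "(complex \<times> complex \<Rightarrow> real^4) \<Rightarrow> (complex \<times> complex \<Rightarrow> real^4) \<Rightarrow> bool" where
  "unit_normal_field F \<nu> \<longleftrightarrow>
     smooth_on_torus \<nu> \<and>
     (\<forall>p\<in>torus. norm (\<nu> p) = 1 \<and> \<nu> p \<bullet> F p = 0 \<and> (\<forall>i. \<nu> p \<bullet> pd i F p = 0))"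

definition first_form :: "(complex \<times> complex \<Rightarrow> real^4) \<Rightarrow> complex \<times> complex \<Rightarrow> real^2^2" where
  "first_form F p = (\<chi> i j. pd i F p \<bullet> pd j F p)"

definition second_form ::
  "(complex \<times> complex \<Rightarrow> real^4) \<Rightarrow> (complex \<times> complex \<Rightarrow> real^4) \<Rightarrow> complex \<times> complex \<Rightarrow> real^2^2"
  where "second_form F \<nu> p = (\<chi> i j. pd i \<nu> p \<bullet> pd j F p)"

text \<open>The set of eigenvalues of the second fundamental form relative to the induced metric. As the
  form is symmetric on a plane, this set is \<open>{l, m}\<close> exactly when \<open>l, m\<close> are the two eigenvalues
  counted with multiplicity (\<open>l = m\<close> at umbilic points).\<close>

definition principal_curvatures ::
  "(complex \<times> complex \<Rightarrow> real^4) \<Rightarrow> (complex \<times> complex \<Rightarrow> real^4) \<Rightarrow> complex \<times> complex \<Rightarrow> real set"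
  where "principal_curvatures F \<nu> p =
    {l. \<exists>v. v \<noteq> 0 \<and> second_form F \<nu> p *v v = l *\<^sub>R (first_form F p *v v)}"

end

(*
  A two-point maximum principle in the manner of Brendle and Andrews-Li. Write H for the mean of the
  principal curvatures and u for half their difference, so that H is a convex function of u.

  There are no umbilics: the trace-free second fundamental form is a periodic solution of a first
  order elliptic system in the plane. Integrating a null Lagrangian bounds the energy of the logarithm
  of its norm, which excludes zeros; vanishing identically is excluded by Gauss-Bonnet.

  For k > 1 let Z(x,y) = (H + k u)(x) (1 - F(x).F(y)) + N(x).F(y). If Z is not nonnegative, then for a
  larger k it is nonnegative with a zero off the diagonal: a sphere touches the surface at two points.
  It does so from the same side, as the surface separates the simply connected three-sphere. The second
  variation of Z, Simons' identity and the concavity of the Weingarten relation then give a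
  contradiction; the decisive term is a negative multiple of (k^2 - 1) u^2 (H - u H'(u)).

  So Z >= 0 for k = 1. Its Taylor expansion along the first principal direction shows that the principal
  curvatures are constant along the corresponding curvature lines, which are therefore circles in
  parallel planes.
*)
theory Submission
  imports Defs
begin

section \<open>Calculus of smooth maps\<close>

text \<open>At an umbilic \<open>u\<close> and the principal directions need not be smooth, so
  umbilics have to go before the two-point function can be differentiated. If the relation is
  written \<open>H = \<psi>(u)\<close>, the hypotheses on the constants enter as
  \<open>0 \<le> \<psi>' < 1\<close>, which makes the system for the trace-free part elliptic, as
  \<open>0 \<le> u \<psi>'' \<le> 1 - (\<psi>')\<^sup>2\<close>, which absorbs the gradient terms of
  the second variation, and as \<open>\<psi> - u \<psi>' > 0\<close>, which gives the decisive term
  its sign. For \<open>b = 1\<close> the slope tends to 1 as \<open>u\<close> grows, so the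
  ellipticity is uniform only because the surface is compact. At \<open>k = 1\<close> the second
  derivative of \<open>Z\<close> on the diagonal degenerates in the first principal direction and
  the decisive term vanishes. This forces the detour over \<open>k > 1\<close>, and the same
  degeneracy makes the expansion at \<open>k = 1\<close> informative. All geometry is done on the
  covering plane, with orthonormal frames obtained as derivatives of \<open>F\<close> along vector
  fields: the equations of Gauss and Codazzi then express the commutator of two such derivatives,
  and no Christoffel symbols occur.\<close>

lemma times_differentiable_Suc_imp:
  "times_differentiable (Suc n) f \<Longrightarrow> times_differentiable n f"
proof (induction n arbitrary: f)
  case 0
  then show ?case
    by (auto intro!: continuous_at_imp_continuous_on differentiable_imp_continuous_within)
next
  case (Suc n)
  then show ?case by (metis times_differentiable.simps(2))
qed

lemma smooth_differentiable: "smooth f \<Longrightarrow> f differentiable (at x)"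
  unfolding smooth_def using times_differentiable.simps(2) by blast

lemma smooth_frechet:
  "smooth f \<Longrightarrow> (f has_derivative frechet_derivative f (at x)) (at x)"
  using smooth_differentiable frechet_derivative_works by blast

lemma smooth_frechet_derivative:
  "smooth f \<Longrightarrow> smooth (\<lambda>x. frechet_derivative f (at x) v)"
  unfolding smooth_def using times_differentiable.simps(2) by blast

lemma smooth_continuous_on: "smooth f \<Longrightarrow> continuous_on S f"
  unfolding smooth_def
  by (metis continuous_on_subset subset_UNIV times_differentiable.simps(1))

lemma smooth_isCont: "smooth f \<Longrightarrow> isCont f x"
  using smooth_differentiable differentiable_imp_continuous_within by blast

text \<open>The definition recurses through \<open>frechet_derivative\<close>; this form lets an
  explicit derivative take its place, so that the closure properties below become inductions over
  the usual differentiation rules.\<close>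

lemma times_differentiable_SucI:
  assumes "\<And>x. (f has_derivative f' x) (at x)" "\<And>v. times_differentiable n (\<lambda>x. f' x v)"
  shows "times_differentiable (Suc n) f"
proof -
  have "frechet_derivative f (at x) = f' x" for x
    using frechet_derivative_at[OF assms(1)] by simp
  then show ?thesis using assms by (auto simp: differentiable_def)
qed

lemma times_differentiable_has_derivative:
  "times_differentiable (Suc n) f \<Longrightarrow> (f has_derivative frechet_derivative f (at x)) (at x)"
  by (simp add: frechet_derivative_works)

lemma times_differentiable_const: "times_differentiable n (\<lambda>x. c)"
  by (induction n arbitrary: c) auto

lemma times_differentiable_add:
  "times_differentiable n f \<Longrightarrow> times_differentiable n g \<Longrightarrow> times_differentiable n (\<lambda>x. f x + g x)"
proof (induction n arbitrary: f g)
  case 0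
  then show ?case by (auto intro: continuous_intros)
next
  case (Suc n)
  show ?case
    using Suc.prems
    by (intro times_differentiable_SucI[OF has_derivative_add[OF
          times_differentiable_has_derivative[OF Suc.prems(1)]
          times_differentiable_has_derivative[OF Suc.prems(2)]]] Suc.IH) auto
qed

lemma times_differentiable_bounded_linear:
  assumes "bounded_linear L"
  shows "times_differentiable n f \<Longrightarrow> times_differentiable n (\<lambda>x. L (f x))"
proof (induction n arbitrary: f)
  case 0
  then show ?case
    using assms by (auto intro: bounded_linear.continuous_on)
next
  case (Suc n)
  show ?case
    using Suc.prems
    by (intro times_differentiable_SucI[OF bounded_linear.has_derivative[OF assms
          times_differentiable_has_derivative[OF Suc.prems]]] Suc.IH) auto
qed

lemma times_differentiable_affine:
  assumes L: "bounded_linear L"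
  shows "times_differentiable n f \<Longrightarrow> times_differentiable n (\<lambda>x. f (L x + c))"
proof (induction n arbitrary: f)
  case 0
  have "continuous_on UNIV (\<lambda>x. L x + c)"
    using L by (intro continuous_on_add continuous_on_const linear_continuous_on)
  then show ?case
    using 0 continuous_on_compose2[of UNIV f UNIV "\<lambda>x. L x + c"] by simp
next
  case (Suc n)
  have *: "((\<lambda>x. f (L x + c)) has_derivative (\<lambda>v. frechet_derivative f (at (L x + c)) (L v))) (at x)" for x
  proof -
    have "((\<lambda>x. L x + c) has_derivative L) (at x)"
      using has_derivative_add[OF bounded_linear_imp_has_derivative[OF L] has_derivative_const[of c]]
      by simp
    from diff_chain_at[OF this times_differentiable_has_derivative[OF Suc.prems]]
    show ?thesis by (simp add: o_def)
  qed
  show ?case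
    using Suc.prems by (intro times_differentiable_SucI[OF *] Suc.IH) simp
qed

lemma times_differentiable_bilinear:
  assumes "bounded_bilinear B"
  shows "times_differentiable n f \<Longrightarrow> times_differentiable n g \<Longrightarrow>
    times_differentiable n (\<lambda>x. B (f x) (g x))"
proof (induction n arbitrary: f g)
  case 0
  then show ?case
    using assms by (auto intro: bounded_bilinear.continuous_on)
next
  case (Suc n)
  have "times_differentiable n f" "times_differentiable n g"
    using Suc.prems times_differentiable_Suc_imp by blast+
  then show ?case
    using Suc.prems
    by (intro times_differentiable_SucI[OF bounded_bilinear.FDERIV[OF assms]] times_differentiable_add)
      (auto intro: times_differentiable_has_derivative intro!: Suc.IH)
qed

lemma times_differentiable_uminus:
  "times_differentiable n f \<Longrightarrow> times_differentiable n (\<lambda>x. - f x)"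
  by (rule times_differentiable_bounded_linear[OF bounded_linear_minus[OF bounded_linear_ident]])

lemma times_differentiable_inverse:
  fixes f :: "'a::real_normed_vector \<Rightarrow> 'b::real_normed_field"
  assumes "\<And>x. f x \<noteq> 0"
  shows "times_differentiable n f \<Longrightarrow> times_differentiable n (\<lambda>x. inverse (f x))"
proof (induction n)
  case 0
  then show ?case using assms by (auto intro: continuous_intros)
next
  case (Suc n)
  have "times_differentiable n (\<lambda>x. inverse (f x))"
    using Suc times_differentiable_Suc_imp by blast
  then show ?case
    using Suc.prems
    by (intro times_differentiable_SucI[OF Deriv.has_derivative_inverse[where f=f, OF assms times_differentiable_has_derivative[OF Suc.prems]]] times_differentiable_uminus
        times_differentiable_bilinear[OF bounded_bilinear_mult])
      (auto intro: times_differentiable_has_derivative)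
qed

lemma times_differentiable_sqrt:
  fixes f :: "'a::real_normed_vector \<Rightarrow> real"
  assumes "\<And>x. f x > 0"
  shows "times_differentiable n f \<Longrightarrow> times_differentiable n (\<lambda>x. sqrt (f x))"
proof (induction n)
  case 0
  then show ?case using assms by (auto intro: continuous_intros)
next
  case (Suc n)
  \<comment> \<open>Written with \<open>inverse (sqrt (f x))\<close>, the derivative contains no
    root other than that of \<open>f\<close>, to which the induction hypothesis applies.\<close>
  have *: "((\<lambda>x. sqrt (f x)) has_derivative
      (\<lambda>v. inverse (sqrt (f x)) * (frechet_derivative f (at x) v * inverse 2))) (at x)" for x
    using has_derivative_real_sqrt[OF assms times_differentiable_has_derivative[OF Suc.prems], of x]
    by (simp add: field_simps)
  have "times_differentiable n (\<lambda>x. sqrt (f x))"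
    using Suc times_differentiable_Suc_imp by blast
  moreover have "sqrt (f x) \<noteq> 0" for x using assms[of x] by simp
  ultimately show ?case
    using Suc.prems
    by (intro times_differentiable_SucI[OF *] times_differentiable_inverse times_differentiable_const
          times_differentiable_bilinear[OF bounded_bilinear_mult]) auto
qed

text \<open>Each of the two functions has the other in its derivative, hence the joint
  induction.\<close>

lemma times_differentiable_cos_sin:
  fixes f :: "'a::real_normed_vector \<Rightarrow> real"
  shows "times_differentiable n f \<Longrightarrow>
    times_differentiable n (\<lambda>x. cos (f x)) \<and> times_differentiable n (\<lambda>x. sin (f x))"
proof (induction n)
  case 0
  then show ?case by (auto intro: continuous_intros)
next
  case (Suc n)
  note f = times_differentiable_has_derivative[OF Suc.prems]
  have c: "((\<lambda>x. cos (f x)) has_derivative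
      (\<lambda>v. - (sin (f x) * frechet_derivative f (at x) v))) (at x)"
    and s: "((\<lambda>x. sin (f x)) has_derivative
      (\<lambda>v. cos (f x) * frechet_derivative f (at x) v)) (at x)" for x
    using has_derivative_cos[OF f] has_derivative_sin[OF f] by (simp_all add: mult.commute)
  have "times_differentiable n (\<lambda>x. cos (f x))" "times_differentiable n (\<lambda>x. sin (f x))"
    using Suc times_differentiable_Suc_imp by blast+
  then show ?case
    using Suc.prems
    by (intro conjI times_differentiable_SucI[OF c] times_differentiable_SucI[OF s]
        times_differentiable_uminus times_differentiable_bilinear[OF bounded_bilinear_mult]) auto
qed

lemma smooth_const: "smooth (\<lambda>x. c)"
  by (simp add: smooth_def times_differentiable_const)

lemma smooth_bounded_linear: "bounded_linear L \<Longrightarrow> smooth f \<Longrightarrow> smooth (\<lambda>x. L (f x))"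
  by (simp add: smooth_def times_differentiable_bounded_linear)

lemma smooth_affine: "bounded_linear L \<Longrightarrow> smooth f \<Longrightarrow> smooth (\<lambda>x. f (L x + c))"
  by (simp add: smooth_def times_differentiable_affine)

lemma smooth_add: "smooth f \<Longrightarrow> smooth g \<Longrightarrow> smooth (\<lambda>x. f x + g x)"
  by (simp add: smooth_def times_differentiable_add)

lemma smooth_minus: "smooth f \<Longrightarrow> smooth (\<lambda>x. - f x)"
  by (rule smooth_bounded_linear[OF bounded_linear_minus[OF bounded_linear_ident]])

lemma smooth_diff: "smooth f \<Longrightarrow> smooth g \<Longrightarrow> smooth (\<lambda>x. f x - g x)"
  using smooth_add[OF _ smooth_minus, of f g] by simp

lemma smooth_bilinear:
  "bounded_bilinear B \<Longrightarrow> smooth f \<Longrightarrow> smooth g \<Longrightarrow> smooth (\<lambda>x. B (f x) (g x))"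
  by (simp add: smooth_def times_differentiable_bilinear)

lemmas smooth_mult = smooth_bilinear[OF bounded_bilinear_mult]
lemmas smooth_scaleR = smooth_bilinear[OF bounded_bilinear_scaleR]
lemmas smooth_inner = smooth_bilinear[OF bounded_bilinear_inner]

lemma smooth_inverse:
  fixes f :: "'a::real_normed_vector \<Rightarrow> 'b::real_normed_field"
  shows "smooth f \<Longrightarrow> (\<And>x. f x \<noteq> 0) \<Longrightarrow> smooth (\<lambda>x. inverse (f x))"
  by (simp add: smooth_def times_differentiable_inverse)

lemma smooth_divide:
  fixes f g :: "'a::real_normed_vector \<Rightarrow> 'b::real_normed_field"
  shows "smooth f \<Longrightarrow> smooth g \<Longrightarrow> (\<And>x. g x \<noteq> 0) \<Longrightarrow> smooth (\<lambda>x. f x / g x)"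
  unfolding divide_inverse by (intro smooth_mult smooth_inverse)

lemma smooth_power:
  fixes f :: "'a::real_normed_vector \<Rightarrow> 'b::real_normed_field"
  shows "smooth f \<Longrightarrow> smooth (\<lambda>x. f x ^ n)"
  by (induction n) (auto intro: smooth_mult smooth_const)

lemma smooth_sqrt:
  fixes f :: "'a::real_normed_vector \<Rightarrow> real"
  shows "smooth f \<Longrightarrow> (\<And>x. f x > 0) \<Longrightarrow> smooth (\<lambda>x. sqrt (f x))"
  by (simp add: smooth_def times_differentiable_sqrt)

lemma smooth_cos: "smooth f \<Longrightarrow> smooth (\<lambda>x. cos (f x :: real))"
  and smooth_sin: "smooth f \<Longrightarrow> smooth (\<lambda>x. sin (f x :: real))"
  by (simp_all add: smooth_def times_differentiable_cos_sin)

lemma smooth_sum: "(\<And>i. i \<in> I \<Longrightarrow> smooth (f i)) \<Longrightarrow> smooth (\<lambda>x. \<Sum>i\<in>I. f i x)"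
  by (induction I rule: infinite_finite_induct) (auto intro: smooth_const smooth_add)

lemma smooth_nth: "smooth f \<Longrightarrow> smooth (\<lambda>x. f x $ i)"
  by (rule smooth_bounded_linear[OF bounded_linear_vec_nth])

lemma smooth_Re: "smooth f \<Longrightarrow> smooth (\<lambda>x. Re (f x))"
  and smooth_Im: "smooth f \<Longrightarrow> smooth (\<lambda>x. Im (f x))"
  and smooth_of_real: "smooth g \<Longrightarrow> smooth (\<lambda>x. of_real (g x) :: complex)"
  by (rule smooth_bounded_linear, rule bounded_linear_Re bounded_linear_Im bounded_linear_of_real, assumption)+

lemma smooth_fst: "smooth f \<Longrightarrow> smooth (\<lambda>z. f (fst z))"
  and smooth_snd: "smooth f \<Longrightarrow> smooth (\<lambda>z. f (snd z))"
  using smooth_affine[OF bounded_linear_fst, of f 0] smooth_affine[OF bounded_linear_snd, of f 0]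
  by simp_all

lemma smooth_Pair: "smooth f \<Longrightarrow> smooth g \<Longrightarrow> smooth (\<lambda>z. (f z, g z))"
proof -
  assume "smooth f" "smooth g"
  have "bounded_linear (\<lambda>x::'b. (x, 0::'c))" "bounded_linear (\<lambda>x::'c. (0::'b, x))"
    by (auto intro: bounded_linear_Pair)
  from smooth_add[OF this(1)[THEN smooth_bounded_linear, OF \<open>smooth f\<close>]
      this(2)[THEN smooth_bounded_linear, OF \<open>smooth g\<close>]]
  show ?thesis by simp
qed

lemmas smooth_intros = smooth_const smooth_add smooth_minus smooth_diff smooth_mult smooth_scaleR
  smooth_inner smooth_inverse smooth_divide smooth_power smooth_sqrt smooth_cos smooth_sin smooth_nth
  smooth_Re smooth_Im smooth_of_real smooth_Pair

text \<open>Locally, a continuous logarithm differs from a branch of the logarithm by a constant.\<close>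

lemma smooth_continuous_log:
  fixes f g :: "'a::real_normed_vector \<Rightarrow> complex"
  assumes "smooth f" and g: "continuous_on UNIV g" and fg: "\<And>x. f x = exp (g x)"
  shows "smooth g"
proof -
  have nz: "f x \<noteq> 0" for x by (simp add: fg)
  have D: "(g has_derivative (\<lambda>v. inverse (f x) * frechet_derivative f (at x) v)) (at x)" for x
  proof (rule has_derivative_transform_eventually)
    have "isCont g x" using g by (simp add: continuous_on_eq_continuous_at)
    then have "eventually (\<lambda>y. dist (g y) (g x) < pi) (at x)"
      using pi_gt_zero unfolding isCont_def by (rule tendstoD)
    then show "\<forall>\<^sub>F y in at x. g x + Ln (f y / f x) = g y"
    proof (rule eventually_mono)
      fix y assume "dist (g y) (g x) < pi"
      then have "\<bar>Im (g y - g x)\<bar> < pi"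
        using abs_Im_le_cmod[of "g y - g x"] by (auto simp: dist_norm)
      then have "Ln (exp (g y - g x)) = g y - g x" by (intro Ln_exp) auto
      then show "g x + Ln (f y / f x) = g y" by (simp add: fg exp_diff)
    qed
    have f: "(f has_derivative frechet_derivative f (at x)) (at x)"
      using assms(1) by (rule smooth_frechet)
    have "((\<lambda>y. f y / f x) has_derivative (\<lambda>v. frechet_derivative f (at x) v / f x)) (at x)"
      using f nz by (auto intro!: derivative_eq_intros)
    moreover have "(Ln has_derivative (\<lambda>v. inverse (f x / f x) * v)) (at (f x / f x))"
      using nz has_field_derivative_Ln[of "f x / f x"]
      by (simp add: has_field_derivative_def mult_1_left[abs_def])
    ultimately have "((\<lambda>y. Ln (f y / f x)) has_derivative
        (\<lambda>v. inverse (f x / f x) * (frechet_derivative f (at x) v / f x))) (at x)"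
      using diff_chain_at by (fastforce simp: o_def)
    then show "((\<lambda>y. g x + Ln (f y / f x)) has_derivative
        (\<lambda>v. inverse (f x) * frechet_derivative f (at x) v)) (at x)"
      using nz by (auto intro!: derivative_eq_intros simp: field_simps)
    show "g x + Ln (f x / f x) = g x" "x \<in> UNIV" using nz by auto
  qed
  then have eq: "frechet_derivative g (at x) = (\<lambda>v. inverse (f x) * frechet_derivative f (at x) v)" for x
    using frechet_derivative_at by metis
  \<comment> \<open>The derivative of \<open>g\<close> is expressed by \<open>f\<close> alone, so a
    case distinction replaces an induction.\<close>
  have "times_differentiable n g" for n
  proof (cases n)
    case (Suc m)
    have "smooth (\<lambda>x. inverse (f x) * frechet_derivative f (at x) v)" for v
      using assms(1) nz by (intro smooth_intros smooth_frechet_derivative)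
    then show ?thesis using D Suc
      by (auto simp: eq smooth_def differentiable_def)
  qed (use g in auto)
  then show ?thesis by (simp add: smooth_def)
qed

subsection \<open>Derivatives along vector fields\<close>

text \<open>The direction may vary with the point, so iterating \<open>dd\<close> also
  differentiates the coefficients of the vector field.\<close>

definition dd :: "('a::real_normed_vector \<Rightarrow> 'a) \<Rightarrow> ('a \<Rightarrow> 'b::real_normed_vector) \<Rightarrow> 'a \<Rightarrow> 'b" where
  "dd a f x = frechet_derivative f (at x) (a x)"

lemma dd_eqI: "(f has_derivative f') (at x) \<Longrightarrow> dd a f x = f' (a x)"
  unfolding dd_def using frechet_derivative_at by metis

text \<open>\<open>smooth\<close> speaks about derivatives in fixed directions only; expanding the
  direction in the basis reduces varying directions to these.\<close>

lemma frechet_basis_sum: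
  fixes f :: "'a::euclidean_space \<Rightarrow> 'b::real_normed_vector"
  assumes "smooth f"
  shows "frechet_derivative f (at x) v = (\<Sum>b\<in>Basis. (v \<bullet> b) *\<^sub>R frechet_derivative f (at x) b)"
proof -
  have "linear (frechet_derivative f (at x))"
    using smooth_frechet[OF assms] has_derivative_linear by blast
  then show ?thesis
    using linear_sum[of "frechet_derivative f (at x)" "\<lambda>b. (v \<bullet> b) *\<^sub>R b" Basis]
    by (simp add: euclidean_representation linear_cmul)
qed

lemma smooth_dd:
  fixes f :: "'a::euclidean_space \<Rightarrow> 'b::real_normed_vector"
  assumes "smooth f" "smooth a"
  shows "smooth (dd a f)"
proof -
  have "dd a f = (\<lambda>x. \<Sum>b\<in>Basis. (a x \<bullet> b) *\<^sub>R frechet_derivative f (at x) b)"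
    unfolding dd_def by (intro ext frechet_basis_sum assms)
  moreover have "smooth \<dots>"
    by (intro smooth_sum smooth_scaleR smooth_inner smooth_const smooth_frechet_derivative assms)
  ultimately show ?thesis by simp
qed

lemma dd_const: "dd a (\<lambda>x. c) x = 0"
  by (simp add: dd_def)

lemma dd_add: "smooth f \<Longrightarrow> smooth g \<Longrightarrow> dd a (\<lambda>x. f x + g x) x = dd a f x + dd a g x"
  by (rule dd_eqI[THEN trans]) (auto intro!: derivative_eq_intros smooth_frechet simp: dd_def)

lemma dd_diff: "smooth f \<Longrightarrow> smooth g \<Longrightarrow> dd a (\<lambda>x. f x - g x) x = dd a f x - dd a g x"
  by (rule dd_eqI[THEN trans]) (auto intro!: derivative_eq_intros smooth_frechet simp: dd_def)

lemma dd_minus: "smooth f \<Longrightarrow> dd a (\<lambda>x. - f x) x = - dd a f x"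
  by (rule dd_eqI[THEN trans]) (auto intro!: derivative_eq_intros smooth_frechet simp: dd_def)

lemma dd_bilinear:
  assumes "bounded_bilinear B" "smooth f" "smooth g"
  shows "dd a (\<lambda>x. B (f x) (g x)) x = B (dd a f x) (g x) + B (f x) (dd a g x)"
  using dd_eqI[OF bounded_bilinear.FDERIV[OF assms(1) smooth_frechet[OF assms(2)] smooth_frechet[OF assms(3)]], of a]
  by (simp add: dd_def)

lemmas dd_mult = dd_bilinear[OF bounded_bilinear_mult]
lemmas dd_scaleR = dd_bilinear[OF bounded_bilinear_scaleR]
lemmas dd_inner = dd_bilinear[OF bounded_bilinear_inner]

lemma dd_bounded_linear: "bounded_linear L \<Longrightarrow> smooth f \<Longrightarrow> dd a (\<lambda>x. L (f x)) x = L (dd a f x)"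
  by (rule dd_eqI[THEN trans], rule bounded_linear.has_derivative, assumption, erule smooth_frechet)
    (simp add: dd_def)

lemmas dd_nth = dd_bounded_linear[OF bounded_linear_vec_nth]

lemma dd_real_compose:
  fixes f :: "'a::real_normed_vector \<Rightarrow> real"
  assumes "(\<phi> has_real_derivative d) (at (f x))" "smooth f"
  shows "dd a (\<lambda>x. \<phi> (f x)) x = d * dd a f x"
proof -
  have "((\<lambda>x. \<phi> (f x)) has_derivative (\<lambda>v. d * frechet_derivative f (at x) v)) (at x)"
    using diff_chain_at[OF smooth_frechet[OF assms(2)] assms(1)[unfolded has_field_derivative_def]]
    by (simp add: o_def)
  from dd_eqI[OF this, of a] show ?thesis by (simp add: dd_def)
qed

lemma dd_divide:
  fixes f g :: "'a::real_normed_vector \<Rightarrow> real"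
  assumes "smooth f" "smooth g" "g x \<noteq> 0"
  shows "dd a (\<lambda>x. f x / g x) x = (dd a f x * g x - f x * dd a g x) / (g x * g x)"
  using dd_eqI[OF has_derivative_divide'[OF smooth_frechet[OF assms(1)] smooth_frechet[OF assms(2)] assms(3)], of a]
  by (simp add: dd_def)

lemma dd_field_add: "smooth f \<Longrightarrow> dd (\<lambda>x. a x + b x) f x = dd a f x + dd b f x"
  unfolding dd_def using smooth_frechet[THEN has_derivative_linear] linear_add by blast

lemma dd_field_diff: "smooth f \<Longrightarrow> dd (\<lambda>x. a x - b x) f x = dd a f x - dd b f x"
  unfolding dd_def using smooth_frechet[THEN has_derivative_linear] linear_diff by blast

lemma dd_field_scaleR: "smooth f \<Longrightarrow> dd (\<lambda>x. c x *\<^sub>R a x) f x = c x *\<^sub>R dd a f x"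
  unfolding dd_def using smooth_frechet[THEN has_derivative_linear] linear_cmul by blast

lemma dd_fst:
  assumes "smooth f"
  shows "dd c (\<lambda>z. f (fst z)) z = frechet_derivative f (at (fst z)) (fst (c z))"
  using dd_eqI[OF diff_chain_at[OF has_derivative_fst[OF has_derivative_ident] smooth_frechet[OF assms]], of c z]
  by (simp add: o_def)

lemma dd_snd:
  assumes "smooth f"
  shows "dd c (\<lambda>z. f (snd z)) z = frechet_derivative f (at (snd z)) (snd (c z))"
  using dd_eqI[OF diff_chain_at[OF has_derivative_snd[OF has_derivative_ident] smooth_frechet[OF assms]], of c z]
  by (simp add: o_def)

section \<open>Restriction to lines, symmetry of second derivatives, conditions at a minimum\<close>

lemma smooth_along_line:
  assumes "smooth f"
  shows "((\<lambda>t. f (x + t *\<^sub>R v)) has_vector_derivative frechet_derivative f (at (x + t *\<^sub>R v)) v) (at t)"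
proof -
  have "((\<lambda>t. x + t *\<^sub>R v) has_derivative (\<lambda>t. t *\<^sub>R v)) (at t)"
    by (auto intro!: derivative_eq_intros)
  from diff_chain_at[OF this smooth_frechet[OF assms]]
  have "((\<lambda>t. f (x + t *\<^sub>R v)) has_derivative
      (\<lambda>s. frechet_derivative f (at (x + t *\<^sub>R v)) (s *\<^sub>R v))) (at t)"
    by (simp add: o_def)
  moreover have "linear (frechet_derivative f (at (x + t *\<^sub>R v)))"
    using smooth_frechet[OF assms] has_derivative_linear by blast
  ultimately show ?thesis
    by (simp add: has_vector_derivative_def linear_cmul)
qed

lemma smooth_along_line_real:
  fixes f :: "'a::real_normed_vector \<Rightarrow> real"
  assumes "smooth f"
  shows "((\<lambda>t. f (x + t *\<^sub>R v)) has_real_derivative frechet_derivative f (at (x + t *\<^sub>R v)) v) (at t)"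
  using smooth_along_line[OF assms] by (simp add: has_real_derivative_iff_has_vector_derivative)

text \<open>The mean value theorem is applied first along \<open>v\<close>, then along
  \<open>w\<close>. The left-hand side is symmetric in \<open>v\<close> and \<open>w\<close>, which
  yields the symmetry of second derivatives.\<close>

lemma second_difference_mvt:
  fixes f :: "'a::real_normed_vector \<Rightarrow> real"
  assumes f: "smooth f" and h: "h > 0"
  obtains \<xi> \<eta> where "0 < \<xi>" "\<xi> < h" "0 < \<eta>" "\<eta> < h"
    "f (x + h *\<^sub>R v + h *\<^sub>R w) - f (x + h *\<^sub>R v) - f (x + h *\<^sub>R w) + f x =
      h * h * frechet_derivative (\<lambda>x. frechet_derivative f (at x) v) (at (x + \<xi> *\<^sub>R v + \<eta> *\<^sub>R w)) w"
proof -
  have "DERIV (\<lambda>t. f ((x + h *\<^sub>R w) + t *\<^sub>R v) - f (x + t *\<^sub>R v)) t :>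
      frechet_derivative f (at ((x + h *\<^sub>R w) + t *\<^sub>R v)) v - frechet_derivative f (at (x + t *\<^sub>R v)) v" for t
    by (intro DERIV_diff smooth_along_line_real f)
  from MVT2[OF h this] obtain \<xi> where \<xi>: "0 < \<xi>" "\<xi> < h" and
    e1: "f ((x + h *\<^sub>R w) + h *\<^sub>R v) - f (x + h *\<^sub>R v) - (f (x + h *\<^sub>R w) - f x) =
      h * (frechet_derivative f (at ((x + h *\<^sub>R w) + \<xi> *\<^sub>R v)) v - frechet_derivative f (at (x + \<xi> *\<^sub>R v)) v)"
    by auto
  have "DERIV (\<lambda>t. frechet_derivative f (at ((x + \<xi> *\<^sub>R v) + t *\<^sub>R w)) v) t :>
     frechet_derivative (\<lambda>x. frechet_derivative f (at x) v) (at ((x + \<xi> *\<^sub>R v) + t *\<^sub>R w)) w" for t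
    by (rule smooth_along_line_real[OF smooth_frechet_derivative[OF f]])
  from MVT2[OF h this] obtain \<eta> where \<eta>: "0 < \<eta>" "\<eta> < h" and
    e2: "frechet_derivative f (at ((x + \<xi> *\<^sub>R v) + h *\<^sub>R w)) v - frechet_derivative f (at (x + \<xi> *\<^sub>R v)) v =
      h * frechet_derivative (\<lambda>x. frechet_derivative f (at x) v) (at ((x + \<xi> *\<^sub>R v) + \<eta> *\<^sub>R w)) w"
    by auto
  show ?thesis
    using that[OF \<xi> \<eta>] e1 e2 by (simp add: algebra_simps)
qed

lemma frechet_symmetric_real:
  fixes f :: "'a::real_normed_vector \<Rightarrow> real"
  assumes f: "smooth f"
  shows "frechet_derivative (\<lambda>x. frechet_derivative f (at x) v) (at x) w =
    frechet_derivative (\<lambda>x. frechet_derivative f (at x) w) (at x) v"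
proof (rule ccontr)
  define A where "A = (\<lambda>y. frechet_derivative (\<lambda>x. frechet_derivative f (at x) v) (at y) w)"
  define B where "B = (\<lambda>y. frechet_derivative (\<lambda>x. frechet_derivative f (at x) w) (at y) v)"
  assume "\<not> ?thesis"
  then have e: "\<bar>A x - B x\<bar> / 2 > 0" by (simp add: A_def B_def)
  have "isCont A x" "isCont B x"
    unfolding A_def B_def
    by (intro smooth_isCont smooth_frechet_derivative f)+
  then obtain d where d: "d > 0" "\<And>y. dist y x < d \<Longrightarrow> dist (A y) (A x) < \<bar>A x - B x\<bar> / 2"
    "\<And>y. dist y x < d \<Longrightarrow> dist (B y) (B x) < \<bar>A x - B x\<bar> / 2"
    unfolding continuous_at_eps_delta using e
    by (metis (no_types, lifting) min_less_iff_conj)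
  define r where "r = norm v + norm w + 1"
  have r: "r > 0" unfolding r_def by (smt (verit) norm_ge_zero)
  \<comment> \<open>So small that the whole parallelogram spanned by \<open>h *\<^sub>R v\<close>
    and \<open>h *\<^sub>R w\<close> lies within distance \<open>d\<close> of
    \<open>x\<close>.\<close>
  define h where "h = d / (2 * r)"
  have h: "h > 0" using d r by (simp add: h_def)
  have near: "dist (x + \<xi> *\<^sub>R v + \<eta> *\<^sub>R w) x < d" if "0 < \<xi>" "\<xi> < h" "0 < \<eta>" "\<eta> < h" for \<xi> \<eta>
  proof -
    have "dist (x + \<xi> *\<^sub>R v + \<eta> *\<^sub>R w) x \<le> \<xi> * norm v + \<eta> * norm w"
      using that norm_triangle_ineq[of "\<xi> *\<^sub>R v" "\<eta> *\<^sub>R w"] by (simp add: dist_norm algebra_simps)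
    also have "\<dots> \<le> h * norm v + h * norm w"
      using that by (intro add_mono mult_right_mono) auto
    also have "\<dots> < h * (2 * r)"
      using h by (simp add: algebra_simps r_def add_nonneg_pos)
    also have "\<dots> = d" using r by (simp add: h_def)
    finally show ?thesis .
  qed
  obtain \<xi> \<eta> where 1: "0 < \<xi>" "\<xi> < h" "0 < \<eta>" "\<eta> < h"
    "f (x + h *\<^sub>R v + h *\<^sub>R w) - f (x + h *\<^sub>R v) - f (x + h *\<^sub>R w) + f x =
      h * h * A (x + \<xi> *\<^sub>R v + \<eta> *\<^sub>R w)"
    unfolding A_def by (rule second_difference_mvt[OF f h])
  obtain \<xi>' \<eta>' where 2: "0 < \<xi>'" "\<xi>' < h" "0 < \<eta>'" "\<eta>' < h"
    "f (x + h *\<^sub>R w + h *\<^sub>R v) - f (x + h *\<^sub>R w) - f (x + h *\<^sub>R v) + f x =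
      h * h * B (x + \<xi>' *\<^sub>R w + \<eta>' *\<^sub>R v)"
    unfolding B_def by (rule second_difference_mvt[OF f h])
  have "A (x + \<xi> *\<^sub>R v + \<eta> *\<^sub>R w) = B (x + \<eta>' *\<^sub>R v + \<xi>' *\<^sub>R w)"
    using 1(5) 2(5) h by (simp add: algebra_simps)
  moreover have "dist (A (x + \<xi> *\<^sub>R v + \<eta> *\<^sub>R w)) (A x) < \<bar>A x - B x\<bar> / 2"
    by (rule d(2)[OF near[OF 1(1-4)]])
  moreover have "dist (B (x + \<eta>' *\<^sub>R v + \<xi>' *\<^sub>R w)) (B x) < \<bar>A x - B x\<bar> / 2"
    by (rule d(3)[OF near[OF 2(3,4,1,2)]])
  ultimately show False by (simp add: dist_real_def abs_if split: if_splits)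
qed

lemma frechet_inner_left:
  assumes "smooth f"
  shows "frechet_derivative (\<lambda>x. f x \<bullet> c) (at x) v = frechet_derivative f (at x) v \<bullet> c"
  using frechet_derivative_at[OF has_derivative_inner_left[OF smooth_frechet[OF assms], of c x]]
  by metis

lemma frechet_symmetric:
  fixes f :: "'a::real_normed_vector \<Rightarrow> 'b::real_inner"
  assumes f: "smooth f"
  shows "frechet_derivative (\<lambda>x. frechet_derivative f (at x) v) (at x) w =
    frechet_derivative (\<lambda>x. frechet_derivative f (at x) w) (at x) v"
proof (rule vector_eq_rdot[THEN iffD1], rule allI)
  fix c
  show "frechet_derivative (\<lambda>x. frechet_derivative f (at x) v) (at x) w \<bullet> c =
    frechet_derivative (\<lambda>x. frechet_derivative f (at x) w) (at x) v \<bullet> c"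
    using frechet_symmetric_real[OF smooth_inner[OF f smooth_const[of c]], of v x w]
    by (simp add: frechet_inner_left f smooth_frechet_derivative)
qed

text \<open>The first summand is the Hessian, symmetric in the two directions; the second arises
  because \<open>b\<close> varies. In a commutator only the second summands survive, and they form
  the Lie bracket.\<close>

lemma dd_dd:
  fixes f :: "'a::euclidean_space \<Rightarrow> 'b::real_normed_vector"
  assumes f: "smooth f" and b: "smooth b"
  shows "dd a (dd b f) z =
    frechet_derivative (\<lambda>x. frechet_derivative f (at x) (b z)) (at z) (a z) +
    frechet_derivative f (at z) (dd a b z)"
proof -
  let ?D = "\<lambda>v x. frechet_derivative f (at x) v"
  have eq: "dd b f = (\<lambda>x. \<Sum>e\<in>Basis. (b x \<bullet> e) *\<^sub>R ?D e x)"
    unfolding dd_def by (intro ext frechet_basis_sum f)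
  have "(dd b f has_derivative
    (\<lambda>v. \<Sum>e\<in>Basis. (b z \<bullet> e) *\<^sub>R frechet_derivative (?D e) (at z) v +
       (frechet_derivative b (at z) v \<bullet> e) *\<^sub>R ?D e z)) (at z)"
    unfolding eq
    by (intro has_derivative_sum has_derivative_scaleR has_derivative_inner_left
        smooth_frechet smooth_frechet_derivative f b)
  from dd_eqI[OF this, of a]
  have "dd a (dd b f) z = (\<Sum>e\<in>Basis. (b z \<bullet> e) *\<^sub>R frechet_derivative (?D e) (at z) (a z)) +
       (\<Sum>e\<in>Basis. (dd a b z \<bullet> e) *\<^sub>R ?D e z)"
    by (simp only: sum.distrib dd_def)
  also have "(\<Sum>e\<in>Basis. (dd a b z \<bullet> e) *\<^sub>R ?D e z) = ?D (dd a b z) z"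
    by (rule frechet_basis_sum[OF f, symmetric])
  also have "(\<Sum>e\<in>Basis. (b z \<bullet> e) *\<^sub>R frechet_derivative (?D e) (at z) (a z)) =
      frechet_derivative (?D (b z)) (at z) (a z)"
  proof -
    have "?D (b z) = (\<lambda>x. \<Sum>e\<in>Basis. (b z \<bullet> e) *\<^sub>R ?D e x)"
      by (intro ext frechet_basis_sum f)
    moreover have "((\<lambda>x. \<Sum>e\<in>Basis. (b z \<bullet> e) *\<^sub>R ?D e x) has_derivative
      (\<lambda>v. \<Sum>e\<in>Basis. (b z \<bullet> e) *\<^sub>R frechet_derivative (?D e) (at z) v)) (at z)"
      by (intro has_derivative_sum has_derivative_scaleR_right smooth_frechet smooth_frechet_derivative f)
    ultimately show ?thesis
      by (simp only: frechet_derivative_at[symmetric])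
  qed
  finally show ?thesis .
qed

lemma dd_commutator:
  fixes f :: "'a::euclidean_space \<Rightarrow> 'b::real_inner"
  assumes f: "smooth f" and "smooth a" "smooth b"
  shows "dd a (dd b f) z - dd b (dd a f) z = frechet_derivative f (at z) (dd a b z - dd b a z)"
proof -
  have "linear (frechet_derivative f (at z))"
    using smooth_frechet[OF f] has_derivative_linear by blast
  then have "frechet_derivative f (at z) (dd a b z - dd b a z) =
      frechet_derivative f (at z) (dd a b z) - frechet_derivative f (at z) (dd b a z)"
    by (rule linear_diff)
  then show ?thesis
    unfolding dd_dd[OF f assms(2)] dd_dd[OF f assms(3)] frechet_symmetric[OF f, of "b z" z "a z"]
    by simp
qed

lemma frechet_zero_at_minimum:
  fixes f :: "'a::real_normed_vector \<Rightarrow> real"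
  assumes "smooth f" "\<And>x. f z \<le> f x"
  shows "frechet_derivative f (at z) v = 0"
proof -
  have "frechet_derivative f (at z) = (\<lambda>v. 0)"
    by (rule differential_zero_maxmin[OF UNIV_I open_UNIV smooth_frechet[OF assms(1)]])
      (use assms(2) in blast)
  then show ?thesis by (rule fun_cong)
qed

text \<open>At a minimum the first derivatives vanish, so the term of \<open>dd_dd\<close>
  containing derivatives of \<open>c\<close> drops out and only the Hessian along the fixed vector
  \<open>c z\<close> remains.\<close>

lemma second_derivative_test:
  fixes f :: "'a::euclidean_space \<Rightarrow> real"
  assumes f: "smooth f" and c: "smooth c" and min: "\<And>x. f z \<le> f x"
  shows "dd c (dd c f) z \<ge> 0"
proof -
  have 0: "frechet_derivative f (at z) v = 0" for v
    using frechet_zero_at_minimum[OF f min] .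
  define D where "D = (\<lambda>x. frechet_derivative f (at x) (c z))"
  have D: "smooth D" unfolding D_def by (intro smooth_frechet_derivative f)
  have "dd c (dd c f) z = frechet_derivative D (at z) (c z)"
    by (simp add: dd_dd f c 0 D_def)
  moreover have "frechet_derivative D (at z) (c z) \<ge> 0"
  proof (rule ccontr)
    assume "\<not> ?thesis"
    then have neg: "frechet_derivative D (at z) (c z) < 0" by simp
    have D0: "D z = 0" by (simp add: D_def 0)
    have "DERIV (\<lambda>t. D (z + t *\<^sub>R c z)) 0 :> frechet_derivative D (at z) (c z)"
      using smooth_along_line_real[OF D, of z "c z" 0] by simp
    from DERIV_neg_dec_right[OF this neg] obtain d where d: "d > 0"
      "\<And>h. 0 < h \<Longrightarrow> h < d \<Longrightarrow> D (z + h *\<^sub>R c z) < 0"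
      unfolding D0 add_0_left scale_zero_left add_0_right by blast
    have "\<exists>t>0. t < d / 2 \<and>
      f (z + (d / 2) *\<^sub>R c z) - f (z + 0 *\<^sub>R c z) = (d / 2 - 0) * D (z + t *\<^sub>R c z)"
      unfolding D_def by (rule MVT2) (use d(1) in \<open>auto intro: smooth_along_line_real[OF f]\<close>)
    then obtain t where t: "0 < t" "t < d / 2" and
      eq: "f (z + (d / 2) *\<^sub>R c z) - f (z + 0 *\<^sub>R c z) = (d / 2 - 0) * D (z + t *\<^sub>R c z)"
      by blast
    have "D (z + t *\<^sub>R c z) < 0" by (rule d(2)) (use t d(1) in linarith)+
    with d(1) have "(d / 2 - 0) * D (z + t *\<^sub>R c z) < 0" by (simp add: mult_pos_neg)
    with eq min[of "z + (d / 2) *\<^sub>R c z"] show False by simp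
  qed
  ultimately show ?thesis by simp
qed

section \<open>Moving frames of surfaces in the three-sphere\<close>

lemma orthonormal4_expand:
  fixes e0 e1 e2 e3 v :: "real^4"
  assumes "e0 \<bullet> e0 = 1" "e1 \<bullet> e1 = 1" "e2 \<bullet> e2 = 1" "e3 \<bullet> e3 = 1"
    and "e0 \<bullet> e1 = 0" "e0 \<bullet> e2 = 0" "e0 \<bullet> e3 = 0" "e1 \<bullet> e2 = 0" "e1 \<bullet> e3 = 0" "e2 \<bullet> e3 = 0"
  shows "v = (v \<bullet> e0) *\<^sub>R e0 + (v \<bullet> e1) *\<^sub>R e1 + (v \<bullet> e2) *\<^sub>R e2 + (v \<bullet> e3) *\<^sub>R e3"
proof -
  have "e1 \<bullet> e0 = 0" "e2 \<bullet> e0 = 0" "e3 \<bullet> e0 = 0" "e2 \<bullet> e1 = 0" "e3 \<bullet> e1 = 0" "e3 \<bullet> e2 = 0"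
    using assms by (simp_all add: inner_commute)
  note o = assms this
  let ?B = "{e0, e1, e2, e3}"
  have ne: "e0 \<noteq> e1" "e0 \<noteq> e2" "e0 \<noteq> e3" "e1 \<noteq> e2" "e1 \<noteq> e3" "e2 \<noteq> e3" using o by auto
  have "pairwise orthogonal ?B" by (auto simp: pairwise_def orthogonal_def o)
  moreover have "0 \<notin> ?B" using o by auto
  ultimately have "independent ?B" by (rule pairwise_orthogonal_independent)
  moreover have "card ?B = 4" using ne by simp
  ultimately have sp: "span ?B = UNIV"
    using card_eq_dim[of ?B UNIV] by (auto simp: dim_UNIV)
  define w where "w = v - ((v \<bullet> e0) *\<^sub>R e0 + (v \<bullet> e1) *\<^sub>R e1 + (v \<bullet> e2) *\<^sub>R e2 + (v \<bullet> e3) *\<^sub>R e3)"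
  have "orthogonal w y" if "y \<in> ?B" for y
    using that by (auto simp: orthogonal_def w_def inner_diff_left inner_add_left o)
  then have "orthogonal w w"
    using orthogonal_to_span[of w ?B w] sp by (auto simp: orthogonal_commute)
  then show ?thesis by (simp add: orthogonal_def w_def)
qed

lemma dd_inner_const:
  assumes "smooth U" "smooth V" "\<And>x. U x \<bullet> V x = k"
  shows "dd c U x \<bullet> V x = - (U x \<bullet> dd c V x)"
  using dd_inner[OF assms(1,2), of c x] by (simp add: assms(3) dd_const)

text \<open>\<open>a\<close> and \<open>b\<close> are fields on the parameter plane which the
  differential of \<open>F\<close> carries to the orthonormal tangent frame \<open>E1\<close>,
  \<open>E2\<close>; differentiating along them replaces covariant calculus in coordinates.\<close>

locale frame =
  fixes F N E1 E2 :: "real^2 \<Rightarrow> real^4" and a b :: "real^2 \<Rightarrow> real^2"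
  assumes smF: "smooth F" and smN: "smooth N" and smE1: "smooth E1" and smE2: "smooth E2"
    and sma: "smooth a" and smb: "smooth b"
    and orth_norm: "F x \<bullet> F x = 1" "N x \<bullet> N x = 1" "E1 x \<bullet> E1 x = 1" "E2 x \<bullet> E2 x = 1"
    and orth_zero: "F x \<bullet> N x = 0" "F x \<bullet> E1 x = 0" "F x \<bullet> E2 x = 0"
      "N x \<bullet> E1 x = 0" "N x \<bullet> E2 x = 0" "E1 x \<bullet> E2 x = 0"
    and daF': "dd a F x = E1 x" and dbF': "dd b F x = E2 x"
begin

lemma daF: "dd a F = E1" and dbF: "dd b F = E2"
  by (simp_all add: fun_eq_iff daF' dbF')

lemma orth: 
  "F x \<bullet> F x = 1" "N x \<bullet> N x = 1" "E1 x \<bullet> E1 x = 1" "E2 x \<bullet> E2 x = 1"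
  "F x \<bullet> N x = 0" "F x \<bullet> E1 x = 0" "F x \<bullet> E2 x = 0"
  "N x \<bullet> E1 x = 0" "N x \<bullet> E2 x = 0" "E1 x \<bullet> E2 x = 0"
  "N x \<bullet> F x = 0" "E1 x \<bullet> F x = 0" "E2 x \<bullet> F x = 0"
  "E1 x \<bullet> N x = 0" "E2 x \<bullet> N x = 0" "E2 x \<bullet> E1 x = 0"
  using orth_norm orth_zero by (simp_all add: inner_commute)

lemma expand: "v = (v \<bullet> E1 x) *\<^sub>R E1 x + (v \<bullet> E2 x) *\<^sub>R E2 x + (v \<bullet> N x) *\<^sub>R N x + (v \<bullet> F x) *\<^sub>R F x"
  by (rule orthonormal4_expand) (simp_all add: orth)

text \<open>\<open>p\<close> and \<open>r\<close> are the coefficients of the Levi-Civita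
  connection: up to sign, the geodesic curvatures of the integral curves of \<open>a\<close> and of
  \<open>b\<close>. The remaining coefficient of the second fundamental form equals
  \<open>h12\<close> by \<open>sym_h\<close>.\<close>

definition "p x = dd a E1 x \<bullet> E2 x"
definition "r x = dd b E1 x \<bullet> E2 x"
definition "h11 x = dd a N x \<bullet> E1 x"
definition "h12 x = dd a N x \<bullet> E2 x"
definition "h22 x = dd b N x \<bullet> E2 x"

lemma smooth_coeffs: "smooth p" "smooth r" "smooth h11" "smooth h12" "smooth h22"
proof -
  have "p = (\<lambda>x. dd a E1 x \<bullet> E2 x)" "r = (\<lambda>x. dd b E1 x \<bullet> E2 x)"
    "h11 = (\<lambda>x. dd a N x \<bullet> E1 x)" "h12 = (\<lambda>x. dd a N x \<bullet> E2 x)" "h22 = (\<lambda>x. dd b N x \<bullet> E2 x)"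
    by (simp_all add: fun_eq_iff p_def r_def h11_def h12_def h22_def)
  then show "smooth p" "smooth r" "smooth h11" "smooth h12" "smooth h22"
    by (auto intro!: smooth_inner smooth_dd smF smN smE1 smE2 sma smb)
qed

lemmas sm = smF smN smE1 smE2 sma smb smooth_coeffs

lemma frechet_F: "frechet_derivative F (at x) (s *\<^sub>R a x + t *\<^sub>R b x) = s *\<^sub>R E1 x + t *\<^sub>R E2 x"
proof -
  have "linear (frechet_derivative F (at x))"
    using smooth_frechet[OF smF] has_derivative_linear by blast
  then show ?thesis
    using daF' dbF' by (simp add: linear_add linear_cmul dd_def)
qed

lemma plane_basis: obtains s t where "v = s *\<^sub>R a x + t *\<^sub>R b x"
proof -
  have 0: "s = 0 \<and> t = 0" if "s *\<^sub>R a x + t *\<^sub>R b x = 0" for s t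
  proof -
    have "s *\<^sub>R E1 x + t *\<^sub>R E2 x = 0"
      using frechet_F[of x s t] frechet_F[of x 0 0] that by simp
    then have "(s *\<^sub>R E1 x + t *\<^sub>R E2 x) \<bullet> E1 x = 0" "(s *\<^sub>R E1 x + t *\<^sub>R E2 x) \<bullet> E2 x = 0" by simp_all
    then show ?thesis by (simp add: inner_add_left orth)
  qed
  have ab: "a x \<noteq> b x" using 0[of 1 "-1"] by auto
  have "a x \<noteq> 0" "b x \<noteq> 0" using 0[of 1 0] 0[of 0 1] by auto
  have "independent {a x, b x}"
    unfolding dependent_explicit
  proof
    assume "\<exists>T u. finite T \<and> T \<subseteq> {a x, b x} \<and> (\<Sum>v\<in>T. u v *\<^sub>R v) = 0 \<and> (\<exists>v\<in>T. u v \<noteq> 0)"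
    then obtain T u where T: "finite T" "T \<subseteq> {a x, b x}" and s: "(\<Sum>v\<in>T. u v *\<^sub>R v) = 0"
      and nz: "\<exists>v\<in>T. u v \<noteq> 0" by blast
    define u' where "u' v = (if v \<in> T then u v else 0)" for v
    have "(\<Sum>v\<in>T. u v *\<^sub>R v) = (\<Sum>v\<in>{a x, b x}. u' v *\<^sub>R v)"
      using T by (intro sum.mono_neutral_cong_left) (auto simp: u'_def)
    then have "u' (a x) *\<^sub>R a x + u' (b x) *\<^sub>R b x = 0" using s ab by simp
    from 0[OF this] show False using T nz by (auto simp: u'_def split: if_splits)
  qed
  moreover have "card {a x, b x} = 2" using ab by simp
  ultimately have "span {a x, b x} = UNIV"
    using card_eq_dim[of "{a x, b x}" UNIV] by (auto simp: dim_UNIV)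
  then have "v \<in> span {a x, b x}" by simp
  then obtain s t where "v = s *\<^sub>R a x + t *\<^sub>R b x"
    by (auto simp: span_insert span_singleton) (metis add_diff_cancel_left' diff_add_cancel)
  then show ?thesis using that by blast
qed

lemma tangent: "frechet_derivative F (at x) v \<bullet> N x = 0" "frechet_derivative F (at x) v \<bullet> F x = 0"
proof -
  obtain s t where v: "v = s *\<^sub>R a x + t *\<^sub>R b x" by (rule plane_basis)
  show "frechet_derivative F (at x) v \<bullet> N x = 0" "frechet_derivative F (at x) v \<bullet> F x = 0"
    unfolding v frechet_F by (simp_all add: inner_add_left orth)
qed

lemma commutator_F: "dd a E2 x - dd b E1 x = frechet_derivative F (at x) (dd a b x - dd b a x)"
  using dd_commutator[OF smF sma smb, of x] by (simp add: daF dbF)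

text \<open>The asymmetry of the form is the normal component of \<open>dd a E2 - dd b E1\<close>,
  which is the image of a Lie bracket under the differential of \<open>F\<close> and hence
  tangent.\<close>

lemma sym_h: "dd b N x \<bullet> E1 x = h12 x"
proof -
  have "dd b N x \<bullet> E1 x - h12 x = N x \<bullet> (dd a E2 x - dd b E1 x)"
    using dd_inner_const[OF smN smE1 orth(8), of b x] dd_inner_const[OF smN smE2 orth(9), of a x]
    by (simp add: h12_def inner_diff_right)
  also have "\<dots> = 0" unfolding commutator_F by (simp add: tangent inner_commute[of "N x"])
  finally show ?thesis by simp
qed

text \<open>Formulas of Gauss and Weingarten: every component in the basis \<open>E1\<close>,
  \<open>E2\<close>, \<open>N\<close>, \<open>F\<close> either is a coefficient by definition or is
  carried to one by differentiating an orthogonality relation. The terms \<open>- F x\<close> come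
  from the curvature of the three-sphere.\<close>

lemma structure_eqs:
  "dd a F x = E1 x" "dd b F x = E2 x"
  "dd a N x = h11 x *\<^sub>R E1 x + h12 x *\<^sub>R E2 x" "dd b N x = h12 x *\<^sub>R E1 x + h22 x *\<^sub>R E2 x"
  "dd a E1 x = p x *\<^sub>R E2 x - h11 x *\<^sub>R N x - F x" "dd b E1 x = r x *\<^sub>R E2 x - h12 x *\<^sub>R N x"
  "dd a E2 x = - p x *\<^sub>R E1 x - h12 x *\<^sub>R N x" "dd b E2 x = - r x *\<^sub>R E1 x - h22 x *\<^sub>R N x - F x"
proof -
  show "dd a F x = E1 x" "dd b F x = E2 x" by (fact daF' dbF')+
  note ic = dd_inner_const[OF smN smN orth(2), of _ x] dd_inner_const[OF smE1 smE1 orth(3), of _ x]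
    dd_inner_const[OF smE2 smE2 orth(4), of _ x] dd_inner_const[OF smN smF orth(11), of _ x]
    dd_inner_const[OF smE1 smF orth(12), of _ x] dd_inner_const[OF smE2 smF orth(13), of _ x]
    dd_inner_const[OF smE1 smN orth(14), of _ x] dd_inner_const[OF smE2 smN orth(15), of _ x]
    dd_inner_const[OF smE2 smE1 orth(16), of _ x]
  have self: "dd c N x \<bullet> N x = 0" "dd c E1 x \<bullet> E1 x = 0" "dd c E2 x \<bullet> E2 x = 0" for c
    using ic(1)[of c] ic(2)[of c] ic(3)[of c] by (simp_all add: inner_commute)
  show "dd a N x = h11 x *\<^sub>R E1 x + h12 x *\<^sub>R E2 x"
    by (subst expand[of "dd a N x" x]) (simp add: self ic(4) daF' orth h11_def h12_def)
  show "dd b N x = h12 x *\<^sub>R E1 x + h22 x *\<^sub>R E2 x"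
    by (subst expand[of "dd b N x" x]) (simp add: self ic(4) dbF' orth h22_def sym_h)
  show "dd a E1 x = p x *\<^sub>R E2 x - h11 x *\<^sub>R N x - F x"
    by (subst expand[of "dd a E1 x" x])
      (simp add: self ic(5,7) daF' orth p_def h11_def inner_commute[of "E1 x" "dd a N x"])
  show "dd b E1 x = r x *\<^sub>R E2 x - h12 x *\<^sub>R N x"
    by (subst expand[of "dd b E1 x" x])
      (simp add: self ic(5,7) dbF' orth r_def sym_h inner_commute[of "E1 x" "dd b N x"])
  show "dd a E2 x = - p x *\<^sub>R E1 x - h12 x *\<^sub>R N x"
    by (subst expand[of "dd a E2 x" x])
      (simp add: self ic(6,8,9) daF' orth p_def h12_def inner_commute[of "E2 x" "dd a N x"]
        inner_commute[of "E2 x" "dd a E1 x"])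
  show "dd b E2 x = - r x *\<^sub>R E1 x - h22 x *\<^sub>R N x - F x"
    by (subst expand[of "dd b E2 x" x])
      (simp add: self ic(6,8,9) dbF' orth r_def h22_def inner_commute[of "E2 x" "dd b N x"]
        inner_commute[of "E2 x" "dd b E1 x"])
qed

text \<open>The bracket is determined by its image \<open>dd a E2 - dd b E1\<close> under the
  differential of \<open>F\<close>, whose components are read off from the structure equations; this
  is the vanishing of the torsion.\<close>

lemma bracket: "dd a b x - dd b a x = - p x *\<^sub>R a x - r x *\<^sub>R b x"
proof -
  obtain s t where v: "dd a b x - dd b a x = s *\<^sub>R a x + t *\<^sub>R b x" by (rule plane_basis)
  have "dd a E2 x - dd b E1 x = s *\<^sub>R E1 x + t *\<^sub>R E2 x"
    unfolding commutator_F v frechet_F ..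
  then have "(dd a E2 x - dd b E1 x) \<bullet> E1 x = s" "(dd a E2 x - dd b E1 x) \<bullet> E2 x = t"
    by (simp_all add: inner_add_left orth)
  then have "s = - p x" "t = - r x"
    by (simp_all add: structure_eqs inner_diff_left orth)
  then show ?thesis using v by simp
qed

lemma commutator:
  fixes f :: "real^2 \<Rightarrow> 'b::real_inner"
  assumes "smooth f"
  shows "dd a (dd b f) x = dd b (dd a f) x - p x *\<^sub>R dd a f x - r x *\<^sub>R dd b f x"
proof -
  have l: "linear (frechet_derivative f (at x))"
    using smooth_frechet[OF assms] has_derivative_linear by blast
  have "dd a (dd b f) x - dd b (dd a f) x = frechet_derivative f (at x) (- p x *\<^sub>R a x - r x *\<^sub>R b x)"
    using dd_commutator[OF assms sma smb, of x] by (simp add: bracket)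
  also have "\<dots> = - p x *\<^sub>R dd a f x - r x *\<^sub>R dd b f x"
    unfolding linear_diff[OF l] linear_cmul[OF l] dd_def ..
  finally show ?thesis by (simp add: algebra_simps)
qed

lemma frechet_coords:
  assumes "smooth f"
  shows "frechet_derivative f (at x) v =
    (frechet_derivative F (at x) v \<bullet> E1 x) *\<^sub>R dd a f x + (frechet_derivative F (at x) v \<bullet> E2 x) *\<^sub>R dd b f x"
proof -
  obtain s t where v: "v = s *\<^sub>R a x + t *\<^sub>R b x" by (rule plane_basis)
  have l: "linear (frechet_derivative f (at x))"
    using smooth_frechet[OF assms] has_derivative_linear by blast
  show ?thesis
    unfolding v frechet_F by (simp add: linear_add[OF l] linear_cmul[OF l] dd_def inner_add_left orth)
qed

text \<open>These are the components along \<open>E1\<close> and \<open>E2\<close> of the commutator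
  applied to \<open>N\<close>.\<close>

lemma codazzi:
  "dd a h12 x - dd b h11 x = p x * (h22 x - h11 x) - 2 * r x * h12 x"
  "dd a h22 x - dd b h12 x = r x * (h11 x - h22 x) - 2 * p x * h12 x"
proof -
  have N: "dd b N = (\<lambda>x. h12 x *\<^sub>R E1 x + h22 x *\<^sub>R E2 x)" "dd a N = (\<lambda>x. h11 x *\<^sub>R E1 x + h12 x *\<^sub>R E2 x)"
    by (simp_all add: fun_eq_iff structure_eqs)
  note c = commutator[OF smN, of x, unfolded N]
  have "(dd a (\<lambda>x. h12 x *\<^sub>R E1 x + h22 x *\<^sub>R E2 x) x) \<bullet> E1 x = dd a h12 x - h22 x * p x"
    "(dd a (\<lambda>x. h12 x *\<^sub>R E1 x + h22 x *\<^sub>R E2 x) x) \<bullet> E2 x = dd a h22 x + h12 x * p x"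
    "(dd b (\<lambda>x. h11 x *\<^sub>R E1 x + h12 x *\<^sub>R E2 x) x) \<bullet> E1 x = dd b h11 x - h12 x * r x"
    "(dd b (\<lambda>x. h11 x *\<^sub>R E1 x + h12 x *\<^sub>R E2 x) x) \<bullet> E2 x = dd b h12 x + h11 x * r x"
    by (simp_all add: dd_add dd_scaleR smooth_scaleR sm structure_eqs inner_add_left inner_diff_left orth
        algebra_simps)
  with arg_cong[OF c, of "\<lambda>v. v \<bullet> E1 x"] arg_cong[OF c, of "\<lambda>v. v \<bullet> E2 x"]
  show "dd a h12 x - dd b h11 x = p x * (h22 x - h11 x) - 2 * r x * h12 x"
    "dd a h22 x - dd b h12 x = r x * (h11 x - h22 x) - 2 * p x * h12 x"
    by (simp_all add: inner_add_left inner_diff_left orth algebra_simps)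
qed

text \<open>This is the component along \<open>E2\<close> of the commutator applied to
  \<open>E1\<close>; the summand 1 is the curvature of the three-sphere.\<close>

lemma gauss: "dd b p x - dd a r x = 1 + h11 x * h22 x - (h12 x)\<^sup>2 + (p x)\<^sup>2 + (r x)\<^sup>2"
proof -
  have E: "dd b E1 = (\<lambda>x. r x *\<^sub>R E2 x - h12 x *\<^sub>R N x)"
    "dd a E1 = (\<lambda>x. p x *\<^sub>R E2 x - h11 x *\<^sub>R N x - F x)"
    by (simp_all add: fun_eq_iff structure_eqs)
  note c = commutator[OF smE1, of x, unfolded E]
  have "(dd a (\<lambda>x. r x *\<^sub>R E2 x - h12 x *\<^sub>R N x) x) \<bullet> E2 x = dd a r x - h12 x * h12 x"
    "(dd b (\<lambda>x. p x *\<^sub>R E2 x - h11 x *\<^sub>R N x - F x) x) \<bullet> E2 x = dd b p x - h11 x * h22 x - 1"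
    by (simp_all add: dd_diff dd_scaleR smooth_scaleR smooth_diff sm structure_eqs inner_add_left inner_diff_left orth)
  with arg_cong[OF c, of "\<lambda>v. v \<bullet> E2 x"] show ?thesis
    by (simp add: inner_add_left inner_diff_left orth algebra_simps power2_eq_square)
qed

end

section \<open>Doubly periodic functions on the plane\<close>

abbreviation pder :: "2 \<Rightarrow> (real^2 \<Rightarrow> 'b::real_normed_vector) \<Rightarrow> real^2 \<Rightarrow> 'b" where
  "pder i \<equiv> dd (\<lambda>_. axis i 1)"

definition pt :: "real \<Rightarrow> real \<Rightarrow> real^2" where
  "pt s t = s *\<^sub>R axis 1 1 + t *\<^sub>R axis 2 1"

lemma pt_nth [simp]: "pt s t $ 1 = s" "pt s t $ 2 = t"
  by (simp_all add: pt_def axis_def)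

lemma pt_eta [simp]: "pt (x $ 1) (x $ 2) = x"
  by (simp add: vec_eq_iff forall_2)

lemma pt_add: "pt s t + pt s' t' = pt (s + s') (t + t')"
  by (simp add: vec_eq_iff forall_2)

definition doubly_periodic :: "(real^2 \<Rightarrow> 'b) \<Rightarrow> bool" where
  "doubly_periodic f \<longleftrightarrow> (\<forall>x m n. m \<in> \<int> \<longrightarrow> n \<in> \<int> \<longrightarrow> f (x + pt (2 * pi * m) (2 * pi * n)) = f x)"

lemma doubly_periodicD:
  "doubly_periodic f \<Longrightarrow> m \<in> \<int> \<Longrightarrow> n \<in> \<int> \<Longrightarrow> f (x + pt (2 * pi * m) (2 * pi * n)) = f x"
  by (simp add: doubly_periodic_def)

lemma frechet_affine:
  assumes "bounded_linear L" "smooth f"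
  shows "frechet_derivative (\<lambda>x. f (L x + c)) (at x) v = frechet_derivative f (at (L x + c)) (L v)"
proof -
  have "((\<lambda>x. L x + c) has_derivative L) (at x)"
    using has_derivative_add[OF bounded_linear_imp_has_derivative[OF assms(1)] has_derivative_const[of c]]
    by simp
  from frechet_derivative_at[OF diff_chain_at[OF this smooth_frechet[OF assms(2)]]]
  show ?thesis by (simp add: o_def fun_eq_iff)
qed

lemma frechet_periodic:
  assumes "smooth f" "doubly_periodic f"
  shows "doubly_periodic (\<lambda>x. frechet_derivative f (at x) v)"
  unfolding doubly_periodic_def
proof (intro allI impI)
  fix x :: "real^2" and m n :: real assume mn: "m \<in> \<int>" "n \<in> \<int>"
  then have "(\<lambda>x. f (x + pt (2 * pi * m) (2 * pi * n))) = f"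
    using assms(2) by (auto simp: doubly_periodic_def)
  then show "frechet_derivative f (at (x + pt (2 * pi * m) (2 * pi * n))) v = frechet_derivative f (at x) v"
    using frechet_affine[OF bounded_linear_ident assms(1), of "pt (2 * pi * m) (2 * pi * n)" x v] by simp
qed

lemma dd_periodic:
  assumes "smooth f" "doubly_periodic f" "doubly_periodic a"
  shows "doubly_periodic (dd a f)"
  using frechet_periodic[OF assms(1,2)] assms(3) by (simp add: doubly_periodic_def dd_def)

lemma doubly_periodic_box:
  obtains m n where "m \<in> \<int>" "n \<in> \<int>" "x + pt (2 * pi * m) (2 * pi * n) \<in> cbox 0 (pt (2 * pi) (2 * pi))"
proof -
  have "0 \<le> t + 2 * pi * of_int (- \<lfloor>t / (2 * pi)\<rfloor>)" "t + 2 * pi * of_int (- \<lfloor>t / (2 * pi)\<rfloor>) \<le> 2 * pi" for t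
  proof -
    have "of_int \<lfloor>t / (2 * pi)\<rfloor> * (2 * pi) \<le> t" "t < (of_int \<lfloor>t / (2 * pi)\<rfloor> + 1) * (2 * pi)"
      by (intro floor_divide_lower floor_divide_upper; simp)+
    then show "0 \<le> t + 2 * pi * of_int (- \<lfloor>t / (2 * pi)\<rfloor>)" "t + 2 * pi * of_int (- \<lfloor>t / (2 * pi)\<rfloor>) \<le> 2 * pi"
      by (simp_all add: algebra_simps)
  qed
  then show ?thesis
    by (intro that[of "of_int (- \<lfloor>x $ 1 / (2 * pi)\<rfloor>)" "of_int (- \<lfloor>x $ 2 / (2 * pi)\<rfloor>)"])
      (auto simp: mem_box_cart forall_2)
qed

lemma doubly_periodic_bounds:
  fixes f :: "real^2 \<Rightarrow> real"
  assumes "continuous_on UNIV f" "doubly_periodic f"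
  obtains u v where "\<And>x. f u \<le> f x" "\<And>x. f x \<le> f v"
proof -
  let ?B = "cbox 0 (pt (2 * pi) (2 * pi))"
  have c: "continuous_on ?B f" using assms(1) continuous_on_subset by blast
  have ne: "?B \<noteq> {}" using doubly_periodic_box by (metis empty_iff)
  obtain u v where uv: "\<And>x. x \<in> ?B \<Longrightarrow> f u \<le> f x" "\<And>x. x \<in> ?B \<Longrightarrow> f x \<le> f v"
    using continuous_attains_inf[OF compact_cbox ne c] continuous_attains_sup[OF compact_cbox ne c] by blast
  have "f u \<le> f x \<and> f x \<le> f v" for x
  proof -
    obtain m n where "m \<in> \<int>" "n \<in> \<int>" "x + pt (2 * pi * m) (2 * pi * n) \<in> ?B"
      by (rule doubly_periodic_box)
    then show ?thesis using uv doubly_periodicD[OF assms(2)] by metis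
  qed
  then show ?thesis using that by blast
qed

lemma doubly_periodic_compose2:
  "doubly_periodic f \<Longrightarrow> doubly_periodic g \<Longrightarrow> doubly_periodic (\<lambda>x. h (f x) (g x))"
  by (simp add: doubly_periodic_def)

lemma doubly_periodic_const: "doubly_periodic (\<lambda>x. c)"
  by (simp add: doubly_periodic_def)

text \<open>The side \<open>T\<close> stays free because the box has to contain the cones used
  below, which may be longer than one period.\<close>

definition box_integral :: "real \<Rightarrow> real \<Rightarrow> real \<Rightarrow> (real^2 \<Rightarrow> real) \<Rightarrow> real" where
  "box_integral A B T f = integral (cbox (A, B) (A + T, B + T)) (\<lambda>(s, t). f (pt s t))"

lemma continuous_on_pt: "continuous_on UNIV f \<Longrightarrow> continuous_on S (\<lambda>(s, t). f (pt s t))"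
  unfolding pt_def case_prod_unfold
  by (rule continuous_on_compose2[of UNIV f]) (auto intro!: continuous_intros)

lemma continuous_on_pt_compose:
  "continuous_on UNIV f \<Longrightarrow> continuous_on S g \<Longrightarrow> continuous_on S h \<Longrightarrow> continuous_on S (\<lambda>x. f (pt (g x) (h x)))"
  unfolding pt_def
  by (rule continuous_on_compose2[of UNIV f]) (auto intro!: continuous_intros)

lemma box_integrable:
  fixes f :: "real^2 \<Rightarrow> real"
  shows "continuous_on UNIV f \<Longrightarrow> (\<lambda>(s, t). f (pt s t)) integrable_on cbox (A, B) (A + T, B + T)"
  by (rule integrable_continuous[OF continuous_on_pt])

lemma box_integral_cmult: "box_integral A B T (\<lambda>x. c * f x) = c * box_integral A B T f"
  unfolding box_integral_def by (simp add: case_prod_unfold)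

lemma box_integral_diff:
  assumes "continuous_on UNIV f" "continuous_on UNIV g"
  shows "box_integral A B T (\<lambda>x. f x - g x) = box_integral A B T f - box_integral A B T g"
  using integral_diff[OF box_integrable[OF assms(1)] box_integrable[OF assms(2)]]
  unfolding box_integral_def by (simp add: case_prod_unfold)

lemma box_integral_mono:
  assumes "continuous_on UNIV f" "continuous_on UNIV g" "\<And>x. f x \<le> g x"
  shows "box_integral A B T f \<le> box_integral A B T g"
  unfolding box_integral_def
  by (rule integral_le[OF box_integrable[OF assms(1)] box_integrable[OF assms(2)]]) (auto simp: assms(3))

lemma box_integral_const: "T \<ge> 0 \<Longrightarrow> box_integral A B T (\<lambda>x. c) = T * T * c"
  unfolding box_integral_def case_prod_unfold by (simp add: content_Pair)

lemma box_integral_iterated: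
  assumes "continuous_on UNIV f"
  shows "box_integral A B T f = integral {A..A+T} (\<lambda>s. integral {B..B+T} (\<lambda>t. f (pt s t)))"
    "box_integral A B T f = integral {B..B+T} (\<lambda>t. integral {A..A+T} (\<lambda>s. f (pt s t)))"
proof -
  show 1: "box_integral A B T f = integral {A..A+T} (\<lambda>s. integral {B..B+T} (\<lambda>t. f (pt s t)))"
    using integral_prod_continuous[OF continuous_on_pt[OF assms], of A B "A+T" "B+T"]
    by (simp add: box_integral_def)
  show "box_integral A B T f = integral {B..B+T} (\<lambda>t. integral {A..A+T} (\<lambda>s. f (pt s t)))"
    using integral_swap_continuous[OF continuous_on_pt[OF assms], of A "A+T" B "B+T"] 1 by simp
qed

text \<open>Stokes' theorem on the torus: integrating first in direction \<open>i\<close> leaves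
  differences of values of \<open>u\<close> that are whole periods apart.\<close>

lemma box_integral_pder:
  fixes u :: "real^2 \<Rightarrow> real"
  assumes u: "smooth u" "doubly_periodic u" and T: "T = 2 * pi * m" "m \<in> \<int>" "m \<ge> 0"
  shows "box_integral A B T (pder i u) = 0"
proof -
  have T0: "T \<ge> 0" using T by simp
  have per: "u (pt (s + T) t) = u (pt s t)" "u (pt s (t + T)) = u (pt s t)" for s t
    using doubly_periodicD[OF u(2), of m 0 "pt s t"] doubly_periodicD[OF u(2), of 0 m "pt s t"] T
    by (simp_all add: pt_add)
  have c: "continuous_on UNIV (pder i u)"
    by (rule smooth_continuous_on) (intro smooth_dd u smooth_const)
  have d1: "((\<lambda>s. pder 1 u (pt s t)) has_integral (u (pt (A + T) t) - u (pt A t))) {A..A+T}" for t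
  proof (rule fundamental_theorem_of_calculus)
    fix s
    have "((\<lambda>s. u (t *\<^sub>R axis 2 1 + s *\<^sub>R axis 1 1)) has_vector_derivative
        frechet_derivative u (at (t *\<^sub>R axis 2 1 + s *\<^sub>R axis 1 1)) (axis 1 1)) (at s)"
      by (rule smooth_along_line[OF u(1)])
    then show "((\<lambda>s. u (pt s t)) has_vector_derivative pder 1 u (pt s t)) (at s within {A..A+T})"
      by (simp add: pt_def dd_def add.commute has_vector_derivative_at_within)
  qed (use T0 in simp)
  have d2: "((\<lambda>t. pder 2 u (pt s t)) has_integral (u (pt s (B + T)) - u (pt s B))) {B..B+T}" for s
  proof (rule fundamental_theorem_of_calculus)
    fix t
    have "((\<lambda>t. u (s *\<^sub>R axis 1 1 + t *\<^sub>R axis 2 1)) has_vector_derivative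
        frechet_derivative u (at (s *\<^sub>R axis 1 1 + t *\<^sub>R axis 2 1)) (axis 2 1)) (at t)"
      by (rule smooth_along_line[OF u(1)])
    then show "((\<lambda>t. u (pt s t)) has_vector_derivative pder 2 u (pt s t)) (at t within {B..B+T})"
      by (simp add: pt_def dd_def has_vector_derivative_at_within)
  qed (use T0 in simp)
  consider "i = 1" | "i = 2" using exhaust_2 by blast
  then show ?thesis
  proof cases
    case 1
    show ?thesis unfolding box_integral_iterated(2)[OF c] using d1[THEN integral_unique] by (simp add: 1 per)
  next
    case 2
    show ?thesis unfolding box_integral_iterated(1)[OF c] using d2[THEN integral_unique] by (simp add: 2 per)
  qed
qed

lemma smooth_arctan:
  fixes f :: "'a::real_normed_vector \<Rightarrow> real"
  assumes "smooth f"
  shows "smooth (\<lambda>x. arctan (f x))"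
proof -
  have *: "((\<lambda>x. arctan (f x)) has_derivative
      (\<lambda>v. inverse (1 + f x * f x) * frechet_derivative f (at x) v)) (at x)" for x
    using has_derivative_arctan[OF smooth_frechet[OF assms], of x]
    by (simp add: power2_eq_square mult.commute)
  have nz: "1 + f x * f x \<noteq> 0" for x
    by (metis add_pos_nonneg less_irrefl zero_le_square zero_less_one)
  have "smooth (\<lambda>x. inverse (1 + f x * f x) * frechet_derivative f (at x) v)" for v
    by (intro smooth_mult smooth_inverse smooth_add smooth_const smooth_frechet_derivative assms nz)
  then have "times_differentiable (Suc n) (\<lambda>x. arctan (f x))" for n
    by (intro times_differentiable_SucI[OF *]) (simp add: smooth_def)
  then show ?thesis
    unfolding smooth_def using times_differentiable_Suc_imp by blast
qed

section \<open>Periodic solutions of elliptic systems have no zeros\<close>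

definition jac :: "(real^2 \<Rightarrow> real) \<Rightarrow> (real^2 \<Rightarrow> real) \<Rightarrow> real^2 \<Rightarrow> real" where
  "jac f g x = pder 1 f x * pder 2 g x - pder 2 f x * pder 1 g x"

definition energy :: "(real^2 \<Rightarrow> real) \<Rightarrow> (real^2 \<Rightarrow> real) \<Rightarrow> real^2 \<Rightarrow> real" where
  "energy f g x = (pder 1 f x)\<^sup>2 + (pder 2 f x)\<^sup>2 + (pder 1 g x)\<^sup>2 + (pder 2 g x)\<^sup>2"

lemma smooth_pder: "smooth f \<Longrightarrow> smooth (pder i f)"
  by (intro smooth_dd smooth_const)

lemma pder_periodic: "smooth f \<Longrightarrow> doubly_periodic f \<Longrightarrow> doubly_periodic (pder i f)"
  by (intro dd_periodic doubly_periodic_const)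

text \<open>The form \<open>jac f g / (f\<^sup>2 + g\<^sup>2 + e) dx dy\<close> is exact, with the periodic potential
  \<open>(arctan (f / m) / m) dg\<close> for \<open>m = sqrt (g\<^sup>2 + e)\<close>.\<close>

lemma box_integral_jac:
  fixes f g :: "real^2 \<Rightarrow> real"
  assumes f: "smooth f" "doubly_periodic f" and g: "smooth g" "doubly_periodic g"
    and T: "T = 2 * pi * m" "m \<in> \<int>" "m \<ge> 0" and e: "e > 0"
  shows "box_integral A B T (\<lambda>x. jac f g x / ((f x)\<^sup>2 + (g x)\<^sup>2 + e)) = 0"
proof -
  \<comment> \<open>The regularisation \<open>e\<close> keeps \<open>w\<close> positive, and
    therefore the potential smooth, at the zeros of \<open>g\<close>.\<close>
  define w where "w = (\<lambda>x. sqrt ((g x)\<^sup>2 + e))"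
  define G where "G = (\<lambda>x. arctan (f x / w x) / w x)"
  have ge: "(g x)\<^sup>2 + e > 0" for x using e by (simp add: add_nonneg_pos)
  have w0: "w x > 0" for x using ge by (simp add: w_def)
  have smw: "smooth w" unfolding w_def by (intro smooth_intros g ge)
  have smfw: "smooth (\<lambda>x. f x / w x)" using w0 by (intro smooth_intros f smw) (simp add: less_imp_neq[symmetric])
  have smG: "smooth G" unfolding G_def
    using w0 by (intro smooth_divide smooth_arctan smfw smw) (simp add: less_imp_neq[symmetric])
  have perG: "doubly_periodic G"
    using f(2) g(2) by (simp add: doubly_periodic_def G_def w_def)
  have w2: "w x * w x = (g x)\<^sup>2 + e" for x
    using ge[of x] by (simp add: w_def)
  have dw: "\<exists>c. \<forall>i. pder i w x = c * pder i g x" for x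
  proof -
    have "((\<lambda>t. sqrt (t\<^sup>2 + e)) has_real_derivative (g x / sqrt ((g x)\<^sup>2 + e))) (at (g x))"
      using ge[of x] by (auto intro!: derivative_eq_intros simp: field_simps)
    then show ?thesis using dd_real_compose[OF _ g(1)] unfolding w_def by blast
  qed
  \<comment> \<open>Only the part along the gradient of \<open>f\<close> needs to be explicit: the
    multiple of the gradient of \<open>g\<close> cancels in the determinant with the gradient of
    \<open>g\<close>.\<close>
  have dG: "\<exists>c. \<forall>i. pder i G x = pder i f x / ((f x)\<^sup>2 + (g x)\<^sup>2 + e) + c * pder i g x" for x
  proof -
    obtain c where c: "\<And>i. pder i w x = c * pder i g x" using dw by blast
    have w0x: "w x \<noteq> 0" using w0[of x] by simp
    have q0: "1 + (f x / w x)\<^sup>2 \<noteq> 0" by (metis add_pos_nonneg less_irrefl zero_le_power2 zero_less_one)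
    have 1: "pder i (\<lambda>x. f x / w x) x = (pder i f x * w x - f x * (c * pder i g x)) / (w x * w x)" for i
      using dd_divide[OF f(1) smw w0x, of "\<lambda>_. axis i 1"] c by simp
    have 2: "pder i (\<lambda>x. arctan (f x / w x)) x = inverse (1 + (f x / w x)\<^sup>2) * pder i (\<lambda>x. f x / w x) x" for i
      by (rule dd_real_compose[OF DERIV_arctan smfw])
    have 3: "pder i G x = (pder i (\<lambda>x. arctan (f x / w x)) x * w x - arctan (f x / w x) * (c * pder i g x)) / (w x * w x)" for i
      using dd_divide[OF smooth_arctan[OF smfw] smw w0x, of "\<lambda>_. axis i 1"] c by (simp add: G_def)
    have s: "inverse (1 + (f x / w x)\<^sup>2) = w x * w x / (w x * w x + (f x)\<^sup>2)"
      using w0x q0 by (simp add: field_simps power2_eq_square)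
    have sw: "(f x)\<^sup>2 + (g x)\<^sup>2 + e = w x * w x + (f x)\<^sup>2" using w2[of x] by simp
    have pos: "w x * w x + (f x)\<^sup>2 \<noteq> 0" using w0x by (simp add: sum_power2_eq_zero_iff power2_eq_square)
    show ?thesis
    proof (intro exI allI)
      fix i
      show "pder i G x = pder i f x / ((f x)\<^sup>2 + (g x)\<^sup>2 + e) +
        (- f x * c / ((w x * w x + (f x)\<^sup>2) * w x) - arctan (f x / w x) * c / (w x * w x)) * pder i g x"
        unfolding 3 2 1 s sw using w0x pos by (simp add: divide_simps) (simp add: algebra_simps)
    qed
  qed
  let ?P = "\<lambda>x. G x * pder 2 g x" and ?Q = "\<lambda>x. G x * pder 1 g x"
  have smPQ: "smooth ?P" "smooth ?Q" by (intro smooth_mult smG smooth_pder g)+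
  have perPQ: "doubly_periodic ?P" "doubly_periodic ?Q"
    by (intro doubly_periodic_compose2[of _ _ "(*)"] perG pder_periodic g)+
  have "jac f g x / ((f x)\<^sup>2 + (g x)\<^sup>2 + e) = pder 1 ?P x - pder 2 ?Q x" for x
  proof -
    obtain c where c: "\<And>i. pder i G x = pder i f x / ((f x)\<^sup>2 + (g x)\<^sup>2 + e) + c * pder i g x"
      using dG by blast
    have "pder 1 (pder 2 g) x = pder 2 (pder 1 g) x"
      using frechet_symmetric_real[OF g(1), of "axis 1 1" x "axis 2 1"] by (simp add: dd_def[abs_def])
    then have "pder 1 ?P x - pder 2 ?Q x = pder 1 G x * pder 2 g x - pder 2 G x * pder 1 g x"
      by (simp add: dd_mult smG smooth_pder g)
    also have "\<dots> = jac f g x / ((f x)\<^sup>2 + (g x)\<^sup>2 + e)"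
      unfolding c jac_def by (simp add: algebra_simps diff_divide_distrib)
    finally show ?thesis by simp
  qed
  then have "box_integral A B T (\<lambda>x. jac f g x / ((f x)\<^sup>2 + (g x)\<^sup>2 + e)) =
      box_integral A B T (\<lambda>x. pder 1 ?P x - pder 2 ?Q x)" by simp
  also have "\<dots> = box_integral A B T (pder 1 ?P) - box_integral A B T (pder 2 ?Q)"
    by (intro box_integral_diff smooth_continuous_on smooth_pder smPQ)
  also have "\<dots> = 0"
    by (simp add: box_integral_pder[OF smPQ(1) perPQ(1) T] box_integral_pder[OF smPQ(2) perPQ(2) T])
  finally show ?thesis .
qed

text \<open>Divided by the regularised square norm, the elliptic inequality bounds the energy
  density by a constant minus a multiple of an exact form, which integrates to zero. What matters is
  that the bound is independent of \<open>e\<close>.\<close>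

lemma log_energy_bound:
  fixes f g :: "real^2 \<Rightarrow> real"
  assumes f: "smooth f" "doubly_periodic f" and g: "smooth g" "doubly_periodic g"
    and T: "T = 2 * pi * m" "m \<in> \<int>" "m \<ge> 0" and e: "e > 0"
    and c: "c > 0" and ell: "\<And>x. jac f g x \<le> - c * energy f g x + C * ((f x)\<^sup>2 + (g x)\<^sup>2)"
  shows "box_integral A B T (\<lambda>x. energy f g x / ((f x)\<^sup>2 + (g x)\<^sup>2 + e)) \<le> T * T * \<bar>C\<bar> / c"
proof -
  define \<rho> where "\<rho> = (\<lambda>x. (f x)\<^sup>2 + (g x)\<^sup>2 + e)"
  have \<rho>: "\<rho> x > 0" for x using e by (simp add: \<rho>_def add_nonneg_pos)
  then have nz: "\<rho> x \<noteq> 0" for x by (metis less_irrefl)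
  have sm\<rho>: "smooth \<rho>" unfolding \<rho>_def by (intro smooth_intros f g)
  have smE: "smooth (energy f g)" unfolding energy_def by (intro smooth_intros smooth_pder f g)
  have smJ: "smooth (jac f g)" unfolding jac_def by (intro smooth_intros smooth_pder f g)
  have "energy f g x / \<rho> x \<le> \<bar>C\<bar> / c - (1 / c) * (jac f g x / \<rho> x)" for x
  proof -
    have "C * ((f x)\<^sup>2 + (g x)\<^sup>2) \<le> \<bar>C\<bar> * \<rho> x"
      using e by (intro mult_mono) (auto simp: \<rho>_def)
    with ell[of x] have "c * energy f g x \<le> \<bar>C\<bar> * \<rho> x - jac f g x" by simp
    then have "c * energy f g x / \<rho> x \<le> (\<bar>C\<bar> * \<rho> x - jac f g x) / \<rho> x"
      using \<rho>[of x] by (intro divide_right_mono) auto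
    then have "c * (energy f g x / \<rho> x) \<le> \<bar>C\<bar> - jac f g x / \<rho> x"
      using nz[of x] by (simp add: diff_divide_distrib)
    then show ?thesis using c by (simp add: field_simps)
  qed
  then have "box_integral A B T (\<lambda>x. energy f g x / \<rho> x) \<le>
      box_integral A B T (\<lambda>x. \<bar>C\<bar> / c - (1 / c) * (jac f g x / \<rho> x))"
    by (intro box_integral_mono smooth_continuous_on smooth_divide smooth_diff smooth_mult smooth_const smE smJ sm\<rho> nz)
  also have "\<dots> = box_integral A B T (\<lambda>x. \<bar>C\<bar> / c) - box_integral A B T (\<lambda>x. (1 / c) * (jac f g x / \<rho> x))"
    by (intro box_integral_diff smooth_continuous_on smooth_divide smooth_diff smooth_mult smooth_const smE smJ sm\<rho> nz)
  also have "box_integral A B T (\<lambda>x. (1 / c) * (jac f g x / \<rho> x)) = 0"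
    unfolding box_integral_cmult \<rho>_def box_integral_jac[OF f g T e] by simp
  also have "box_integral A B T (\<lambda>x. \<bar>C\<bar> / c) = T * T * \<bar>C\<bar> / c"
    using T by (simp add: box_integral_const)
  finally show ?thesis by (simp add: \<rho>_def)
qed

lemma smooth_locally_lipschitz:
  fixes f :: "real^2 \<Rightarrow> real"
  assumes "smooth f" "f x = 0"
  obtains L d where "d > 0" "L > 0" "\<And>v. norm v < d \<Longrightarrow> (f (x + v))\<^sup>2 \<le> L * (norm v)\<^sup>2"
proof -
  let ?D = "frechet_derivative f (at x)"
  from smooth_frechet[OF assms(1)] have bl: "bounded_linear ?D"
    and al: "\<forall>e>0. \<exists>d>0. \<forall>y. norm (y - x) < d \<longrightarrow> norm (f y - f x - ?D (y - x)) \<le> e * norm (y - x)"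
    unfolding has_derivative_at_alt by blast+
  obtain K where K: "\<And>v. norm (?D v) \<le> norm v * K" using bounded_linear.bounded[OF bl] by blast
  obtain d where d: "d > 0" "\<And>y. norm (y - x) < d \<Longrightarrow> norm (f y - f x - ?D (y - x)) \<le> 1 * norm (y - x)"
    using al zero_less_one by blast
  show ?thesis
  proof (rule that[of d "(1 + \<bar>K\<bar>)\<^sup>2"])
    fix v :: "real^2" assume "norm v < d"
    then have "norm (f (x + v) - ?D v) \<le> norm v" using d(2)[of "x + v"] assms(2) by simp
    moreover have "norm v * K \<le> norm v * \<bar>K\<bar>" by (intro mult_left_mono) auto
    ultimately have "\<bar>f (x + v)\<bar> \<le> (1 + \<bar>K\<bar>) * norm v" using K[of v] by (simp add: algebra_simps)
    then have "\<bar>f (x + v)\<bar>\<^sup>2 \<le> ((1 + \<bar>K\<bar>) * norm v)\<^sup>2" by (intro power_mono) auto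
    then show "(f (x + v))\<^sup>2 \<le> (1 + \<bar>K\<bar>)\<^sup>2 * (norm v)\<^sup>2" by (simp add: power_mult_distrib)
  qed (use d(1) in \<open>auto simp: add_pos_nonneg\<close>)
qed

text \<open>The growth of \<open>\<phi>\<close> across a thin cone with apex \<open>(A, B)\<close>, from distance \<open>\<epsilon>\<close> to distance \<open>R\<close>,
  is at most \<open>ln (R / \<epsilon>) / 2\<close> plus its energy. For \<open>\<phi> = ln (f\<^sup>2 + g\<^sup>2 + \<epsilon>\<^sup>2) / 2\<close>, which grows like
  \<open>ln (R / \<epsilon>)\<close> from a zero of \<open>(f, g)\<close>, this contradicts a bound of the energy.\<close>

lemma cone_estimate:
  fixes \<phi> W :: "real^2 \<Rightarrow> real"
  assumes \<phi>: "smooth \<phi>" and W: "continuous_on UNIV W" "\<And>x. W x \<ge> 0"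
    and grad: "\<And>x. (\<bar>pder 1 \<phi> x\<bar> + \<bar>pder 2 \<phi> x\<bar>)\<^sup>2 \<le> 2 * W x"
    and eps: "0 < \<epsilon>" "\<epsilon> \<le> R" "R \<le> T" and s0: "0 < s0" "s0 \<le> 1"
    and lo: "\<And>s. 0 \<le> s \<Longrightarrow> s \<le> s0 \<Longrightarrow> k \<le> \<phi> (pt (A + R) (B + R * s)) - \<phi> (pt (A + \<epsilon>) (B + \<epsilon> * s))"
  shows "s0 * k \<le> box_integral A B T W + s0 * (ln (R / \<epsilon>) / 2)"
proof -
  let ?I = "{A + \<epsilon>..A + R}"
  let ?w = "\<lambda>\<tau> s. (\<tau> - A) * W (pt \<tau> (B + (\<tau> - A) * s))"
  have ptw: "k \<le> integral ?I (\<lambda>\<tau>. ?w \<tau> s) + ln (R / \<epsilon>) / 2" if s: "0 \<le> s" "s \<le> s0" for s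
  proof -
    define v where "v = pt 1 s"
    have line: "pt \<tau> (B + (\<tau> - A) * s) = pt 0 (B - A * s) + \<tau> *\<^sub>R v" for \<tau>
      by (simp add: vec_eq_iff forall_2 v_def algebra_simps)
    have 1: "((\<lambda>\<tau>. frechet_derivative \<phi> (at (pt \<tau> (B + (\<tau> - A) * s))) v) has_integral
        (\<phi> (pt (A + R) (B + (A + R - A) * s)) - \<phi> (pt (A + \<epsilon>) (B + (A + \<epsilon> - A) * s)))) ?I"
      unfolding line
      by (rule fundamental_theorem_of_calculus)
        (use eps in \<open>auto intro: has_vector_derivative_at_within smooth_along_line \<phi>\<close>)
    have "((\<lambda>\<tau>. 1 / (2 * (\<tau> - A))) has_integral (ln (A + R - A) / 2 - ln (A + \<epsilon> - A) / 2)) ?I"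
    proof (rule fundamental_theorem_of_calculus[where f = "\<lambda>\<tau>. ln (\<tau> - A) / 2"])
      fix \<tau> assume "\<tau> \<in> ?I"
      then have "\<tau> - A > 0" using eps by auto
      then have "((\<lambda>\<tau>. ln (\<tau> - A) / 2) has_real_derivative 1 / (2 * (\<tau> - A))) (at \<tau> within ?I)"
        by (auto intro!: derivative_eq_intros simp: divide_simps)
      then show "((\<lambda>\<tau>. ln (\<tau> - A) / 2) has_vector_derivative 1 / (2 * (\<tau> - A))) (at \<tau> within ?I)"
        by (simp add: has_real_derivative_iff_has_vector_derivative)
    qed (use eps in simp)
    moreover have "((\<lambda>\<tau>. ?w \<tau> s) has_integral integral ?I (\<lambda>\<tau>. ?w \<tau> s)) ?I"
      by (intro integrable_integral integrable_continuous_real continuous_intros continuous_on_pt_compose W)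
    ultimately have 2: "((\<lambda>\<tau>. ?w \<tau> s + 1 / (2 * (\<tau> - A))) has_integral
        (integral ?I (\<lambda>\<tau>. ?w \<tau> s) + (ln (A + R - A) / 2 - ln (A + \<epsilon> - A) / 2))) ?I"
      by (intro has_integral_add)
    have "\<phi> (pt (A + R) (B + (A + R - A) * s)) - \<phi> (pt (A + \<epsilon>) (B + (A + \<epsilon> - A) * s)) \<le>
        integral ?I (\<lambda>\<tau>. ?w \<tau> s) + (ln (A + R - A) / 2 - ln (A + \<epsilon> - A) / 2)"
    proof (rule has_integral_le[OF 1 2])
      fix \<tau> assume "\<tau> \<in> ?I"
      then have t: "\<tau> - A > 0" using eps by auto
      define x where "x = pt \<tau> (B + (\<tau> - A) * s)"
      define t where "t = \<tau> - A"
      have t0: "t > 0" using t by (simp add: t_def)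
      have lin: "linear (frechet_derivative \<phi> (at x))"
        using smooth_frechet[OF \<phi>] has_derivative_linear by blast
      have "frechet_derivative \<phi> (at x) v = pder 1 \<phi> x + s * pder 2 \<phi> x"
        by (simp add: v_def pt_def linear_add[OF lin] linear_cmul[OF lin] dd_def)
      also have "\<dots> \<le> \<bar>pder 1 \<phi> x\<bar> + \<bar>pder 2 \<phi> x\<bar>"
      proof -
        have "s * pder 2 \<phi> x \<le> s * \<bar>pder 2 \<phi> x\<bar>" using s(1) by (intro mult_left_mono) auto
        also have "\<dots> \<le> 1 * \<bar>pder 2 \<phi> x\<bar>" using s s0 by (intro mult_right_mono) auto
        finally show ?thesis by linarith
      qed
      \<comment> \<open>The weight \<open>t\<close> in this Young inequality is the Jacobian of the
        cone coordinates, so the first term becomes an area integral; the second one integrates to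
        half a logarithm.\<close>
      also have "\<dots> \<le> t * W x + 1 / (2 * t)"
      proof -
        define q where "q = \<bar>pder 1 \<phi> x\<bar> + \<bar>pder 2 \<phi> x\<bar>"
        have "0 \<le> (t * q - 1)\<^sup>2" by simp
        then have "2 * t * q \<le> t\<^sup>2 * q\<^sup>2 + 1" by (simp add: power2_eq_square algebra_simps)
        also have "\<dots> \<le> t\<^sup>2 * (2 * W x) + 1"
          using grad[of x] by (intro add_right_mono mult_left_mono) (auto simp: q_def)
        finally show ?thesis using t0 by (simp add: q_def[symmetric] field_simps power2_eq_square)
      qed
      finally show "frechet_derivative \<phi> (at (pt \<tau> (B + (\<tau> - A) * s))) v \<le>
          ?w \<tau> s + 1 / (2 * (\<tau> - A))"
        by (simp add: x_def t_def)
    qed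
    then show ?thesis using lo[OF s] eps by (simp add: ln_div diff_divide_distrib)
  qed
  have wc: "continuous_on S (\<lambda>(s, \<tau>). ?w \<tau> s)" for S
    unfolding case_prod_unfold
    by (intro continuous_intros continuous_on_pt_compose W)
  have "s0 * k = integral {0..s0} (\<lambda>s. k)" using s0 by simp
  also have "\<dots> \<le> integral {0..s0} (\<lambda>s. integral ?I (\<lambda>\<tau>. ?w \<tau> s) + ln (R / \<epsilon>) / 2)"
  proof (rule integral_le)
    have "continuous_on {0..s0} (\<lambda>s. integral (cbox (A + \<epsilon>) (A + R)) (\<lambda>\<tau>. ?w \<tau> s))"
      by (rule integral_continuous_on_param) (rule wc)
    then show "(\<lambda>s. integral ?I (\<lambda>\<tau>. ?w \<tau> s) + ln (R / \<epsilon>) / 2) integrable_on {0..s0}"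
      by (intro integrable_continuous_real continuous_intros) simp
  qed (use ptw in auto)
  also have "\<dots> = integral {0..s0} (\<lambda>s. integral ?I (\<lambda>\<tau>. ?w \<tau> s)) + s0 * (ln (R / \<epsilon>) / 2)"
  proof -
    have "continuous_on {0..s0} (\<lambda>s. integral (cbox (A + \<epsilon>) (A + R)) (\<lambda>\<tau>. ?w \<tau> s))"
      by (rule integral_continuous_on_param) (rule wc)
    then have "(\<lambda>s. integral ?I (\<lambda>\<tau>. ?w \<tau> s)) integrable_on {0..s0}"
      by (intro integrable_continuous_real) simp
    then show ?thesis using s0 by (subst integral_add) auto
  qed
  also have "integral {0..s0} (\<lambda>s. integral ?I (\<lambda>\<tau>. ?w \<tau> s)) = integral ?I (\<lambda>\<tau>. integral {0..s0} (\<lambda>s. ?w \<tau> s))"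
    using integral_swap_continuous[OF wc, of 0 s0 "A + \<epsilon>" "A + R"] by simp
  also have "\<dots> \<le> integral ?I (\<lambda>\<tau>. integral {B..B+T} (\<lambda>y. W (pt \<tau> y)))"
  proof (rule integral_le)
    have "continuous_on ?I (\<lambda>\<tau>. integral (cbox 0 s0) (\<lambda>s. ?w \<tau> s))"
      by (rule integral_continuous_on_param) (unfold case_prod_unfold, intro continuous_intros continuous_on_pt_compose W)
    then show "(\<lambda>\<tau>. integral {0..s0} (\<lambda>s. ?w \<tau> s)) integrable_on ?I"
      by (intro integrable_continuous_real) simp
    have "continuous_on ?I (\<lambda>\<tau>. integral (cbox B (B + T)) (\<lambda>y. W (pt \<tau> y)))"
      by (rule integral_continuous_on_param) (rule continuous_on_pt[OF W(1)])
    then show "(\<lambda>\<tau>. integral {B..B+T} (\<lambda>y. W (pt \<tau> y))) integrable_on ?I"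
      by (intro integrable_continuous_real) simp
    fix \<tau> assume \<tau>: "\<tau> \<in> ?I"
    have Wc: "continuous_on S (\<lambda>y. W (pt \<tau> y))" for S
      by (intro continuous_intros continuous_on_pt_compose W)
    have "(\<tau> - A) * s0 \<le> R * 1" using \<tau> s0 eps by (intro mult_mono) auto
    then have le: "B + (\<tau> - A) * s0 \<le> B + T" using eps by simp
    \<comment> \<open>The substitution \<open>y = B + (\<tau> - A) * s\<close> uses up the factor
      \<open>\<tau> - A\<close> and turns the integral over slopes into one over a vertical segment
      of the box.\<close>
    have "((\<lambda>s. (\<tau> - A) *\<^sub>R W (pt \<tau> (B + (\<tau> - A) * s))) has_integral
        integral {B + (\<tau> - A) * 0..B + (\<tau> - A) * s0} (\<lambda>y. W (pt \<tau> y))) {0..s0}"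
    proof (rule has_integral_substitution[where c = B and d = "B + T"])
      show "(\<lambda>s. B + (\<tau> - A) * s) ` {0..s0} \<subseteq> {B..B + T}"
      proof clarsimp
        fix s assume s: "0 \<le> s" "s \<le> s0"
        then have "(\<tau> - A) * s \<le> (\<tau> - A) * s0" using \<tau> eps by (intro mult_left_mono) auto
        moreover have "0 \<le> (\<tau> - A) * s" using s \<tau> eps by (intro mult_nonneg_nonneg) auto
        ultimately show "0 \<le> (\<tau> - A) * s \<and> (\<tau> - A) * s \<le> T" using le by linarith
      qed
      show "((\<lambda>s. B + (\<tau> - A) * s) has_field_derivative (\<tau> - A)) (at s within {0..s0})" for s
        by (auto intro!: derivative_eq_intros)
    qed (use s0 \<tau> eps Wc in auto)
    from integral_unique[OF this]
    have "integral {0..s0} (\<lambda>s. ?w \<tau> s) = integral {B..B + (\<tau> - A) * s0} (\<lambda>y. W (pt \<tau> y))"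
      by (simp only: real_scaleR_def mult_zero_right add_0_right)
    also have "\<dots> \<le> integral {B..B+T} (\<lambda>y. W (pt \<tau> y))"
      using le W(2) by (intro integral_subset_le integrable_continuous_real Wc) auto
    finally show "integral {0..s0} (\<lambda>s. ?w \<tau> s) \<le> integral {B..B+T} (\<lambda>y. W (pt \<tau> y))" .
  qed
  also have "\<dots> \<le> integral {A..A+T} (\<lambda>\<tau>. integral {B..B+T} (\<lambda>y. W (pt \<tau> y)))"
  proof (rule integral_subset_le)
    have "continuous_on S (\<lambda>\<tau>. integral (cbox B (B + T)) (\<lambda>y. W (pt \<tau> y)))" for S
      by (rule integral_continuous_on_param) (rule continuous_on_pt[OF W(1)])
    then show "(\<lambda>\<tau>. integral {B..B+T} (\<lambda>y. W (pt \<tau> y))) integrable_on ?I"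
      "(\<lambda>\<tau>. integral {B..B+T} (\<lambda>y. W (pt \<tau> y))) integrable_on {A..A+T}"
      by (intro integrable_continuous_real; simp)+
    show "\<forall>\<tau>\<in>{A..A+T}. 0 \<le> integral {B..B+T} (\<lambda>y. W (pt \<tau> y))"
      by (intro ballI integral_nonneg integrable_continuous_real continuous_intros continuous_on_pt_compose W)
  qed (use eps in auto)
  also have "\<dots> = box_integral A B T W"
    by (rule box_integral_iterated(1)[OF W(1), symmetric])
  finally show ?thesis by simp
qed

lemma elliptic_no_zero_on_row:
  fixes f g :: "real^2 \<Rightarrow> real"
  assumes f: "smooth f" "doubly_periodic f" and g: "smooth g" "doubly_periodic g"
    and c: "c > 0" and ell: "\<And>x. jac f g x \<le> - c * energy f g x + C * ((f x)\<^sup>2 + (g x)\<^sup>2)"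
    and R: "R > 0" and zero: "f (pt A B) = 0" "g (pt A B) = 0"
    and nonzero: "(f (pt (A + R) B))\<^sup>2 + (g (pt (A + R) B))\<^sup>2 > 0"
  shows False
proof -
  define q where "q = (\<lambda>x. (f x)\<^sup>2 + (g x)\<^sup>2)"
  have smq: "smooth q" unfolding q_def by (intro smooth_intros f g)
  have q0: "q x \<ge> 0" for x by (simp add: q_def)
  \<comment> \<open>Enough periods for the box to contain a cone of length \<open>R\<close>.\<close>
  obtain k where k: "R / (2 * pi) \<le> real k" using real_arch_simple by blast
  define T where "T = 2 * pi * real k"
  have T: "T = 2 * pi * real k" "real k \<in> \<int>" "real k \<ge> 0" "R \<le> T"
    using k by (simp_all add: T_def field_simps)
  define K where "K = T * T * \<bar>C\<bar> / c"
  define m0 where "m0 = q (pt (A + R) B) / 2"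
  have m0: "m0 > 0" using nonzero by (simp add: m0_def q_def)
  have "\<forall>\<^sub>F y in at (pt (A + R) B). m0 < q y"
    using smooth_isCont[OF smq, of "pt (A + R) B"] m0
    by (intro order_tendstoD(1)[OF isContD]) (auto simp: m0_def)
  then obtain d0 where d0: "d0 > 0" "\<And>y. dist y (pt (A + R) B) < d0 \<Longrightarrow> m0 < q y"
  proof -
    assume "\<forall>\<^sub>F y in at (pt (A + R) B). m0 < q y"
    then obtain d where d: "d > 0" "\<And>y. y \<noteq> pt (A + R) B \<Longrightarrow> dist y (pt (A + R) B) < d \<Longrightarrow> m0 < q y"
      unfolding eventually_at by blast
    have "m0 < q (pt (A + R) B)" using m0 by (simp add: m0_def)
    with d show ?thesis by (intro that[of d]) metis+
  qed
  \<comment> \<open>The cone is so thin that its far edge stays near \<open>pt (A + R) B\<close>,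
    where \<open>q\<close> exceeds \<open>m0\<close>.\<close>
  define s0 where "s0 = min 1 (d0 / (2 * R))"
  have s0: "0 < s0" "s0 \<le> 1" using d0 R by (simp_all add: s0_def)
  have far: "m0 < q (pt (A + R) (B + R * s))" if "0 \<le> s" "s \<le> s0" for s
  proof (rule d0(2))
    have "pt (A + R) (B + R * s) - pt (A + R) B = pt 0 (R * s)" by (simp add: vec_eq_iff forall_2)
    then have "dist (pt (A + R) (B + R * s)) (pt (A + R) B) = R * s"
      using that R by (simp add: dist_norm pt_def)
    also have "\<dots> \<le> R * (d0 / (2 * R))" using that R by (intro mult_left_mono) (auto simp: s0_def)
    also have "\<dots> < d0" using R d0(1) by simp
    finally show "dist (pt (A + R) (B + R * s)) (pt (A + R) B) < d0" .
  qed
  obtain L1 d1 where L1: "d1 > 0" "L1 > 0" "\<And>v. norm v < d1 \<Longrightarrow> (f (pt A B + v))\<^sup>2 \<le> L1 * (norm v)\<^sup>2"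
    using smooth_locally_lipschitz[OF f(1) zero(1)] by metis
  obtain L2 d2 where L2: "d2 > 0" "L2 > 0" "\<And>v. norm v < d2 \<Longrightarrow> (g (pt A B + v))\<^sup>2 \<le> L2 * (norm v)\<^sup>2"
    using smooth_locally_lipschitz[OF g(1) zero(2)] by metis
  \<comment> \<open>Offsets on the near edge have length at most \<open>2 * \<epsilon>\<close>,
    whence the factor 4; the summand 1 takes care of the added
    \<open>\<epsilon>\<^sup>2\<close>.\<close>
  define M where "M = 4 * (L1 + L2) + 1"
  have M: "M > 0" using L1 L2 by (simp add: M_def)
  have near: "q (pt (A + \<epsilon>) (B + \<epsilon> * s)) + \<epsilon>\<^sup>2 \<le> M * \<epsilon>\<^sup>2"
    if "0 < \<epsilon>" "2 * \<epsilon> < d1" "2 * \<epsilon> < d2" "0 \<le> s" "s \<le> s0" for \<epsilon> s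
  proof -
    let ?v = "pt \<epsilon> (\<epsilon> * s)"
    have "norm ?v \<le> norm (\<epsilon> *\<^sub>R axis 1 1 :: real^2) + norm ((\<epsilon> * s) *\<^sub>R axis 2 1 :: real^2)"
      unfolding pt_def by (rule norm_triangle_ineq)
    also have "\<dots> = \<epsilon> + \<epsilon> * s" using that by simp
    also have "\<epsilon> * s \<le> \<epsilon> * 1" using that s0 by (intro mult_left_mono) auto
    finally have nv: "norm ?v \<le> 2 * \<epsilon>" by simp
    then have nv2: "(norm ?v)\<^sup>2 \<le> 4 * \<epsilon>\<^sup>2" using power_mono[OF nv norm_ge_zero, of 2] by simp
    have "(f (pt A B + ?v))\<^sup>2 \<le> L1 * (norm ?v)\<^sup>2" "(g (pt A B + ?v))\<^sup>2 \<le> L2 * (norm ?v)\<^sup>2"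
      using nv that by (intro L1(3) L2(3); linarith)+
    moreover have "L1 * (norm ?v)\<^sup>2 \<le> L1 * (4 * \<epsilon>\<^sup>2)" "L2 * (norm ?v)\<^sup>2 \<le> L2 * (4 * \<epsilon>\<^sup>2)"
      using nv2 L1 L2 by (intro mult_left_mono; simp)+
    ultimately show ?thesis by (simp add: q_def pt_add M_def algebra_simps)
  qed
  have key: "s0 * (ln m0 - ln M - ln R) \<le> 2 * K + s0 * ln \<epsilon>"
    if e: "0 < \<epsilon>" "2 * \<epsilon> < d1" "2 * \<epsilon> < d2" "\<epsilon> \<le> R" for \<epsilon>
  proof -
    define \<phi> where "\<phi> = (\<lambda>x. ln (q x + \<epsilon>\<^sup>2) / 2)"
    define W where "W = (\<lambda>x. energy f g x / ((f x)\<^sup>2 + (g x)\<^sup>2 + \<epsilon>\<^sup>2))"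
    have pos: "q x + \<epsilon>\<^sup>2 > 0" for x using e q0[of x] by (simp add: add_nonneg_pos)
    have smE: "smooth (energy f g)" unfolding energy_def by (intro smooth_intros smooth_pder f g)
    have smW: "smooth W" unfolding W_def
      using pos by (intro smooth_divide smE smooth_intros f g) (simp add: q_def less_imp_neq[symmetric])
    have E0: "energy f g x \<ge> 0" for x by (simp add: energy_def)
    have smd: "smooth (\<lambda>x. q x + \<epsilon>\<^sup>2)" by (intro smooth_intros smq)
    have Dphi: "(\<phi> has_derivative (\<lambda>v. (1 / (2 * (q x + \<epsilon>\<^sup>2))) * frechet_derivative (\<lambda>x. q x + \<epsilon>\<^sup>2) (at x) v)) (at x)" for x
    proof -
      have "((\<lambda>t. ln t / 2) has_real_derivative (1 / (2 * (q x + \<epsilon>\<^sup>2)))) (at (q x + \<epsilon>\<^sup>2))"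
        using pos[of x] by (auto intro!: derivative_eq_intros simp: divide_simps)
      from diff_chain_at[OF smooth_frechet[OF smd] this[unfolded has_field_derivative_def]]
      show ?thesis by (simp add: \<phi>_def o_def)
    qed
    have sm\<phi>: "smooth \<phi>"
    proof -
      have "smooth (\<lambda>x. (1 / (2 * (q x + \<epsilon>\<^sup>2))) * frechet_derivative (\<lambda>x. q x + \<epsilon>\<^sup>2) (at x) v)" for v
        using pos by (intro smooth_mult smooth_divide smooth_const smooth_frechet_derivative smd) (metis less_irrefl mult_eq_0_iff zero_neq_numeral)
      then have "times_differentiable (Suc n) \<phi>" for n
        by (intro times_differentiable_SucI[OF Dphi]) (simp add: smooth_def)
      then show ?thesis unfolding smooth_def using times_differentiable_Suc_imp by blast
    qed
    have "pder i \<phi> x = (f x * pder i f x + g x * pder i g x) / (q x + \<epsilon>\<^sup>2)" for i x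
    proof -
      have "pder i \<phi> x = (1 / (2 * (q x + \<epsilon>\<^sup>2))) * pder i (\<lambda>x. q x + \<epsilon>\<^sup>2) x"
        using dd_eqI[OF Dphi] by (simp add: dd_def)
      also have "pder i (\<lambda>x. q x + \<epsilon>\<^sup>2) x = 2 * (f x * pder i f x + g x * pder i g x)"
        unfolding q_def power2_eq_square
        by (simp add: dd_add dd_mult dd_const smooth_add smooth_mult smooth_const f g)
      finally show ?thesis using pos[of x] by (simp add: field_simps)
    qed
    then have "(\<bar>pder 1 \<phi> x\<bar> + \<bar>pder 2 \<phi> x\<bar>)\<^sup>2 \<le> 2 * W x" for x
    proof -
      assume H: "\<And>i x. pder i \<phi> x = (f x * pder i f x + g x * pder i g x) / (q x + \<epsilon>\<^sup>2)"
      define D where "D = q x + \<epsilon>\<^sup>2"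
      have D: "D > 0" "q x \<le> D" using pos[of x] by (simp_all add: D_def)
      have cs: "(f x * u + g x * v)\<^sup>2 \<le> q x * (u\<^sup>2 + v\<^sup>2)" for u v
      proof -
        have "0 \<le> (f x * v - g x * u)\<^sup>2" by simp
        then show ?thesis by (simp add: q_def power2_eq_square algebra_simps)
      qed
      have "(\<bar>pder 1 \<phi> x\<bar> + \<bar>pder 2 \<phi> x\<bar>)\<^sup>2 \<le> 2 * (\<bar>pder 1 \<phi> x\<bar>\<^sup>2 + \<bar>pder 2 \<phi> x\<bar>\<^sup>2)"
        using sum_squares_bound[of "\<bar>pder 1 \<phi> x\<bar>" "\<bar>pder 2 \<phi> x\<bar>"] by (simp add: power2_sum)
      also have "\<bar>pder 1 \<phi> x\<bar>\<^sup>2 + \<bar>pder 2 \<phi> x\<bar>\<^sup>2 =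
          ((f x * pder 1 f x + g x * pder 1 g x)\<^sup>2 + (f x * pder 2 f x + g x * pder 2 g x)\<^sup>2) / D\<^sup>2"
        unfolding H D_def[symmetric] power2_abs power_divide by (rule add_divide_distrib[symmetric])
      also have "\<dots> \<le> (q x * energy f g x) / D\<^sup>2"
        using cs[of "pder 1 f x" "pder 1 g x"] cs[of "pder 2 f x" "pder 2 g x"]
        by (intro divide_right_mono) (auto simp: energy_def algebra_simps)
      also have "\<dots> \<le> (D * energy f g x) / D\<^sup>2"
        using D E0[of x] by (intro divide_right_mono mult_right_mono) auto
      also have "\<dots> = W x" using D by (simp add: W_def D_def q_def power2_eq_square)
      finally show ?thesis by simp
    qed
    moreover have "W x \<ge> 0" for x
      using E0[of x] pos[of x] by (simp add: W_def q_def)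
    moreover have "(ln m0 - ln (M * \<epsilon>\<^sup>2)) / 2 \<le> \<phi> (pt (A + R) (B + R * s)) - \<phi> (pt (A + \<epsilon>) (B + \<epsilon> * s))"
      if s: "0 \<le> s" "s \<le> s0" for s
    proof -
      have "ln m0 \<le> ln (q (pt (A + R) (B + R * s)) + \<epsilon>\<^sup>2)"
        using far[OF s] m0 zero_le_power2[of \<epsilon>] by (intro ln_mono) linarith+
      moreover have "ln (q (pt (A + \<epsilon>) (B + \<epsilon> * s)) + \<epsilon>\<^sup>2) \<le> ln (M * \<epsilon>\<^sup>2)"
        using near[OF e(1-3) s] pos by (intro ln_mono) auto
      ultimately show ?thesis by (simp add: \<phi>_def)
    qed
    ultimately have "s0 * ((ln m0 - ln (M * \<epsilon>\<^sup>2)) / 2) \<le> box_integral A B T W + s0 * (ln (R / \<epsilon>) / 2)"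
      using e T s0 smooth_continuous_on[OF smW] sm\<phi> by (intro cone_estimate) auto
    also have "box_integral A B T W \<le> K"
      unfolding W_def K_def using e by (intro log_energy_bound[OF f g T(1-3) _ c ell]) simp
    also have "ln (M * \<epsilon>\<^sup>2) = ln M + 2 * ln \<epsilon>"
      using M e by (simp add: ln_mult ln_realpow)
    also have "ln (R / \<epsilon>) = ln R - ln \<epsilon>" using R e by (simp add: ln_div)
    finally show ?thesis by (simp add: field_simps)
  qed
  \<comment> \<open>For \<open>ln \<epsilon> \<le> k'\<close> the inequality \<open>key\<close>
    fails; subtracting 1 makes the failure strict.\<close>
  define k' where "k' = (s0 * (ln m0 - ln M - ln R) - 2 * K) / s0 - 1"
  define \<epsilon> where "\<epsilon> = min (exp k') (min R (min (d1 / 3) (d2 / 3)))"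
  have e: "0 < \<epsilon>" "2 * \<epsilon> < d1" "2 * \<epsilon> < d2" "\<epsilon> \<le> R" "\<epsilon> \<le> exp k'"
    using R L1(1) L2(1) by (auto simp: \<epsilon>_def min_def)
  have "ln \<epsilon> \<le> k'" using e(1,5) by (metis ln_exp ln_le_cancel_iff exp_gt_zero)
  then have "s0 * ln \<epsilon> \<le> s0 * k'" using s0 by simp
  also have "s0 * k' = s0 * (ln m0 - ln M - ln R) - 2 * K - s0" using s0 by (simp add: k'_def field_simps)
  finally show False using key[OF e(1-4)] s0 by simp
qed

text \<open>Cones open to the right only, so periodicity first moves the second point to the right
  of the zero.\<close>

lemma elliptic_zero_row:
  fixes f g :: "real^2 \<Rightarrow> real"
  assumes f: "smooth f" "doubly_periodic f" and g: "smooth g" "doubly_periodic g"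
    and c: "c > 0" and ell: "\<And>x. jac f g x \<le> - c * energy f g x + C * ((f x)\<^sup>2 + (g x)\<^sup>2)"
    and zero: "f (pt A B) = 0" "g (pt A B) = 0"
  shows "f (pt A' B) = 0 \<and> g (pt A' B) = 0"
proof (rule ccontr)
  assume n: "\<not> ?thesis"
  obtain k :: nat where k: "(A - A') / (2 * pi) < real k" using reals_Archimedean2 by blast
  define R where "R = A' + 2 * pi * real k - A"
  have R: "R > 0" using k by (simp add: R_def field_simps)
  have "pt A' B + pt (2 * pi * real k) (2 * pi * 0) = pt (A + R) B" by (simp add: pt_add R_def)
  then have "f (pt (A + R) B) = f (pt A' B)" "g (pt (A + R) B) = g (pt A' B)"
    using doubly_periodicD[OF f(2), of "real k" 0 "pt A' B"] doubly_periodicD[OF g(2), of "real k" 0 "pt A' B"]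
    by auto
  with n have "(f (pt (A + R) B))\<^sup>2 + (g (pt (A + R) B))\<^sup>2 > 0"
    by (simp add: sum_power2_gt_zero_iff)
  from elliptic_no_zero_on_row[OF f g c ell R zero this] show False .
qed

text \<open>A row is followed by a column. Exchanging the coordinates reverses the sign of the
  Jacobian determinant; exchanging \<open>f\<close> and \<open>g\<close> restores it, so that the
  elliptic inequality is preserved.\<close>

theorem elliptic_zero_free:
  fixes f g :: "real^2 \<Rightarrow> real"
  assumes f: "smooth f" "doubly_periodic f" and g: "smooth g" "doubly_periodic g"
    and c: "c > 0" and ell: "\<And>x. jac f g x \<le> - c * energy f g x + C * ((f x)\<^sup>2 + (g x)\<^sup>2)"
    and zero: "f x = 0" "g x = 0"
  shows "f y = 0 \<and> g y = 0"
proof -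
  have row: "f (pt (y $ 1) (x $ 2)) = 0 \<and> g (pt (y $ 1) (x $ 2)) = 0"
    using elliptic_zero_row[OF f g c ell, of "x $ 1" "x $ 2" "y $ 1"] zero by simp
  define S where "S = (\<lambda>x::real^2. pt (x $ 2) (x $ 1))"
  have S: "bounded_linear S"
    unfolding S_def pt_def by (intro bounded_linear_add bounded_linear_scaleR_const bounded_linear_vec_nth)
  have Sax: "S (axis 1 1) = axis 2 1" "S (axis 2 1) = axis 1 1"
    by (simp_all add: S_def vec_eq_iff forall_2 axis_def)
  have Spt: "S (pt s t) = pt t s" for s t by (simp add: S_def)
  have per: "doubly_periodic (\<lambda>x. h (S x))" if "doubly_periodic h" for h :: "real^2 \<Rightarrow> real"
    unfolding doubly_periodic_def
  proof (intro allI impI)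
    fix x :: "real^2" and m n :: real assume "m \<in> \<int>" "n \<in> \<int>"
    then show "h (S (x + pt (2 * pi * m) (2 * pi * n))) = h (S x)"
      using doubly_periodicD[OF that, of n m "S x"] by (simp add: linear_add[OF bounded_linear.linear[OF S]] Spt)
  qed
  have sm: "smooth (\<lambda>x. h (S x))" if "smooth h" for h :: "real^2 \<Rightarrow> real"
    using smooth_affine[OF S that, of 0] by simp
  have d: "pder 1 (\<lambda>x. h (S x)) x = pder 2 h (S x)" "pder 2 (\<lambda>x. h (S x)) x = pder 1 h (S x)"
    if "smooth h" for h :: "real^2 \<Rightarrow> real" and x
    using frechet_affine[OF S that, of 0 x] by (simp_all add: dd_def Sax)
  have "jac (\<lambda>x. g (S x)) (\<lambda>x. f (S x)) x \<le> - c * energy (\<lambda>x. g (S x)) (\<lambda>x. f (S x)) x + C * ((g (S x))\<^sup>2 + (f (S x))\<^sup>2)" for x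
    using ell[of "S x"] by (simp add: jac_def energy_def d f g algebra_simps)
  from elliptic_zero_row[OF sm[OF g(1)] per[OF g(2)] sm[OF f(1)] per[OF f(2)] c this, of "x $ 2" "y $ 1" "y $ 2"] row
  show ?thesis by (simp add: Spt)
qed

section \<open>Weingarten tori have no umbilic points\<close>

lemma doubly_periodic_bounded:
  fixes f :: "real^2 \<Rightarrow> real"
  assumes "smooth f" "doubly_periodic f"
  obtains M where "M > 0" "\<And>x. \<bar>f x\<bar> \<le> M"
proof -
  obtain u v where uv: "\<And>x. f u \<le> f x" "\<And>x. f x \<le> f v"
    by (rule doubly_periodic_bounds[OF smooth_continuous_on[OF assms(1)] assms(2)]) blast
  have "\<bar>f x\<bar> \<le> \<bar>f u\<bar> + \<bar>f v\<bar> + 1" for x using uv[of x] by linarith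
  then show ?thesis by (intro that[of "\<bar>f u\<bar> + \<bar>f v\<bar> + 1"]) auto
qed

lemma doubly_periodic_pos_bounds:
  fixes f :: "real^2 \<Rightarrow> real"
  assumes "smooth f" "doubly_periodic f" "\<And>x. f x > 0"
  obtains m M where "0 < m" "\<And>x. m \<le> f x" "\<And>x. f x \<le> M" "0 < M"
proof -
  obtain u v where uv: "\<And>x. f u \<le> f x" "\<And>x. f x \<le> f v"
    by (rule doubly_periodic_bounds[OF smooth_continuous_on[OF assms(1)] assms(2)]) blast
  then show ?thesis using assms(3) by (intro that[of "f u" "f v"]) auto
qed

text \<open>The triangular form of \<open>a\<close> and \<open>b\<close> is what Gram-Schmidt
  orthonormalisation produces from the coordinate fields. It makes \<open>a x $ 1 * b x $ 2\<close>,
  the factor between frame and coordinate Jacobians, positive.\<close>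

locale periodic_frame = frame +
  assumes perF: "doubly_periodic F" and perN: "doubly_periodic N"
    and pera: "doubly_periodic a" and perb: "doubly_periodic b"
    and tri: "a x $ 2 = 0" "a x $ 1 > 0" "b x $ 2 > 0"
begin

lemma perE: "doubly_periodic E1" "doubly_periodic E2"
  using dd_periodic[OF smF perF pera] dd_periodic[OF smF perF perb] by (simp_all add: daF dbF)

lemma per_coeffs: "doubly_periodic p" "doubly_periodic r" "doubly_periodic h11" "doubly_periodic h12" "doubly_periodic h22"
  unfolding p_def[abs_def] r_def[abs_def] h11_def[abs_def] h12_def[abs_def] h22_def[abs_def]
  by (intro doubly_periodic_compose2[of _ _ "(\<bullet>)"] dd_periodic sm perE perN pera perb)+

lemma dd_a_pder: "smooth f \<Longrightarrow> dd a f x = (a x $ 1) *\<^sub>R pder 1 f x"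
  and dd_b_pder: "smooth f \<Longrightarrow> dd b f x = (b x $ 1) *\<^sub>R pder 1 f x + (b x $ 2) *\<^sub>R pder 2 f x"
proof -
  assume f: "smooth f"
  have l: "linear (frechet_derivative f (at x))"
    using smooth_frechet[OF f] has_derivative_linear by blast
  have "a x = (a x $ 1) *\<^sub>R axis 1 1" "b x = (b x $ 1) *\<^sub>R axis 1 1 + (b x $ 2) *\<^sub>R axis 2 1"
    by (simp_all add: vec_eq_iff forall_2 axis_def tri)
  then show "dd a f x = (a x $ 1) *\<^sub>R pder 1 f x" "dd b f x = (b x $ 1) *\<^sub>R pder 1 f x + (b x $ 2) *\<^sub>R pder 2 f x"
    unfolding dd_def by (metis linear_cmul[OF l] linear_add[OF l])+
qed

lemma jac_frame:
  assumes "smooth f" "smooth g"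
  shows "dd a f x * dd b g x - dd b f x * dd a g x = (a x $ 1) * (b x $ 2) * jac f g x"
  by (simp add: dd_a_pder dd_b_pder assms jac_def algebra_simps)

text \<open>Inverting the triangular matrix bounds coordinate gradients by frame gradients with the
  factor \<open>k\<close>, which is bounded by periodicity.\<close>

lemma energy_frame:
  obtains K where "K > 0" "\<And>f g x. smooth f \<Longrightarrow> smooth g \<Longrightarrow>
    energy f g x \<le> K * ((dd a f x)\<^sup>2 + (dd b f x)\<^sup>2 + (dd a g x)\<^sup>2 + (dd b g x)\<^sup>2)"
proof -
  define k where "k = (\<lambda>x. (1 / a x $ 1)\<^sup>2 + 2 * (1 + (b x $ 1 / a x $ 1)\<^sup>2) * (1 / b x $ 2)\<^sup>2)"
  have nz: "a x $ 1 \<noteq> 0" "b x $ 2 \<noteq> 0" for x using tri[of x] by auto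
  have "smooth k" unfolding k_def using nz by (intro smooth_intros sma smb)
  moreover have "doubly_periodic k"
    using pera perb unfolding k_def by (simp add: doubly_periodic_def)
  ultimately obtain K where K: "K > 0" "\<And>x. \<bar>k x\<bar> \<le> K" using doubly_periodic_bounded by blast
  have one: "(pder 1 f x)\<^sup>2 + (pder 2 f x)\<^sup>2 \<le> K * ((dd a f x)\<^sup>2 + (dd b f x)\<^sup>2)"
    if "smooth f" for f :: "real^2 \<Rightarrow> real" and x
  proof -
    define u v where "u = dd a f x" and "v = dd b f x"
    define s where "s = b x $ 1 / a x $ 1"
    define i j where "i = 1 / a x $ 1" and "j = 1 / b x $ 2"
    have 1: "pder 1 f x = i * u"
      using nz[of x] by (simp add: u_def i_def dd_a_pder that)
    have 2: "pder 2 f x = j * (v - s * u)"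
      using nz[of x] by (simp add: u_def v_def s_def j_def dd_a_pder dd_b_pder that)
    have "(v - s * u)\<^sup>2 \<le> 2 * (1 + s\<^sup>2) * (u\<^sup>2 + v\<^sup>2)"
    proof -
      have "0 \<le> (v + s * u)\<^sup>2 + 2 * u\<^sup>2 + 2 * (s * v)\<^sup>2" by simp
      then show ?thesis by (simp add: power2_eq_square algebra_simps)
    qed
    then have "j\<^sup>2 * (v - s * u)\<^sup>2 \<le> j\<^sup>2 * (2 * (1 + s\<^sup>2) * (u\<^sup>2 + v\<^sup>2))"
      by (intro mult_left_mono) auto
    moreover have "i\<^sup>2 * u\<^sup>2 \<le> i\<^sup>2 * (u\<^sup>2 + v\<^sup>2)" by (intro mult_left_mono) auto
    ultimately have "(i * u)\<^sup>2 + (j * (v - s * u))\<^sup>2 \<le> (i\<^sup>2 + 2 * (1 + s\<^sup>2) * j\<^sup>2) * (u\<^sup>2 + v\<^sup>2)"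
      unfolding power_mult_distrib distrib_right[of "i\<^sup>2"] by (simp add: mult.commute mult.left_commute)
    also have "i\<^sup>2 + 2 * (1 + s\<^sup>2) * j\<^sup>2 = k x" by (simp add: k_def i_def j_def s_def)
    also have "k x * (u\<^sup>2 + v\<^sup>2) \<le> K * (u\<^sup>2 + v\<^sup>2)"
      using K(2)[of x] by (intro mult_right_mono) auto
    finally show ?thesis unfolding 1 2 by (simp add: u_def v_def)
  qed
  have "energy f g x \<le> K * ((dd a f x)\<^sup>2 + (dd b f x)\<^sup>2 + (dd a g x)\<^sup>2 + (dd b g x)\<^sup>2)"
    if "smooth f" "smooth g" for f g x
    using one[OF that(1), of x] one[OF that(2), of x] by (simp add: energy_def algebra_simps)
  then show ?thesis using that K(1) by blast
qed

text \<open>Gauss--Bonnet: the Gauss curvature of a totally umbilic torus would be positive.\<close>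

lemma not_totally_umbilic:
  assumes "\<And>x. h12 x = 0" "\<And>x. h11 x = h22 x"
  shows False
proof -
  \<comment> \<open>The components of the connection form, whose curl is the Gauss curvature times
    the area density. They are doubly periodic, so the curl integrates to zero.\<close>
  define w where "w = (\<lambda>i x. pder i E1 x \<bullet> E2 x)"
  have smw: "smooth (w i)" for i unfolding w_def by (intro smooth_inner smooth_pder sm)
  have perw: "doubly_periodic (w i)" for i unfolding w_def
    by (intro doubly_periodic_compose2[of _ _ "(\<bullet>)"] dd_periodic sm perE doubly_periodic_const)
  define k where "k = (\<lambda>x. (1 + (h11 x)\<^sup>2) / (a x $ 1 * b x $ 2))"
  have nz: "a x $ 1 * b x $ 2 \<noteq> 0" "a x $ 1 \<noteq> 0" "b x $ 2 \<noteq> 0" for x using tri[of x] by auto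
  have smk: "smooth k" unfolding k_def using nz by (intro smooth_intros sm)
  have perk: "doubly_periodic k"
    using pera perb per_coeffs(3) unfolding k_def by (simp add: doubly_periodic_def)
  have k0: "k x > 0" for x
    using tri[of x] by (auto simp: k_def intro!: divide_pos_pos add_pos_nonneg)
  have curl: "pder 2 (w 1) x - pder 1 (w 2) x = k x" for x
  proof -
    have sym: "pder 1 (pder 2 E1) x = pder 2 (pder 1 E1) x"
      using frechet_symmetric[OF smE1, of "axis 1 1" x "axis 2 1"] by (simp add: dd_def[abs_def])
    have "pder 2 (w 1) x - pder 1 (w 2) x = pder 1 E1 x \<bullet> pder 2 E2 x - pder 2 E1 x \<bullet> pder 1 E2 x"
      unfolding w_def by (simp add: dd_inner smooth_pder sm sym)
    also have "\<dots> = k x"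
    proof -
      define i j s where "i = 1 / a x $ 1" and "j = 1 / b x $ 2" and "s = b x $ 1 / a x $ 1"
      have 1: "pder 1 f x = i *\<^sub>R dd a f x" if "smooth f" for f :: "real^2 \<Rightarrow> real^4"
        using nz[of x] by (simp add: i_def dd_a_pder that)
      have 2: "pder 2 f x = j *\<^sub>R (dd b f x - s *\<^sub>R dd a f x)" if "smooth f" for f :: "real^2 \<Rightarrow> real^4"
        using nz[of x] by (simp add: s_def j_def dd_a_pder dd_b_pder that)
      have "pder 1 E1 x \<bullet> pder 2 E2 x - pder 2 E1 x \<bullet> pder 1 E2 x =
        i * j * (dd a E1 x \<bullet> dd b E2 x - dd b E1 x \<bullet> dd a E2 x)"
        by (simp add: 1 2 sm inner_diff_right inner_diff_left algebra_simps)
      also have "dd a E1 x \<bullet> dd b E2 x - dd b E1 x \<bullet> dd a E2 x = 1 + (h11 x)\<^sup>2"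
        by (simp add: structure_eqs assms(1) assms(2)[symmetric] inner_diff_left inner_diff_right orth power2_eq_square)
      finally show ?thesis by (simp add: k_def i_def j_def)
    qed
    finally show ?thesis .
  qed
  obtain m where m: "m > 0" "\<And>x. m \<le> k x"
    using doubly_periodic_pos_bounds[OF smk perk k0] by metis
  have "0 < (2 * pi) * (2 * pi) * m" using m by simp
  also have "\<dots> = box_integral 0 0 (2 * pi) (\<lambda>x. m)" by (simp add: box_integral_const)
  also have "\<dots> \<le> box_integral 0 0 (2 * pi) k"
    by (intro box_integral_mono smooth_continuous_on smk smooth_const m)
  also have "k = (\<lambda>x. pder 2 (w 1) x - pder 1 (w 2) x)" using curl by auto
  also have "box_integral 0 0 (2 * pi) \<dots> = box_integral 0 0 (2 * pi) (pder 2 (w 1)) - box_integral 0 0 (2 * pi) (pder 1 (w 2))"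
    by (intro box_integral_diff smooth_continuous_on smooth_pder smw)
  also have "\<dots> = 0"
    using box_integral_pder[OF smw perw, of "2 * pi" 1] by simp
  finally show False by simp
qed

text \<open>The trace-free part \<open>(f, h12)\<close> of the second fundamental form satisfies an elliptic system: by the
  Codazzi equations \<open>dd a f + dd b h12\<close> and \<open>dd a h12 - dd b f\<close> equal \<open>dd a H\<close> and \<open>dd b H\<close> up to terms
  of order zero, and the Weingarten relation bounds the gradient of \<open>H\<close> strictly by that of \<open>(f, h12)\<close>.\<close>

lemma no_umbilics:
  assumes w: "0 < wa" "0 \<le> wb" "wb \<le> 1"
    and W: "\<And>x. (h11 x + h22 x - wc)\<^sup>2 = wa + wb * ((h11 x - h22 x)\<^sup>2 + 4 * (h12 x)\<^sup>2)"
      "\<And>x. h11 x + h22 x \<ge> wc"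
  shows "h11 x \<noteq> h22 x \<or> h12 x \<noteq> 0"
proof (rule ccontr)
  assume umb: "\<not> ?thesis"
  define f where "f = (\<lambda>x. (h11 x - h22 x) / 2)"
  define H where "H = (\<lambda>x. (h11 x + h22 x) / 2)"
  define q where "q = (\<lambda>x. (f x)\<^sup>2 + (h12 x)\<^sup>2)"
  have smf: "smooth f" and smH: "smooth H" unfolding f_def H_def by (intro smooth_intros sm; simp)+
  have smq: "smooth q" unfolding q_def by (intro smooth_intros smf sm)
  have perf: "doubly_periodic f" and perq: "doubly_periodic q"
    using per_coeffs by (simp_all add: f_def q_def doubly_periodic_def)
  have q0: "q x \<ge> 0" for x by (simp add: q_def)
  have pos: "wa + 4 * wb * q x > 0" for x using w q0[of x] by (simp add: add_pos_nonneg)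
  have Heq: "H x = (wc + sqrt (wa + 4 * wb * q x)) / 2" for x
  proof -
    have "(h11 x + h22 x - wc)\<^sup>2 = wa + 4 * wb * q x"
      unfolding W(1) q_def f_def by (simp add: power2_eq_square field_simps)
    then have "h11 x + h22 x - wc = sqrt (wa + 4 * wb * q x)"
      using W(2)[of x] by (metis abs_of_nonneg diff_ge_0_iff_ge real_sqrt_abs)
    then show ?thesis by (simp add: H_def)
  qed
  define g where "g = (\<lambda>v x. (dd v f x)\<^sup>2 + (dd v h12 x)\<^sup>2)"
  obtain M where M: "M > 0" "\<And>x. \<bar>q x\<bar> \<le> M" using doubly_periodic_bounded[OF smq perq] by blast
  \<comment> \<open>The squared slope of \<open>H\<close> as a function of \<open>sqrt q\<close> is
    \<open>4 * wb\<^sup>2 * q x / S\<close>. By \<open>wb\<^sup>2 \<le> wb\<close> and the bound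
    \<open>M\<close> of \<open>q\<close> it is at most \<open>1 - \<delta>\<close>, also when
    \<open>wb = 1\<close>.\<close>
  define \<delta> where "\<delta> = wa / (wa + 4 * wb * M)"
  have \<delta>: "0 < \<delta>" "\<delta> \<le> 1" using w M by (auto simp: \<delta>_def field_simps add_pos_nonneg)
  have dH: "(dd v H x)\<^sup>2 \<le> (1 - \<delta>) * g v x" for v x
  proof -
    define S where "S = wa + 4 * wb * q x"
    have S: "S > 0" using pos[of x] by (simp add: S_def)
    have "H = (\<lambda>x. (wc + sqrt (wa + 4 * wb * q x)) / 2)" using Heq by blast
    moreover have "((\<lambda>t. (wc + sqrt (wa + 4 * wb * t)) / 2) has_real_derivative (wb / sqrt S)) (at (q x))"
      unfolding S_def using pos[of x] by (auto intro!: derivative_eq_intros simp: divide_simps)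
    ultimately have "dd v H x = wb / sqrt S * dd v q x"
      using dd_real_compose[OF _ smq] by blast
    also have "dd v q x = 2 * (f x * dd v f x + h12 x * dd v h12 x)"
      unfolding q_def power2_eq_square by (simp add: dd_add dd_mult smooth_mult smf sm)
    finally have E: "dd v H x = wb / sqrt S * (2 * (f x * dd v f x + h12 x * dd v h12 x))" .
    have "(dd v H x)\<^sup>2 = 4 * wb\<^sup>2 / S * (f x * dd v f x + h12 x * dd v h12 x)\<^sup>2"
      using S unfolding E power_mult_distrib power_divide by simp
    also have "\<dots> \<le> 4 * wb\<^sup>2 / S * (q x * g v x)"
    proof (intro mult_left_mono)
      have "0 \<le> (f x * dd v h12 x - h12 x * dd v f x)\<^sup>2" by simp
      then show "(f x * dd v f x + h12 x * dd v h12 x)\<^sup>2 \<le> q x * g v x"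
        by (simp add: q_def g_def power2_eq_square algebra_simps)
    qed (use S in simp)
    also have "\<dots> = 4 * wb\<^sup>2 * q x / S * g v x" by simp
    also have "\<dots> \<le> (1 - \<delta>) * g v x"
    proof (intro mult_right_mono)
      have "wb\<^sup>2 \<le> wb" using w by (simp add: power2_eq_square mult_left_le)
      then have "4 * wb\<^sup>2 * q x \<le> 4 * wb * q x" using q0[of x] by (simp add: mult_right_mono)
      also have "\<delta> * S \<le> wa"
      proof -
        have "4 * wb * q x \<le> 4 * wb * M" using M(2)[of x] w by (intro mult_left_mono) auto
        then have "\<delta> * S \<le> \<delta> * (wa + 4 * wb * M)" using \<delta> by (intro mult_left_mono) (auto simp: S_def)
        also have "\<dots> = wa" using w M by (simp add: \<delta>_def add_pos_nonneg less_imp_neq[symmetric])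
        finally show ?thesis .
      qed
      then have "4 * wb * q x \<le> (1 - \<delta>) * S" by (simp add: S_def algebra_simps)
      finally show "4 * wb\<^sup>2 * q x / S \<le> 1 - \<delta>" using S by (simp add: divide_le_eq)
    qed (simp add: g_def)
    finally show ?thesis .
  qed
  obtain K where K: "K > 0" "\<And>f g x. smooth f \<Longrightarrow> smooth g \<Longrightarrow>
      energy f g x \<le> K * ((dd a f x)\<^sup>2 + (dd b f x)\<^sup>2 + (dd a g x)\<^sup>2 + (dd b g x)\<^sup>2)"
    by (rule energy_frame) blast
  define d where "d = (\<lambda>x. a x $ 1 * b x $ 2)"
  have d0: "d x > 0" for x using tri[of x] by (simp add: d_def)
  have smd: "smooth d" and perd: "doubly_periodic d"
    using pera perb unfolding d_def by (auto intro!: smooth_intros sm simp: doubly_periodic_def)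
  obtain d1 d2 where d: "0 < d1" "\<And>x. d1 \<le> d x" "\<And>x. d x \<le> d2" "0 < d2"
    using doubly_periodic_pos_bounds[OF smd perd d0] by metis
  define e where "e = (\<lambda>x. (p x)\<^sup>2 + (r x)\<^sup>2)"
  have sme: "smooth e" and pere: "doubly_periodic e"
    using per_coeffs unfolding e_def by (auto intro!: smooth_intros sm simp: doubly_periodic_def)
  obtain e1 where e1: "e1 > 0" "\<And>x. \<bar>e x\<bar> \<le> e1" using doubly_periodic_bounded[OF sme pere] by blast
  define C where "C = 2 * (1 + 1 / \<delta>) * e1"
  have C: "C > 0" using \<delta> e1 by (simp add: C_def add_pos_pos)
  have ell: "jac f h12 x \<le> - (\<delta>\<^sup>2 / (2 * d2 * K)) * energy f h12 x + C / d1 * ((f x)\<^sup>2 + (h12 x)\<^sup>2)" for x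
  proof -
    define G where "G = g a x + g b x"
    define o1 o2 where "o1 = 2 * (p x * h12 x - r x * f x)" and "o2 = - 2 * (p x * f x + r x * h12 x)"
    have h: "h11 = (\<lambda>x. H x + f x)" "h22 = (\<lambda>x. H x - f x)" by (auto simp: H_def f_def field_simps)
    have dh: "dd v h11 x = dd v H x + dd v f x" "dd v h22 x = dd v H x - dd v f x" for v
      unfolding h by (simp_all add: dd_add dd_diff smf smH)
    have s1: "dd a f x + dd b h12 x = dd a H x + o1" and s2: "dd a h12 x - dd b f x = dd b H x + o2"
      using codazzi[of x] unfolding dh by (simp_all add: o1_def o2_def f_def field_simps)
    define J where "J = dd a f x * dd b h12 x - dd b f x * dd a h12 x"
    \<comment> \<open>Twice a determinant is the sum of the squares of the two Codazzi combinations
      minus the sum of the squares of all entries. The combinations are controlled by the gradient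
      of \<open>H\<close>, so the negative energy dominates.\<close>
    have "2 * J = (dd a H x + o1)\<^sup>2 + (dd b H x + o2)\<^sup>2 - G"
      unfolding s1[symmetric] s2[symmetric] G_def g_def J_def by (simp add: power2_eq_square algebra_simps)
    also have "\<dots> \<le> - \<delta>\<^sup>2 * G + (1 + 1 / \<delta>) * (o1\<^sup>2 + o2\<^sup>2)"
    proof -
      \<comment> \<open>These weights leave a margin:
        \<open>(1 + \<delta>) * (1 - \<delta>) = 1 - \<delta>\<^sup>2\<close> is still below
        1.\<close>
      have young: "(u + v)\<^sup>2 \<le> (1 + \<delta>) * u\<^sup>2 + (1 + 1 / \<delta>) * v\<^sup>2" for u v :: real
      proof -
        have "0 \<le> (\<delta> * u - v)\<^sup>2 / \<delta>" using \<delta> by simp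
        also have "\<dots> = (1 + \<delta>) * u\<^sup>2 + (1 + 1 / \<delta>) * v\<^sup>2 - (u + v)\<^sup>2"
          using \<delta> by (simp add: field_simps power2_eq_square)
        finally show ?thesis by simp
      qed
      have "(1 + \<delta>) * (dd a H x)\<^sup>2 \<le> (1 + \<delta>) * ((1 - \<delta>) * g a x)"
        "(1 + \<delta>) * (dd b H x)\<^sup>2 \<le> (1 + \<delta>) * ((1 - \<delta>) * g b x)"
        using dH \<delta> by (intro mult_left_mono; simp)+
      then show ?thesis
        using young[of "dd a H x" o1] young[of "dd b H x" o2] unfolding G_def
        by (simp add: algebra_simps power2_eq_square)
    qed
    also have "o1\<^sup>2 + o2\<^sup>2 = 4 * e x * q x"
      by (simp add: o1_def o2_def e_def q_def power2_eq_square algebra_simps)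
    also have "(1 + 1 / \<delta>) * (4 * e x * q x) \<le> (1 + 1 / \<delta>) * (4 * e1 * q x)"
      using e1(2)[of x] \<delta> q0[of x] by (intro mult_left_mono mult_right_mono) auto
    finally have "2 * J \<le> - \<delta>\<^sup>2 * G + 2 * (C * q x)" by (simp add: C_def algebra_simps)
    then have J: "J \<le> - (\<delta>\<^sup>2 / 2) * G + C * q x" by simp
    have G0: "G \<ge> 0" by (simp add: G_def g_def)
    have "jac f h12 x = J / d x"
      using jac_frame[OF smf sm(10), of x, folded J_def] tri[of x] by (simp add: d_def)
    also have "\<dots> \<le> (- (\<delta>\<^sup>2 / 2) * G + C * q x) / d x"
      using J d0[of x] by (intro divide_right_mono) auto
    also have "\<dots> = - ((\<delta>\<^sup>2 / 2) * G / d x) + C * q x / d x"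
      by (simp add: add_divide_distrib diff_divide_distrib)
    also have "\<dots> \<le> - ((\<delta>\<^sup>2 / 2) * G / d2) + C * q x / d1"
      using d d0[of x] G0 C q0[of x] by (intro add_mono le_imp_neg_le divide_left_mono) auto
    finally have "jac f h12 x \<le> - ((\<delta>\<^sup>2 / 2) * G / d2) + C * q x / d1" .
    moreover have "(\<delta>\<^sup>2 / 2) * (energy f h12 x / K) / d2 \<le> (\<delta>\<^sup>2 / 2) * G / d2"
      using K(2)[OF smf sm(10), of x] K(1) d
      by (intro divide_right_mono mult_left_mono) (auto simp: G_def g_def field_simps)
    ultimately have "jac f h12 x \<le> - ((\<delta>\<^sup>2 / 2) * (energy f h12 x / K) / d2) + C * q x / d1" by linarith
    then show ?thesis by (simp add: q_def mult_ac)
  qed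
  have z: "f x = 0" "h12 x = 0" using umb by (simp_all add: f_def)
  have c: "\<delta>\<^sup>2 / (2 * d2 * K) > 0" using \<delta> K(1) d(4) by simp
  have "f y = 0 \<and> h12 y = 0" for y
    by (rule elliptic_zero_free[OF smf perf sm(10) per_coeffs(4) c ell z])
  then have "h12 y = 0" "h11 y = h22 y" for y by (auto simp: f_def)
  then show False by (rule not_totally_umbilic)
qed

end

section \<open>Diagonalising the second fundamental form\<close>

context frame begin

lemma rotate_frame:
  assumes \<theta>: "smooth (\<theta> :: real^2 \<Rightarrow> real)"
  shows "frame F N (\<lambda>x. cos (\<theta> x) *\<^sub>R E1 x + sin (\<theta> x) *\<^sub>R E2 x) (\<lambda>x. cos (\<theta> x) *\<^sub>R E2 x - sin (\<theta> x) *\<^sub>R E1 x)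
    (\<lambda>x. cos (\<theta> x) *\<^sub>R a x + sin (\<theta> x) *\<^sub>R b x) (\<lambda>x. cos (\<theta> x) *\<^sub>R b x - sin (\<theta> x) *\<^sub>R a x)"
proof
  have cs: "cos t * cos t + sin t * sin t = 1" for t :: real
    using sin_cos_squared_add2[of t] by (simp add: power2_eq_square)
  note [simp] = orth inner_add_left inner_add_right inner_diff_left inner_diff_right cs
  show "smooth (\<lambda>x. cos (\<theta> x) *\<^sub>R E1 x + sin (\<theta> x) *\<^sub>R E2 x)" "smooth (\<lambda>x. cos (\<theta> x) *\<^sub>R E2 x - sin (\<theta> x) *\<^sub>R E1 x)"
    "smooth (\<lambda>x. cos (\<theta> x) *\<^sub>R a x + sin (\<theta> x) *\<^sub>R b x)" "smooth (\<lambda>x. cos (\<theta> x) *\<^sub>R b x - sin (\<theta> x) *\<^sub>R a x)"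
    "smooth F" "smooth N"
    by (intro smooth_intros sm \<theta>)+
  fix x
  show "dd (\<lambda>x. cos (\<theta> x) *\<^sub>R a x + sin (\<theta> x) *\<^sub>R b x) F x = cos (\<theta> x) *\<^sub>R E1 x + sin (\<theta> x) *\<^sub>R E2 x"
    "dd (\<lambda>x. cos (\<theta> x) *\<^sub>R b x - sin (\<theta> x) *\<^sub>R a x) F x = cos (\<theta> x) *\<^sub>R E2 x - sin (\<theta> x) *\<^sub>R E1 x"
    by (simp_all add: dd_field_add dd_field_diff dd_field_scaleR sm structure_eqs)
  show "F x \<bullet> F x = 1" "N x \<bullet> N x = 1" "F x \<bullet> N x = 0" by simp_all
  show "F x \<bullet> (cos (\<theta> x) *\<^sub>R E1 x + sin (\<theta> x) *\<^sub>R E2 x) = 0" "F x \<bullet> (cos (\<theta> x) *\<^sub>R E2 x - sin (\<theta> x) *\<^sub>R E1 x) = 0"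
   "N x \<bullet> (cos (\<theta> x) *\<^sub>R E1 x + sin (\<theta> x) *\<^sub>R E2 x) = 0" "N x \<bullet> (cos (\<theta> x) *\<^sub>R E2 x - sin (\<theta> x) *\<^sub>R E1 x) = 0"
   "(cos (\<theta> x) *\<^sub>R E1 x + sin (\<theta> x) *\<^sub>R E2 x) \<bullet> (cos (\<theta> x) *\<^sub>R E1 x + sin (\<theta> x) *\<^sub>R E2 x) = 1"
   "(cos (\<theta> x) *\<^sub>R E2 x - sin (\<theta> x) *\<^sub>R E1 x) \<bullet> (cos (\<theta> x) *\<^sub>R E2 x - sin (\<theta> x) *\<^sub>R E1 x) = 1"
   "(cos (\<theta> x) *\<^sub>R E1 x + sin (\<theta> x) *\<^sub>R E2 x) \<bullet> (cos (\<theta> x) *\<^sub>R E2 x - sin (\<theta> x) *\<^sub>R E1 x) = 0"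
    by simp_all
qed

text \<open>Rotating the frame by the angle \<open>\<theta>\<close> multiplies the complex number
  \<open>q\<close> by \<open>exp (- 2 * \<i> * \<theta>)\<close>. Without umbilics \<open>q\<close>
  has no zeros and the plane is contractible, so \<open>q\<close> has a smooth logarithm; half of
  its imaginary part is an angle that makes \<open>q\<close> real and positive.\<close>

lemma principal_frame_exists:
  assumes nu: "\<And>x. h11 x \<noteq> h22 x \<or> h12 x \<noteq> 0"
  obtains E1' E2' a' b' where "frame F N E1' E2' a' b'" "\<And>x. frame.h12 N E2' a' x = 0"
    "\<And>x. frame.h11 N E1' a' x > frame.h22 N E2' b' x"
    "\<And>x. frame.h11 N E1' a' x + frame.h22 N E2' b' x = h11 x + h22 x"
    "\<And>x. (frame.h11 N E1' a' x - frame.h22 N E2' b' x)\<^sup>2 = (h11 x - h22 x)\<^sup>2 + 4 * (h12 x)\<^sup>2"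
proof -
  define f where "f = (\<lambda>x. (h11 x - h22 x) / 2)"
  define q where "q = (\<lambda>x. of_real (f x) + \<i> * of_real (h12 x))"
  have smf: "smooth f" unfolding f_def by (intro smooth_intros sm) simp
  have smq: "smooth q" unfolding q_def by (intro smooth_intros smf sm)
  have Req: "Re (q x) = f x" "Im (q x) = h12 x" for x by (simp_all add: q_def)
  have qnz: "q x \<noteq> 0" for x
    using nu[of x] Req[of x] by (auto simp: complex_eq_iff f_def)
  obtain g where g: "continuous_on UNIV g" "\<And>x. q x = exp (g x)"
    using continuous_logarithm_on_contractible[OF smooth_continuous_on[OF smq, of UNIV] convex_imp_contractible[OF convex_UNIV]] qnz
    by (metis UNIV_I)
  have smg: "smooth g" by (rule smooth_continuous_log[OF smq g])
  define \<theta> where "\<theta> = (\<lambda>x. Im (g x) / 2)"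
  have sm\<theta>: "smooth \<theta>" unfolding \<theta>_def by (intro smooth_intros smg) simp
  define \<rho> where "\<rho> = (\<lambda>x. exp (Re (g x)))"
  define C S where "C = (\<lambda>x. cos (\<theta> x))" and "S = (\<lambda>x. sin (\<theta> x))"
  have CS: "C x * C x + S x * S x = 1" for x
    using sin_cos_squared_add2[of "\<theta> x"] by (simp add: power2_eq_square C_def S_def)
  have fC: "f x = \<rho> x * (C x * C x - S x * S x)" and hS: "h12 x = \<rho> x * (2 * S x * C x)" for x
  proof -
    have "Im (g x) = 2 * \<theta> x" by (simp add: \<theta>_def)
    then show "f x = \<rho> x * (C x * C x - S x * S x)" "h12 x = \<rho> x * (2 * S x * C x)"
      unfolding Req[symmetric] g(2) Re_exp Im_exp
      by (simp_all add: \<rho>_def C_def S_def cos_double sin_double power2_eq_square)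
  qed
  let ?E1 = "\<lambda>x. C x *\<^sub>R E1 x + S x *\<^sub>R E2 x" and ?E2 = "\<lambda>x. C x *\<^sub>R E2 x - S x *\<^sub>R E1 x"
  let ?a = "\<lambda>x. C x *\<^sub>R a x + S x *\<^sub>R b x" and ?b = "\<lambda>x. C x *\<^sub>R b x - S x *\<^sub>R a x"
  interpret R: frame F N ?E1 ?E2 ?a ?b
    unfolding C_def S_def by (rule rotate_frame[OF sm\<theta>])
  have da: "dd ?a N x = C x *\<^sub>R (h11 x *\<^sub>R E1 x + h12 x *\<^sub>R E2 x) + S x *\<^sub>R (h12 x *\<^sub>R E1 x + h22 x *\<^sub>R E2 x)"
    and db: "dd ?b N x = C x *\<^sub>R (h12 x *\<^sub>R E1 x + h22 x *\<^sub>R E2 x) - S x *\<^sub>R (h11 x *\<^sub>R E1 x + h12 x *\<^sub>R E2 x)" for x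
    by (simp_all only: dd_field_add[OF smN] dd_field_diff[OF smN] dd_field_scaleR[OF smN] structure_eqs)
  have "R.h12 x = h12 x * (C x * C x - S x * S x) - 2 * S x * C x * f x" for x
    unfolding R.h12_def da by (simp add: inner_add_left inner_add_right inner_diff_right orth f_def field_simps)
  then have 1: "R.h12 x = 0" for x unfolding fC hS by simp
  have "R.h11 x - R.h22 x = 2 * f x * (C x * C x - S x * S x) + 4 * S x * C x * h12 x" for x
    unfolding R.h11_def R.h22_def da db
    by (simp add: inner_add_left inner_add_right inner_diff_right inner_diff_left orth f_def field_simps)
  also have "2 * f x * (C x * C x - S x * S x) + 4 * S x * C x * h12 x = 2 * \<rho> x * (C x * C x + S x * S x)\<^sup>2" for x
    unfolding fC hS by (simp add: power2_eq_square algebra_simps)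
  finally have diff: "R.h11 x - R.h22 x = 2 * \<rho> x" for x by (simp add: CS)
  then have 2: "R.h11 x > R.h22 x" for x
  proof -
    have "\<rho> x > 0" by (simp add: \<rho>_def)
    then show ?thesis using diff[of x] by linarith
  qed
  have "R.h11 x + R.h22 x = (h11 x + h22 x) * (C x * C x + S x * S x)" for x
    unfolding R.h11_def R.h22_def da db
    by (simp add: inner_add_left inner_add_right inner_diff_right inner_diff_left orth algebra_simps)
  then have 3: "R.h11 x + R.h22 x = h11 x + h22 x" for x by (simp add: CS)
  have "(h11 x - h22 x)\<^sup>2 + 4 * (h12 x)\<^sup>2 = 4 * ((f x)\<^sup>2 + (h12 x)\<^sup>2)" for x
    by (simp add: f_def power_divide)
  also have "4 * ((f x)\<^sup>2 + (h12 x)\<^sup>2) = (2 * \<rho> x * (C x * C x + S x * S x))\<^sup>2" for x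
    unfolding fC hS by (simp add: power2_eq_square algebra_simps)
  finally have 4: "(R.h11 x - R.h22 x)\<^sup>2 = (h11 x - h22 x)\<^sup>2 + 4 * (h12 x)\<^sup>2" for x
    by (simp add: diff CS)
  show ?thesis by (rule that[OF R.frame_axioms 1 2 3 4])
qed

end

section \<open>The two-point maximum principle\<close>

text \<open>The field \<open>c = (a, e)\<close> moves both points of the pair simultaneously; this
  coupling produces the mixed terms of the second variation. The condition in \<open>y\<close> alone
  is derived separately and simplifies the first-order condition in \<open>x\<close>.\<close>

lemma two_point_variation:
  fixes F N :: "real^2 \<Rightarrow> real^4" and \<Phi> :: "real^2 \<Rightarrow> real"
  assumes sm: "smooth F" "smooth N" "smooth \<Phi>" "smooth a" "smooth e"
    and min: "\<And>x y. \<Phi> x0 * (1 - F x0 \<bullet> F y0) + N x0 \<bullet> F y0 \<le> \<Phi> x * (1 - F x \<bullet> F y) + N x \<bullet> F y"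
  shows "dd a \<Phi> x0 * (1 - F x0 \<bullet> F y0) - \<Phi> x0 * (dd a F x0 \<bullet> F y0) + dd a N x0 \<bullet> F y0 = 0" (is ?A)
    and "N x0 \<bullet> dd e F y0 = \<Phi> x0 * (F x0 \<bullet> dd e F y0)" (is ?B)
    and "0 \<le> dd a (dd a \<Phi>) x0 * (1 - F x0 \<bullet> F y0) - 2 * dd a \<Phi> x0 * (dd a F x0 \<bullet> F y0 + F x0 \<bullet> dd e F y0)
      - \<Phi> x0 * (dd a (dd a F) x0 \<bullet> F y0 + 2 * (dd a F x0 \<bullet> dd e F y0) + F x0 \<bullet> dd e (dd e F) y0)
      + dd a (dd a N) x0 \<bullet> F y0 + 2 * (dd a N x0 \<bullet> dd e F y0) + N x0 \<bullet> dd e (dd e F) y0" (is ?C)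
proof -
  define Z where "Z = (\<lambda>z. \<Phi> (fst z) * (1 - F (fst z) \<bullet> F (snd z)) + N (fst z) \<bullet> F (snd z))"
  define c where "c = (\<lambda>z. (a (fst z), e (snd z)))"
  have dfst: "dd c (\<lambda>z. f (fst z)) = (\<lambda>z. dd a f (fst z))" if "smooth f" for f :: "real^2 \<Rightarrow> 'c::real_normed_vector"
    using dd_fst[OF that, of c] by (simp add: c_def dd_def fun_eq_iff)
  have dsnd: "dd c (\<lambda>z. f (snd z)) = (\<lambda>z. dd e f (snd z))" if "smooth f" for f :: "real^2 \<Rightarrow> 'c::real_normed_vector"
    using dd_snd[OF that, of c] by (simp add: c_def dd_def fun_eq_iff)
  have smc: "smooth c" unfolding c_def by (intro smooth_Pair smooth_fst smooth_snd sm)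
  have smd: "smooth (dd a \<Phi>)" "smooth (dd a F)" "smooth (dd a N)" "smooth (dd e F)"
    by (intro smooth_dd sm)+
  note s = sm smd
  have smZ: "smooth Z" unfolding Z_def
    by (intro smooth_add smooth_mult smooth_diff smooth_const smooth_inner smooth_fst smooth_snd sm)
  have minZ: "Z (x0, y0) \<le> Z z" for z using min[of "fst z" "snd z"] by (simp add: Z_def)
  have D1: "dd c Z = (\<lambda>z. dd a \<Phi> (fst z) * (1 - F (fst z) \<bullet> F (snd z))
      - \<Phi> (fst z) * (dd a F (fst z) \<bullet> F (snd z) + F (fst z) \<bullet> dd e F (snd z))
      + (dd a N (fst z) \<bullet> F (snd z) + N (fst z) \<bullet> dd e F (snd z)))"
    unfolding Z_def
    by (simp add: fun_eq_iff dd_add dd_diff dd_mult dd_inner dd_const dfst dsnd smooth_fst smooth_snd s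
        smooth_add smooth_diff smooth_mult smooth_inner smooth_const) (simp add: algebra_simps)
  have D2: "dd c (dd c Z) (x0, y0) = dd a (dd a \<Phi>) x0 * (1 - F x0 \<bullet> F y0) - 2 * dd a \<Phi> x0 * (dd a F x0 \<bullet> F y0 + F x0 \<bullet> dd e F y0)
      - \<Phi> x0 * (dd a (dd a F) x0 \<bullet> F y0 + 2 * (dd a F x0 \<bullet> dd e F y0) + F x0 \<bullet> dd e (dd e F) y0)
      + dd a (dd a N) x0 \<bullet> F y0 + 2 * (dd a N x0 \<bullet> dd e F y0) + N x0 \<bullet> dd e (dd e F) y0"
    unfolding D1
    by (simp add: dd_add dd_diff dd_mult dd_inner dd_const dfst dsnd smooth_fst smooth_snd s
        smooth_add smooth_diff smooth_mult smooth_inner smooth_const algebra_simps)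
  show ?C using second_derivative_test[OF smZ smc minZ] unfolding D2 .
  have "dd c Z (x0, y0) = 0"
    using frechet_zero_at_minimum[OF smZ minZ] by (simp add: dd_def)
  then have full: "dd a \<Phi> x0 * (1 - F x0 \<bullet> F y0)
      - \<Phi> x0 * (dd a F x0 \<bullet> F y0 + F x0 \<bullet> dd e F y0)
      + (dd a N x0 \<bullet> F y0 + N x0 \<bullet> dd e F y0) = 0" unfolding D1 by simp
  have "dd (\<lambda>z. (0, e (snd z))) Z (x0, y0) = 0"
    using frechet_zero_at_minimum[OF smZ minZ] by (simp add: dd_def)
  moreover have "dd (\<lambda>z. (0, e (snd z))) Z (x0, y0) = - \<Phi> x0 * (F x0 \<bullet> dd e F y0) + N x0 \<bullet> dd e F y0"
  proof -
    have 1: "dd (\<lambda>z. (0, e (snd z))) (\<lambda>z. f (fst z)) z = 0" if "smooth f" for f :: "real^2 \<Rightarrow> 'c::real_normed_vector" and z :: "(real^2) \<times> (real^2)"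
      using dd_fst[OF that, of "\<lambda>z. (0, e (snd z))" z] linear_0[OF has_derivative_linear[OF smooth_frechet[OF that]]] by simp
    have 2: "dd (\<lambda>z. (0, e (snd z))) (\<lambda>z. f (snd z)) z = dd e f (snd z)" if "smooth f" for f :: "real^2 \<Rightarrow> 'c::real_normed_vector" and z :: "(real^2) \<times> (real^2)"
      using dd_snd[OF that, of "\<lambda>z. (0, e (snd z))" z] by (simp add: dd_def)
    show ?thesis unfolding Z_def
      by (simp add: dd_add dd_diff dd_mult dd_inner dd_const 1 2 smooth_fst smooth_snd s
        smooth_add smooth_diff smooth_mult smooth_inner smooth_const)
  qed
  ultimately show ?B by simp
  then show ?A using full by (simp add: algebra_simps)
qed

text \<open>The second variations in two orthogonal principal directions, weighted by the coefficients
  \<open>1 - t\<close> and \<open>1 + t\<close> of the linearised Weingarten equation and combined with Simons' identity.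
  Here \<open>q\<^sub>1 = u\<^sub>1 / ((k - 1) u)\<close> and \<open>q\<^sub>2 = u\<^sub>2 / ((k + 1) u)\<close>, which makes everything polynomial.\<close>

lemma touching_algebra:
  fixes R u k t d H q1 q2 u11 u22 hy1 hy2 p r :: real
  assumes pos: "R > 0" "u > 0" "k > 1" "0 \<le> t" "t < 1" "0 \<le> d" "u * d \<le> 1 - t\<^sup>2" "H - u * t > 0"
    and pr: "p = (1 + t) * (k + 1) * q2 / 2" "r = - ((1 - t) * (k - 1) * q1 / 2)"
    and simons: "(1 + t) * u22 + (1 - t) * u11 = 2 * u * (1 + H\<^sup>2 - u\<^sup>2)
      + ((1 + t)\<^sup>2 * u * (k + 1)\<^sup>2 * q2\<^sup>2 + (1 - t)\<^sup>2 * u * (k - 1)\<^sup>2 * q1\<^sup>2) / 2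
      + ((1 + t) * u * (k + 1)\<^sup>2 * q2\<^sup>2 + (1 - t) * u * (k - 1)\<^sup>2 * q1\<^sup>2)
      - d * u\<^sup>2 * ((k + 1)\<^sup>2 * q2\<^sup>2 - (k - 1)\<^sup>2 * q1\<^sup>2)"
    and hy: "(1 - t) * hy1 + (1 + t) * hy2 \<ge> 2 * (H - u * t)"
    and I1: "0 \<le> R * (((t + k) * u11 + d * (u * (k - 1) * q1)\<^sup>2) - (k - 1) * u * ((H + u) * (H + k * u) + 1))
      - 2 * ((t + k) * (u * (k - 1) * q1)) * (R * (t + k) * q1) - (k - 1) * u * p * (R * (t + k) * q2)
      + (1 + t) * (u * (k - 1) * q1) * (R * (t + k) * q1) + (H + u) - hy1"
    and I2: "0 \<le> R * (((t + k) * u22 + d * (u * (k + 1) * q2)\<^sup>2) - (k + 1) * u * ((H - u) * (H + k * u) + 1))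
      - 2 * ((t + k) * (u * (k + 1) * q2)) * (R * (t + k) * q2) + (k + 1) * u * r * (R * (t + k) * q1)
      + (t - 1) * (u * (k + 1) * q2) * (R * (t + k) * q2) + (H - u) - hy2"
  shows False
proof -
  define I1' where "I1' = R * (d * (u * (k - 1) * q1)\<^sup>2 - (k - 1) * u * ((H + u) * (H + k * u) + 1))
      - 2 * ((t + k) * (u * (k - 1) * q1)) * (R * (t + k) * q1) - (k - 1) * u * p * (R * (t + k) * q2)
      + (1 + t) * (u * (k - 1) * q1) * (R * (t + k) * q1) + (H + u) - hy1"
  define I2' where "I2' = R * (d * (u * (k + 1) * q2)\<^sup>2 - (k + 1) * u * ((H - u) * (H + k * u) + 1))
      - 2 * ((t + k) * (u * (k + 1) * q2)) * (R * (t + k) * q2) + (k + 1) * u * r * (R * (t + k) * q1)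
      + (t - 1) * (u * (k + 1) * q2) * (R * (t + k) * q2) + (H - u) - hy2"
  \<comment> \<open>What remains after Simons' identity has removed the second derivatives of
    \<open>u\<close>. The only nonnegative gradient term, the one with \<open>q1\<close> and
    \<open>d\<close>, is absorbed by the term next to it through
    \<open>u * d \<le> 1 - t\<^sup>2\<close>.\<close>
  define T where "T = 2 * (1 - k\<^sup>2) * u\<^sup>2 * (H - u * t)
     + u\<^sup>2 * (k - 1)\<^sup>2 * q1\<^sup>2 * (k + 1) * d - u * (k - 1) * q1\<^sup>2 * (k + 1) * (1 - t\<^sup>2) * (t + k)
     + u\<^sup>2 * (k + 1)\<^sup>2 * q2\<^sup>2 * (1 - k) * d + u * (k + 1) * q2\<^sup>2 * (1 - k) * (1 - t\<^sup>2) * (t + k)"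
  have "R * (t + k) * u11 + I1' \<ge> 0" "R * (t + k) * u22 + I2' \<ge> 0"
    unfolding I1'_def I2'_def
    by (rule order_trans[OF I1 eq_refl] order_trans[OF I2 eq_refl], simp add: algebra_simps)+
  then have "0 \<le> (1 - t) * (R * (t + k) * u11 + I1') + (1 + t) * (R * (t + k) * u22 + I2')"
    using pos(4,5) by (intro add_nonneg_nonneg[OF mult_nonneg_nonneg mult_nonneg_nonneg]) auto
  also have "\<dots> = R * (t + k) * ((1 + t) * u22 + (1 - t) * u11) + (1 - t) * I1' + (1 + t) * I2'"
    by (simp add: algebra_simps)
  also have "\<dots> = R * T + (2 * (H - u * t) - ((1 - t) * hy1 + (1 + t) * hy2))"
    unfolding simons I1'_def I2'_def T_def pr by (simp add: power2_eq_square field_simps)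
  finally have RT: "0 \<le> R * T" using hy by linarith
  have t2: "1 - t\<^sup>2 \<ge> 0" using pos(4,5) by (simp add: power2_eq_square mult_le_one less_imp_le)
  have k2: "1 - k\<^sup>2 < 0" using pos(3) by (simp add: power2_eq_square less_1_mult)
  have a: "2 * (1 - k\<^sup>2) * u\<^sup>2 * (H - u * t) < 0"
  proof -
    have "(1 - k\<^sup>2) * (2 * u\<^sup>2 * (H - u * t)) < 0"
      by (intro mult_neg_pos[OF k2] mult_pos_pos) (use pos(2,8) in auto)
    then show ?thesis by (simp only: mult_ac)
  qed
  have b: "u\<^sup>2 * (k - 1)\<^sup>2 * q1\<^sup>2 * (k + 1) * d \<le> u * (k - 1) * q1\<^sup>2 * (k + 1) * (1 - t\<^sup>2) * (t + k)"
  proof -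
    have "(k - 1) * (u * d) \<le> (t + k) * (1 - t\<^sup>2)"
      using pos t2 by (intro mult_mono) auto
    then have "u * (k - 1) * q1\<^sup>2 * (k + 1) * ((k - 1) * (u * d)) \<le> u * (k - 1) * q1\<^sup>2 * (k + 1) * ((t + k) * (1 - t\<^sup>2))"
      using pos by (intro mult_left_mono) auto
    then show ?thesis by (simp add: power2_eq_square mult_ac)
  qed
  have c: "u\<^sup>2 * (k + 1)\<^sup>2 * q2\<^sup>2 * (1 - k) * d \<le> 0"
    using pos by (intro mult_nonpos_nonneg mult_nonneg_nonpos) auto
  have e: "u * (k + 1) * q2\<^sup>2 * (1 - k) * (1 - t\<^sup>2) * (t + k) \<le> 0"
    using pos t2 by (intro mult_nonpos_nonneg mult_nonneg_nonpos) auto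
  have "T < 0" unfolding T_def using a b c e by linarith
  then show False using RT pos(1) by (simp add: zero_le_mult_iff)
qed

section \<open>The Weingarten relation in a principal frame\<close>

locale principal_frame = frame +
  fixes wa wb wc :: real
  assumes w: "0 < wa" "0 \<le> wb" "wb \<le> 1" "0 \<le> wc"
    and h12z: "h12 x = 0" and h_gt: "h11 x > h22 x"
    and weingarten: "(h11 x + h22 x - wc)\<^sup>2 = wa + wb * (h11 x - h22 x)\<^sup>2" "h11 x + h22 x \<ge> wc"
begin

text \<open>The Weingarten relation says \<open>H = \<psi>(u)\<close> with \<open>\<psi>(u) = (wc + sqrt (wa + 4 wb u\<^sup>2)) / 2\<close>; the functions
  \<open>t\<close> and \<open>d\<close> are \<open>\<psi>'(u)\<close> and \<open>\<psi>''(u)\<close>.\<close>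

definition "u x = (h11 x - h22 x) / 2"
definition "H x = (h11 x + h22 x) / 2"
definition "S x = sqrt (wa + 4 * wb * (u x)\<^sup>2)"
definition "t x = 2 * wb * u x / S x"
definition "d x = 2 * wb * wa / (S x)^3"

lemma h_eq: "h11 x = H x + u x" "h22 x = H x - u x"
  by (simp_all add: H_def u_def field_simps)

lemma u_pos: "u x > 0" using h_gt[of x] by (simp add: u_def)

lemma S_arg: "wa + 4 * wb * (u x)\<^sup>2 > 0"
  using w by (simp add: add_pos_nonneg)

lemma S_pos: "S x > 0" using S_arg by (simp add: S_def)

lemma S_sq: "(S x)\<^sup>2 = wa + 4 * wb * (u x)\<^sup>2" using S_arg[of x] by (simp add: S_def)

lemma smu: "smooth u" and smH: "smooth H"
  unfolding u_def[abs_def] H_def[abs_def] by (intro smooth_intros sm; simp)+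

lemma smS: "smooth S"
  unfolding S_def[abs_def] by (intro smooth_intros smu S_arg)

lemma smt: "smooth t"
  unfolding t_def[abs_def] using S_pos by (intro smooth_intros smu smS) (simp add: less_imp_neq[symmetric])

lemma H_val: "H x = (wc + S x) / 2"
proof -
  have "(h11 x + h22 x - wc)\<^sup>2 = (S x)\<^sup>2"
    unfolding weingarten S_sq by (simp add: u_def power_divide)
  then have "h11 x + h22 x - wc = S x"
    using weingarten(2)[of x] S_pos[of x] by (metis diff_ge_0_iff_ge less_imp_le power2_eq_iff_nonneg)
  then show ?thesis by (simp add: H_def)
qed

lemma dS: "dd v S x = 2 * t x * dd v u x"
proof -
  have "((\<lambda>s. sqrt (wa + 4 * wb * s\<^sup>2)) has_real_derivative (4 * wb * u x / S x)) (at (u x))"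
    unfolding S_def using S_arg[of x] by (auto intro!: derivative_eq_intros simp: divide_simps)
  from dd_real_compose[OF this smu] show ?thesis by (simp add: S_def[abs_def] t_def)
qed

lemma dH: "dd v H x = t x * dd v u x"
proof -
  have "H = (\<lambda>x. wc / 2 + (1 / 2) * S x)" by (simp add: fun_eq_iff H_val add_divide_distrib)
  then have "dd v H x = dd v (\<lambda>x. wc / 2 + (1 / 2) * S x) x" by simp
  also have "\<dots> = (1 / 2) * dd v S x"
    using smS by (simp only: dd_add dd_mult dd_const smooth_const smooth_mult)
  finally show ?thesis by (simp add: dS)
qed

lemma dt: "dd v t x = d x * dd v u x"
proof -
  have "dd v t x = ((2 * wb * dd v u x) * S x - 2 * wb * u x * dd v S x) / (S x * S x)"
    unfolding t_def[abs_def] using S_pos[of x]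
    by (subst dd_divide) (auto simp: dd_mult dd_const smooth_mult smooth_const smu smS)
  also have "\<dots> = 2 * wb * ((S x)\<^sup>2 - 4 * wb * (u x)\<^sup>2) / (S x)^3 * dd v u x"
    unfolding dS t_def using S_pos[of x] by (simp add: field_simps power2_eq_square power3_eq_cube)
  also have "(S x)\<^sup>2 - 4 * wb * (u x)\<^sup>2 = wa" by (simp add: S_sq)
  finally show ?thesis by (simp add: d_def)
qed

text \<open>All follow from the formula for \<open>(S x)\<^sup>2\<close>:
  \<open>1 - (t x)\<^sup>2\<close> is at least \<open>wa / (S x)\<^sup>2\<close> since
  \<open>wb \<le> 1\<close>, \<open>u x * d x\<close> is that quotient times \<open>t x\<close>, and
  \<open>H x - u x * t x\<close> equals \<open>wc / 2 + wa / (2 * S x)\<close>.\<close>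

lemma t_bounds: "0 \<le> t x" "t x < 1" "0 \<le> d x" "u x * d x \<le> 1 - (t x)\<^sup>2" "H x - u x * t x > 0"
proof -
  note S = S_pos[of x] and u = u_pos[of x]
  show t0: "0 \<le> t x" using S u w by (simp add: t_def)
  show "0 \<le> d x" using S w by (simp add: d_def)
  have 1: "1 - (t x)\<^sup>2 = (wa + 4 * wb * (1 - wb) * (u x)\<^sup>2) / (S x)\<^sup>2"
  proof -
    have "1 - (t x)\<^sup>2 = ((S x)\<^sup>2 - 4 * wb\<^sup>2 * (u x)\<^sup>2) / (S x)\<^sup>2"
      using S by (simp add: t_def power_divide power_mult_distrib diff_divide_distrib)
    moreover have "(S x)\<^sup>2 - 4 * wb\<^sup>2 * (u x)\<^sup>2 = wa + 4 * wb * (1 - wb) * (u x)\<^sup>2"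
      unfolding S_sq by (simp add: algebra_simps power2_eq_square)
    ultimately show ?thesis by simp
  qed
  have 2: "1 - (t x)\<^sup>2 \<ge> wa / (S x)\<^sup>2"
    unfolding 1 using w S by (intro divide_right_mono) auto
  have "wa / (S x)\<^sup>2 > 0" using w S by simp
  with 2 have "(t x)\<^sup>2 < 1" by linarith
  then show t1: "t x < 1" using t0 by (simp add: power2_less_1_iff abs_square_less_1)
  have "u x * d x = wa / (S x)\<^sup>2 * t x"
    using S by (simp add: d_def t_def power2_eq_square power3_eq_cube)
  also have "\<dots> \<le> wa / (S x)\<^sup>2 * 1" using w t1 by (intro mult_left_mono) auto
  finally show "u x * d x \<le> 1 - (t x)\<^sup>2" using 2 by simp
  have "H x - u x * t x = wc / 2 + ((S x)\<^sup>2 - 4 * wb * (u x)\<^sup>2) / (2 * S x)"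
    using S by (simp add: H_val t_def field_simps power2_eq_square)
  also have "\<dots> = wc / 2 + wa / (2 * S x)" by (simp add: S_sq)
  also have "\<dots> > 0" using w S by (simp add: add_nonneg_pos)
  finally show "H x - u x * t x > 0" .
qed

lemma dh: "dd v h11 x = (1 + t x) * dd v u x" "dd v h22 x = (t x - 1) * dd v u x"
proof -
  have h: "h11 = (\<lambda>x. H x + u x)" "h22 = (\<lambda>x. H x - u x)" by (simp_all add: fun_eq_iff h_eq)
  show "dd v h11 x = (1 + t x) * dd v u x" "dd v h22 x = (t x - 1) * dd v u x"
    unfolding h by (simp_all add: dd_add dd_diff smu smH dH algebra_simps)
qed

text \<open>With \<open>h12 = 0\<close> the Codazzi equations become algebraic in the connection
  coefficients and can be solved for them, since \<open>u\<close> has no zeros.\<close>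

lemma p_val: "p x = (1 + t x) * dd b u x / (2 * u x)" and r_val: "r x = - ((1 - t x) * dd a u x / (2 * u x))"
proof -
  have "h12 = (\<lambda>x. 0)" using h12z by blast
  then have h12d: "dd v h12 x = 0" for v by (simp add: dd_const)
  have "(1 + t x) * dd b u x = 2 * u x * p x" "- (1 - t x) * dd a u x = 2 * u x * r x"
    using codazzi[of x] unfolding h12d h12z dh h_eq by (simp_all add: algebra_simps)
  then show "p x = (1 + t x) * dd b u x / (2 * u x)" "r x = - ((1 - t x) * dd a u x / (2 * u x))"
    using u_pos[of x] by (simp_all add: field_simps)
qed

text \<open>Simons' identity appears here as the Gauss equation, multiplied by
  \<open>2 * u x\<close>, with the connection coefficients expressed by derivatives of
  \<open>u\<close>.\<close>

lemma simons:
  "(1 + t x) * dd b (dd b u) x + (1 - t x) * dd a (dd a u) x = 2 * u x * (1 + (H x)\<^sup>2 - (u x)\<^sup>2)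
    + ((1 + t x)\<^sup>2 * (dd b u x)\<^sup>2 + (1 - t x)\<^sup>2 * (dd a u x)\<^sup>2) / (2 * u x)
    + ((1 + t x) * (dd b u x)\<^sup>2 + (1 - t x) * (dd a u x)\<^sup>2) / u x
    - d x * ((dd b u x)\<^sup>2 - (dd a u x)\<^sup>2)"
proof -
  have u0: "u x \<noteq> 0" using u_pos[of x] by simp
  have smab: "smooth (dd a u)" "smooth (dd b u)" by (intro smooth_dd smu sm)+
  have p: "p = (\<lambda>x. (1 + t x) * dd b u x / (2 * u x))" and r: "r = (\<lambda>x. - ((1 - t x) * dd a u x / (2 * u x)))"
    using p_val r_val by blast+
  have Dp: "dd b p x = (((1 + t x) * dd b (dd b u) x + d x * (dd b u x)\<^sup>2) * (2 * u x) - (1 + t x) * dd b u x * (2 * dd b u x)) / (2 * u x * (2 * u x))"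
    unfolding p using u0
    by (subst dd_divide) (auto simp: dd_add dd_mult dd_const smooth_mult smooth_add smooth_const smu smt smab dt power2_eq_square algebra_simps)
  have Dr: "dd a r x = - (((1 - t x) * dd a (dd a u) x - d x * (dd a u x)\<^sup>2) * (2 * u x) - (1 - t x) * dd a u x * (2 * dd a u x)) / (2 * u x * (2 * u x))"
  proof -
    have "smooth (\<lambda>x. (1 - t x) * dd a u x / (2 * u x))"
      using u_pos by (intro smooth_intros smt smu smab) (metis less_irrefl mult_eq_0_iff zero_neq_numeral)
    then have "dd a r x = - dd a (\<lambda>x. (1 - t x) * dd a u x / (2 * u x)) x"
      unfolding r by (rule dd_minus)
    also have "dd a (\<lambda>x. (1 - t x) * dd a u x / (2 * u x)) x =
      (((1 - t x) * dd a (dd a u) x - d x * (dd a u x)\<^sup>2) * (2 * u x) - (1 - t x) * dd a u x * (2 * dd a u x)) / (2 * u x * (2 * u x))"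
      using u0
      by (subst dd_divide) (auto simp: dd_diff dd_mult dd_const smooth_mult smooth_diff smooth_const smu smt smab dt power2_eq_square algebra_simps)
    finally show ?thesis by (simp only: minus_divide_left)
  qed
  have "2 * u x * dd b p x = (1 + t x) * dd b (dd b u) x + d x * (dd b u x)\<^sup>2 - (1 + t x) * (dd b u x)\<^sup>2 / u x"
    unfolding Dp using u0 by (simp add: field_simps power2_eq_square)
  moreover have "2 * u x * dd a r x = - (1 - t x) * dd a (dd a u) x + d x * (dd a u x)\<^sup>2 + (1 - t x) * (dd a u x)\<^sup>2 / u x"
    unfolding Dr using u0 by (simp add: field_simps power2_eq_square)
  moreover have "2 * u x * ((p x)\<^sup>2 + (r x)\<^sup>2) =
      ((1 + t x)\<^sup>2 * (dd b u x)\<^sup>2 + (1 - t x)\<^sup>2 * (dd a u x)\<^sup>2) / (2 * u x)"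
    unfolding p_val r_val using u0 by (simp add: field_simps power2_eq_square)
  moreover have "2 * u x * dd b p x - 2 * u x * dd a r x =
      2 * u x * (1 + (H x)\<^sup>2 - (u x)\<^sup>2) + 2 * u x * ((p x)\<^sup>2 + (r x)\<^sup>2)"
    unfolding right_diff_distrib[symmetric] gauss h12z h_eq by (simp add: power2_eq_square algebra_simps)
  ultimately show ?thesis
    by (simp add: add_divide_distrib diff_divide_distrib algebra_simps)
qed

text \<open>The graph of \<psi> lies above its tangent at \<open>u x\<close>. The inequality reduces
  to Cauchy-Schwarz for the vectors \<open>(sqrt wa, 2 * sqrt wb * u x)\<close> and
  \<open>(sqrt wa, 2 * sqrt wb * u y)\<close>, whose lengths are \<open>S x\<close> and
  \<open>S y\<close>.\<close>

lemma psi_convex: "H y - u y * t x \<ge> H x - u x * t x"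
proof -
  have "(wa + 4 * wb * u x * u y)\<^sup>2 \<le> (S x * S y)\<^sup>2"
  proof -
    have "(S x * S y)\<^sup>2 - (wa + 4 * wb * u x * u y)\<^sup>2 = wa * (4 * wb) * (u x - u y)\<^sup>2"
      unfolding power_mult_distrib[of "S x"] S_sq by (simp add: power2_eq_square algebra_simps)
    also have "\<dots> \<ge> 0" using w by simp
    finally show ?thesis by simp
  qed
  moreover have "0 \<le> S x * S y" using S_pos[of x] S_pos[of y] by simp
  ultimately have "wa + 4 * wb * u x * u y \<le> S x * S y" by (rule power2_le_imp_le)
  moreover have "4 * wb * u x * u x = S x * S x - wa" using S_sq[of x] by (simp add: power2_eq_square)
  moreover have "(S y - S x) * S x - 4 * wb * u x * (u y - u x) =
      S x * S y - S x * S x - 4 * wb * u x * u y + 4 * wb * u x * u x"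
    by (simp add: algebra_simps)
  ultimately have "0 \<le> (S y - S x) * S x - 4 * wb * u x * (u y - u x)"
    by linarith
  then have "0 \<le> ((S y - S x) * S x - 4 * wb * u x * (u y - u x)) / (2 * S x)"
    using S_pos[of x] by (intro divide_nonneg_pos) auto
  also have "\<dots> = H y - H x - t x * (u y - u x)"
    using S_pos[of x] by (simp add: H_val t_def field_simps)
  finally show ?thesis by (simp add: algebra_simps)
qed

text \<open>For \<open>k = 1\<close> this is the larger principal curvature; for
  \<open>k > 1\<close> it exceeds both.\<close>

definition "\<Phi> k x = H x + k * u x"

text \<open>\<open>Z k x y \<ge> 0\<close> for all \<open>y\<close> means that the surface stays on one side of the sphere
  \<open>{Y. (N x - \<Phi> k x F x) \<bullet> Y = - \<Phi> k x}\<close>, which touches it at \<open>F x\<close> and has curvature \<open>\<Phi> k x\<close>.\<close>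

definition "Z k x y = \<Phi> k x * (1 - F x \<bullet> F y) + N x \<bullet> F y"

lemma sm\<Phi>: "smooth (\<Phi> k)"
  unfolding \<Phi>_def[abs_def] by (intro smooth_intros smH smu)

lemma d\<Phi>: "dd v (\<Phi> k) x = (t x + k) * dd v u x"
  unfolding \<Phi>_def[abs_def]
  by (simp add: dd_add dd_mult dd_const smooth_mult smooth_const smu smH dH algebra_simps)

lemma dd\<Phi>: 
  assumes "smooth v"
  shows "dd v (dd v (\<Phi> k)) x = (t x + k) * dd v (dd v u) x + d x * (dd v u x)\<^sup>2"
proof -
  have "dd v (\<Phi> k) = (\<lambda>x. (t x + k) * dd v u x)" by (simp add: fun_eq_iff d\<Phi>)
  then show ?thesis
    by (simp add: dd_add dd_mult dd_const smooth_add smooth_const smt smooth_dd smu assms dt power2_eq_square)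
qed

end

context principal_frame begin

lemma principal_structure:
  "dd a N x = h11 x *\<^sub>R E1 x" "dd b N x = h22 x *\<^sub>R E2 x"
  "dd a E1 x = p x *\<^sub>R E2 x - h11 x *\<^sub>R N x - F x" "dd b E1 x = r x *\<^sub>R E2 x"
  "dd a E2 x = - p x *\<^sub>R E1 x" "dd b E2 x = - r x *\<^sub>R E1 x - h22 x *\<^sub>R N x - F x"
  using structure_eqs[of x] by (simp_all add: h12z)

lemma second_derivatives:
  "dd a (dd a F) x = p x *\<^sub>R E2 x - h11 x *\<^sub>R N x - F x"
  "dd b (dd b F) x = - r x *\<^sub>R E1 x - h22 x *\<^sub>R N x - F x"
  "dd a (dd a N) x = ((1 + t x) * dd a u x) *\<^sub>R E1 x + h11 x *\<^sub>R (p x *\<^sub>R E2 x - h11 x *\<^sub>R N x - F x)"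
  "dd b (dd b N) x = ((t x - 1) * dd b u x) *\<^sub>R E2 x + h22 x *\<^sub>R (- r x *\<^sub>R E1 x - h22 x *\<^sub>R N x - F x)"
proof -
  have N: "dd a N = (\<lambda>x. h11 x *\<^sub>R E1 x)" "dd b N = (\<lambda>x. h22 x *\<^sub>R E2 x)"
    by (simp_all add: fun_eq_iff principal_structure)
  show "dd a (dd a F) x = p x *\<^sub>R E2 x - h11 x *\<^sub>R N x - F x"
    "dd b (dd b F) x = - r x *\<^sub>R E1 x - h22 x *\<^sub>R N x - F x"
    unfolding daF dbF by (simp_all add: principal_structure)
  show "dd a (dd a N) x = ((1 + t x) * dd a u x) *\<^sub>R E1 x + h11 x *\<^sub>R (p x *\<^sub>R E2 x - h11 x *\<^sub>R N x - F x)"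
    "dd b (dd b N) x = ((t x - 1) * dd b u x) *\<^sub>R E2 x + h22 x *\<^sub>R (- r x *\<^sub>R E1 x - h22 x *\<^sub>R N x - F x)"
    unfolding N by (simp_all add: dd_scaleR sm principal_structure dh)
qed

text \<open>The left-hand vector is the unit normal of the touching sphere at \<open>F y0\<close>:
  it is orthogonal to the tangent plane there by the first variation in \<open>y\<close>, and to
  \<open>F y0\<close> because \<open>Z\<close> vanishes. So it is one of the two unit normals of the
  surface.\<close>

lemma touching_normal:
  assumes min: "\<And>x y. Z k x y \<ge> 0" and zero: "Z k x0 y0 = 0"
  shows "N x0 - \<Phi> k x0 *\<^sub>R F x0 + \<Phi> k x0 *\<^sub>R F y0 = N y0 \<or>
    N x0 - \<Phi> k x0 *\<^sub>R F x0 + \<Phi> k x0 *\<^sub>R F y0 = - N y0"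
proof -
  define V where "V = N x0 - \<Phi> k x0 *\<^sub>R F x0 + \<Phi> k x0 *\<^sub>R F y0"
  have "\<Phi> k x0 * (1 - F x0 \<bullet> F y0) + N x0 \<bullet> F y0 \<le> \<Phi> k x * (1 - F x \<bullet> F y) + N x \<bullet> F y" for x y
    using min[of x y] zero unfolding Z_def by linarith
  note var = two_point_variation(2)[OF smF smN sm\<Phi>[of k] sma _ this]
  have "V \<bullet> E1 y0 = 0" "V \<bullet> E2 y0 = 0"
    using var[OF sma] var[OF smb] by (simp_all add: V_def inner_diff_left inner_add_left orth daF dbF)
  moreover have VF: "V \<bullet> F y0 = 0"
    using zero by (simp add: V_def Z_def inner_diff_left inner_add_left orth algebra_simps)
  ultimately have V: "V = (V \<bullet> N y0) *\<^sub>R N y0"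
    by (intro trans[OF expand[of V y0]]) simp
  have "V \<bullet> V = 1"
  proof -
    have "V \<bullet> V = V \<bullet> (N x0 - \<Phi> k x0 *\<^sub>R F x0)"
      using VF by (subst (2) V_def) (simp add: inner_add_right)
    also have "\<dots> = 1 + \<Phi> k x0 * (\<Phi> k x0 * (1 - F x0 \<bullet> F y0) + N x0 \<bullet> F y0)"
      by (simp add: V_def inner_diff_left inner_diff_right inner_add_left inner_add_right orth
          inner_commute[of "F y0"] algebra_simps)
    also have "\<dots> = 1" using zero by (simp add: Z_def)
    finally show ?thesis .
  qed
  moreover have "V \<bullet> V = (V \<bullet> N y0) * (V \<bullet> N y0)"
    by (rule trans[OF arg_cong[OF V, of "\<lambda>v. V \<bullet> v"]]) simp
  ultimately have "(V \<bullet> N y0)\<^sup>2 = 1" by (simp add: power2_eq_square)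
  then have "V \<bullet> N y0 = 1 \<or> V \<bullet> N y0 = - 1" by (simp only: power2_eq_1_iff)
  then have "V = N y0 \<or> V = - N y0"
  proof
    assume "V \<bullet> N y0 = 1"
    then have "(V \<bullet> N y0) *\<^sub>R N y0 = N y0" by simp
    with V show ?thesis by (rule disjI1[OF trans])
  next
    assume "V \<bullet> N y0 = - 1"
    then have "(V \<bullet> N y0) *\<^sub>R N y0 = - N y0" by simp
    with V show ?thesis by (rule disjI2[OF trans])
  qed
  then show ?thesis unfolding V_def .
qed

text \<open>The reflection of \<open>E1 x0, E2 x0\<close> in the hyperplane between \<open>F x0\<close> and \<open>F y0\<close> is a basis of the
  tangent plane at \<open>F y0\<close>, along which the second variation is taken.\<close>

lemma no_touching:
  assumes k: "k > 1" and min: "\<And>x y. Z k x y \<ge> 0" and zero: "Z k x0 y0 = 0" and ne: "F x0 \<noteq> F y0"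
  shows "N x0 - \<Phi> k x0 *\<^sub>R F x0 + \<Phi> k x0 *\<^sub>R F y0 \<noteq> N y0"
proof
  assume Ny: "N x0 - \<Phi> k x0 *\<^sub>R F x0 + \<Phi> k x0 *\<^sub>R F y0 = N y0"
  have P: "\<Phi> k x0 = H x0 + k * u x0" by (simp add: \<Phi>_def)
  define R where "R = 1 - F x0 \<bullet> F y0"
  have FG: "F x0 \<bullet> F y0 = 1 - R" by (simp add: R_def)
  have NG: "N x0 \<bullet> F y0 = - (\<Phi> k x0 * R)" using zero by (simp add: Z_def R_def)
  have R: "R > 0"
  proof -
    have "(F x0 - F y0) \<bullet> (F x0 - F y0) = 2 * R"
      by (simp add: inner_diff_left inner_diff_right orth R_def inner_commute[of "F y0"])
    moreover have "(F x0 - F y0) \<bullet> (F x0 - F y0) > 0" using ne by simp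
    ultimately show ?thesis by simp
  qed
  have min': "\<Phi> k x0 * (1 - F x0 \<bullet> F y0) + N x0 \<bullet> F y0 \<le> \<Phi> k x * (1 - F x \<bullet> F y) + N x \<bullet> F y" for x y
    using min[of x y] zero unfolding Z_def by linarith
  note var = two_point_variation[OF smF smN sm\<Phi>[of k] _ _ min']
  define g1 g2 where "g1 = E1 x0 \<bullet> F y0" and "g2 = E2 x0 \<bullet> F y0"
  define q1 q2 where "q1 = dd a u x0 / (u x0 * (k - 1))" and "q2 = dd b u x0 / (u x0 * (k + 1))"
  have u0: "u x0 > 0" by (rule u_pos)
  have uq: "dd a u x0 = u x0 * (k - 1) * q1" "dd b u x0 = u x0 * (k + 1) * q2"
    using u0 k by (simp_all add: q1_def q2_def)
  have "dd a (\<Phi> k) x0 * R - \<Phi> k x0 * g1 + h11 x0 * g1 = 0"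
    using var(1)[OF sma smb] unfolding principal_structure structure_eqs(1,2) inner_scaleR_left R_def[symmetric] g1_def[symmetric] .
  then have "(t x0 + k) * dd a u x0 * R - (k - 1) * u x0 * g1 = 0"
    unfolding d\<Phi> P h_eq by (simp add: algebra_simps)
  then have "(u x0 * (k - 1)) * (R * (t x0 + k) * q1) = (u x0 * (k - 1)) * g1"
    unfolding uq by (simp add: algebra_simps)
  then have g1: "g1 = R * (t x0 + k) * q1" using u0 k by simp
  have "dd b (\<Phi> k) x0 * R - \<Phi> k x0 * g2 + h22 x0 * g2 = 0"
    using var(1)[OF smb smb] unfolding principal_structure structure_eqs(1,2) inner_scaleR_left R_def[symmetric] g2_def[symmetric] .
  then have "(t x0 + k) * dd b u x0 * R - (k + 1) * u x0 * g2 = 0"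
    unfolding d\<Phi> P h_eq by (simp add: algebra_simps)
  then have "(u x0 * (k + 1)) * (R * (t x0 + k) * q2) = (u x0 * (k + 1)) * g2"
    unfolding uq by (simp add: algebra_simps)
  then have g2: "g2 = R * (t x0 + k) * q2" using u0 k by simp
  \<comment> \<open>The vector \<open>F x0 - F y0\<close> has squared length \<open>2 * R\<close>
    and inner products \<open>- g1\<close> and \<open>- g2\<close> with \<open>E1 x0\<close> and
    \<open>E2 x0\<close>, which gives these coefficients of the reflection.\<close>
  define w1 w2 where "w1 = E1 x0 + (g1 / R) *\<^sub>R (F x0 - F y0)" and "w2 = E2 x0 + (g2 / R) *\<^sub>R (F x0 - F y0)"
  have R0: "R \<noteq> 0" using R by simp
  note ev = inner_add_left inner_add_right inner_diff_left inner_diff_right orth FG NG g1_def[symmetric] g2_def[symmetric]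
    inner_commute[of "F y0" "F x0"] inner_commute[of "F y0" "E1 x0"] inner_commute[of "F y0" "E2 x0"] inner_commute[of "F y0" "N x0"]
  have wG: "w1 \<bullet> F y0 = 0" "w2 \<bullet> F y0 = 0"
    using R0 by (simp_all add: w1_def w2_def ev)
  have wN: "w1 \<bullet> N y0 = 0" "w2 \<bullet> N y0 = 0"
    unfolding Ny[symmetric] using R0 by (simp_all add: w1_def w2_def ev field_simps)
  have ww: "w1 \<bullet> w1 = 1" "w2 \<bullet> w2 = 1" "w1 \<bullet> w2 = 0"
    using R0 by (simp_all add: w1_def w2_def ev field_simps)
  have wF: "F x0 \<bullet> w1 = g1" "F x0 \<bullet> w2 = g2"
    using R0 by (simp_all add: w1_def w2_def ev)
  have wE: "E1 x0 \<bullet> w1 = 1 - g1 * g1 / R" "E2 x0 \<bullet> w2 = 1 - g2 * g2 / R"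
    using R0 by (simp_all add: w1_def w2_def ev)
  define c1 s1 c2 s2 where "c1 = w1 \<bullet> E1 y0" and "s1 = w1 \<bullet> E2 y0" and "c2 = w2 \<bullet> E1 y0" and "s2 = w2 \<bullet> E2 y0"
  have w1: "w1 = c1 *\<^sub>R E1 y0 + s1 *\<^sub>R E2 y0" and w2: "w2 = c2 *\<^sub>R E1 y0 + s2 *\<^sub>R E2 y0"
    by (rule trans[OF expand[of _ y0]], simp add: wG wN c1_def s1_def c2_def s2_def)+
  have cs: "c1 * c1 + s1 * s1 = 1" "c2 * c2 + s2 * s2 = 1" "c1 * c2 + s1 * s2 = 0"
    using ww unfolding w1 w2 by (simp_all add: inner_add_left inner_add_right orth mult.commute)
  \<comment> \<open>The data at \<open>x0\<close> act on accelerations at \<open>y0\<close> exactly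
    as \<open>N y0\<close> and \<open>F y0\<close> do, so the second variation in \<open>y\<close>
    sees only the second fundamental form at \<open>y0\<close> and the radial part.\<close>
  have nn: "N x0 \<bullet> v - \<Phi> k x0 * (F x0 \<bullet> v) = N y0 \<bullet> v - \<Phi> k x0 * (F y0 \<bullet> v)" for v
    unfolding Ny[symmetric] by (simp add: inner_add_left inner_diff_left)
  have dE: "N x0 \<bullet> dd e (dd e F) y0 - \<Phi> k x0 * (F x0 \<bullet> dd e (dd e F) y0) = \<Phi> k x0 - (c * c * h11 y0 + s * s * h22 y0)"
    "dd e F y0 = c *\<^sub>R E1 y0 + s *\<^sub>R E2 y0" "smooth e"
    if e: "e = (\<lambda>y. c *\<^sub>R a y + s *\<^sub>R b y)" and cs1: "c * c + s * s = 1" for c s e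
  proof -
    show sme: "smooth e" unfolding e by (intro smooth_add smooth_scaleR smooth_const sm)
    have de: "dd e f = (\<lambda>y. c *\<^sub>R dd a f y + s *\<^sub>R dd b f y)" if "smooth f" for f :: "real^2 \<Rightarrow> real^4"
      unfolding e using dd_field_add[OF that] dd_field_scaleR[OF that] by (simp add: fun_eq_iff)
    show "dd e F y0 = c *\<^sub>R E1 y0 + s *\<^sub>R E2 y0" by (simp add: de[OF smF] structure_eqs)
    have "dd e (dd e F) y0 = c *\<^sub>R dd e E1 y0 + s *\<^sub>R dd e E2 y0"
      unfolding de[OF smF] daF dbF by (simp add: dd_add dd_scaleR dd_const smooth_scaleR smooth_const sm)
    also have "\<dots> = c *\<^sub>R (c *\<^sub>R dd a E1 y0 + s *\<^sub>R dd b E1 y0) + s *\<^sub>R (c *\<^sub>R dd a E2 y0 + s *\<^sub>R dd b E2 y0)"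
      by (simp add: de sm)
    finally have "dd e (dd e F) y0 = \<dots>" .
    then have "N y0 \<bullet> dd e (dd e F) y0 = - (c * c * h11 y0 + s * s * h22 y0)" "F y0 \<bullet> dd e (dd e F) y0 = - (c * c + s * s)"
      by (simp_all add: principal_structure inner_add_right inner_diff_right orth)
    then show "N x0 \<bullet> dd e (dd e F) y0 - \<Phi> k x0 * (F x0 \<bullet> dd e (dd e F) y0) = \<Phi> k x0 - (c * c * h11 y0 + s * s * h22 y0)"
      unfolding nn cs1 by simp
  qed
  define hy1 hy2 where "hy1 = c1 * c1 * h11 y0 + s1 * s1 * h22 y0" and "hy2 = c2 * c2 * h11 y0 + s2 * s2 * h22 y0"
  define e1 e2 where "e1 = (\<lambda>y. c1 *\<^sub>R a y + s1 *\<^sub>R b y)" and "e2 = (\<lambda>y. c2 *\<^sub>R a y + s2 *\<^sub>R b y)"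
  note dE1 = dE[OF e1_def cs(1), folded w1 hy1_def] and dE2 = dE[OF e2_def cs(2), folded w2 hy2_def]
  have "0 \<le> R * ((t x0 + k) * dd a (dd a u) x0 + d x0 * (dd a u x0)\<^sup>2) - 4 * ((t x0 + k) * dd a u x0) * g1
      + (h11 x0 - \<Phi> k x0) * (p x0 * g2 + h11 x0 * (\<Phi> k x0 * R) - (1 - R)) + (1 + t x0) * dd a u x0 * g1
      + 2 * ((h11 x0 - \<Phi> k x0) * (1 - g1 * g1 / R)) + (\<Phi> k x0 - hy1)"
  proof -
    let ?X = "p x0 * g2 + h11 x0 * (\<Phi> k x0 * R) - (1 - R)"
    have 1: "dd a (dd a F) x0 \<bullet> F y0 = ?X"
      unfolding second_derivatives by (simp add: inner_add_left inner_diff_left NG FG g1_def g2_def)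
    have 2: "dd a (dd a N) x0 \<bullet> F y0 = (1 + t x0) * dd a u x0 * g1 + h11 x0 * ?X"
      unfolding second_derivatives inner_add_left inner_scaleR_left 1[unfolded second_derivatives] g1_def g2_def by simp
    have 3: "dd a F x0 \<bullet> F y0 = g1" "dd a N x0 \<bullet> dd e1 F y0 = h11 x0 * (1 - g1 * g1 / R)"
      "dd a F x0 \<bullet> dd e1 F y0 = 1 - g1 * g1 / R" "F x0 \<bullet> dd e1 F y0 = g1"
      by (simp_all only: principal_structure(1) structure_eqs(1) dE1(2) inner_scaleR_left wE(1) wF(1) g1_def[symmetric])
    show ?thesis
      using var(3)[OF sma dE1(3)] dE1(1)
      unfolding 1 2 3 dd\<Phi>[OF sma] d\<Phi> R_def[symmetric]
      by (simp add: algebra_simps)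
  qed
  also have "(h11 x0 - \<Phi> k x0) * (1 - g1 * g1 / R) = (h11 x0 - \<Phi> k x0) + (t x0 + k) * dd a u x0 * g1"
    unfolding uq g1 P h_eq using R0 by (simp add: field_simps)
  finally have I1: "0 \<le> R * ((t x0 + k) * dd a (dd a u) x0 + d x0 * (dd a u x0)\<^sup>2) - 4 * ((t x0 + k) * dd a u x0) * g1
      + (h11 x0 - \<Phi> k x0) * (p x0 * g2 + h11 x0 * (\<Phi> k x0 * R) - (1 - R)) + (1 + t x0) * dd a u x0 * g1
      + 2 * ((h11 x0 - \<Phi> k x0) + (t x0 + k) * dd a u x0 * g1) + (\<Phi> k x0 - hy1)" .
  have "0 \<le> R * ((t x0 + k) * dd b (dd b u) x0 + d x0 * (dd b u x0)\<^sup>2) - 4 * ((t x0 + k) * dd b u x0) * g2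
      + (h22 x0 - \<Phi> k x0) * (- (r x0 * g1) + h22 x0 * (\<Phi> k x0 * R) - (1 - R)) + (t x0 - 1) * dd b u x0 * g2
      + 2 * ((h22 x0 - \<Phi> k x0) * (1 - g2 * g2 / R)) + (\<Phi> k x0 - hy2)"
  proof -
    let ?X = "- (r x0 * g1) + h22 x0 * (\<Phi> k x0 * R) - (1 - R)"
    have 1: "dd b (dd b F) x0 \<bullet> F y0 = ?X"
      unfolding second_derivatives by (simp add: inner_add_left inner_diff_left NG FG g1_def g2_def)
    have 2: "dd b (dd b N) x0 \<bullet> F y0 = (t x0 - 1) * dd b u x0 * g2 + h22 x0 * ?X"
      unfolding second_derivatives inner_add_left inner_scaleR_left 1[unfolded second_derivatives] g1_def g2_def by simp
    have 3: "dd b F x0 \<bullet> F y0 = g2" "dd b N x0 \<bullet> dd e2 F y0 = h22 x0 * (1 - g2 * g2 / R)"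
      "dd b F x0 \<bullet> dd e2 F y0 = 1 - g2 * g2 / R" "F x0 \<bullet> dd e2 F y0 = g2"
      by (simp_all only: principal_structure(2) structure_eqs(2) dE2(2) inner_scaleR_left wE(2) wF(2) g2_def[symmetric])
    show ?thesis
      using var(3)[OF smb dE2(3)] dE2(1)
      unfolding 1 2 3 dd\<Phi>[OF smb] d\<Phi> R_def[symmetric]
      by (simp add: algebra_simps)
  qed
  also have "(h22 x0 - \<Phi> k x0) * (1 - g2 * g2 / R) = (h22 x0 - \<Phi> k x0) + (t x0 + k) * dd b u x0 * g2"
    unfolding uq g2 P h_eq using R0 by (simp add: field_simps)
  finally have I2: "0 \<le> R * ((t x0 + k) * dd b (dd b u) x0 + d x0 * (dd b u x0)\<^sup>2) - 4 * ((t x0 + k) * dd b u x0) * g2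
      + (h22 x0 - \<Phi> k x0) * (- (r x0 * g1) + h22 x0 * (\<Phi> k x0 * R) - (1 - R)) + (t x0 - 1) * dd b u x0 * g2
      + 2 * ((h22 x0 - \<Phi> k x0) + (t x0 + k) * dd b u x0 * g2) + (\<Phi> k x0 - hy2)" .
  have c2s1: "c2 * c2 = s1 * s1"
  proof -
    have e: "c1 * c2 = - (s1 * s2)" using cs(3) by simp
    have "c2 * c2 = (c2 * c2) * (c1 * c1 + s1 * s1)" by (simp add: cs(1))
    also have "\<dots> = (c1 * c2) * (c1 * c2) + s1 * s1 * (c2 * c2)" by (simp add: algebra_simps)
    also have "\<dots> = s1 * s1 * (c2 * c2 + s2 * s2)" unfolding e by (simp add: algebra_simps)
    finally show ?thesis by (simp add: cs(2))
  qed
  \<comment> \<open>As \<open>w1\<close>, \<open>w2\<close> is orthonormal, \<open>hy1\<close> and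
    \<open>hy2\<close> are \<open>H y0\<close> plus and minus a number of size at most
    \<open>u y0\<close>. By \<open>0 \<le> t x0\<close> the worst case is \<open>w1\<close> in the
    first principal direction, and there convexity of \<psi> applies.\<close>
  have hy: "(1 - t x0) * hy1 + (1 + t x0) * hy2 \<ge> 2 * (H x0 - u x0 * t x0)"
  proof -
    have s1: "s1 * s1 = 1 - c1 * c1" and s2: "s2 * s2 = c1 * c1" using cs c2s1 by simp_all
    have hyv: "hy1 = H y0 + (2 * (c1 * c1) - 1) * u y0" "hy2 = H y0 - (2 * (c1 * c1) - 1) * u y0"
      unfolding hy1_def hy2_def c2s1 s1 s2 h_eq by (simp_all add: algebra_simps)
    have "(1 - t x0) * hy1 + (1 + t x0) * hy2 = 2 * (H y0 - (2 * (c1 * c1) - 1) * (t x0 * u y0))"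
      unfolding hyv by (simp add: algebra_simps)
    also have "\<dots> \<ge> 2 * (H y0 - 1 * (t x0 * u y0))"
    proof -
      have "c1 * c1 \<le> 1" using cs(1) by (metis le_add_same_cancel1 zero_le_square)
      then have "(2 * (c1 * c1) - 1) * (t x0 * u y0) \<le> 1 * (t x0 * u y0)"
        using t_bounds(1)[of x0] u_pos[of y0] by (intro mult_right_mono) auto
      then show ?thesis by simp
    qed
    finally show ?thesis using psi_convex[of x0 y0] by (simp add: mult.commute)
  qed
  show False
  proof (rule touching_algebra[where R = R and u = "u x0" and k = k and t = "t x0" and d = "d x0" and H = "H x0"
        and ?q1.0 = q1 and ?q2.0 = q2 and ?u11.0 = "dd a (dd a u) x0" and ?u22.0 = "dd b (dd b u) x0"
        and ?hy1.0 = hy1 and ?hy2.0 = hy2 and p = "p x0" and r = "r x0", OF R u0 k t_bounds(1-5)[of x0] _ _ _ hy])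
    show "p x0 = (1 + t x0) * (k + 1) * q2 / 2" "r x0 = - ((1 - t x0) * (k - 1) * q1 / 2)"
      unfolding p_val r_val uq using u0 by (simp_all add: field_simps)
    show "(1 + t x0) * dd b (dd b u) x0 + (1 - t x0) * dd a (dd a u) x0 = 2 * u x0 * (1 + (H x0)\<^sup>2 - (u x0)\<^sup>2)
      + ((1 + t x0)\<^sup>2 * u x0 * (k + 1)\<^sup>2 * q2\<^sup>2 + (1 - t x0)\<^sup>2 * u x0 * (k - 1)\<^sup>2 * q1\<^sup>2) / 2
      + ((1 + t x0) * u x0 * (k + 1)\<^sup>2 * q2\<^sup>2 + (1 - t x0) * u x0 * (k - 1)\<^sup>2 * q1\<^sup>2)
      - d x0 * (u x0)\<^sup>2 * ((k + 1)\<^sup>2 * q2\<^sup>2 - (k - 1)\<^sup>2 * q1\<^sup>2)"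
    proof -
      have 1: "((1 + t x0)\<^sup>2 * (dd b u x0)\<^sup>2 + (1 - t x0)\<^sup>2 * (dd a u x0)\<^sup>2) / (2 * u x0) =
        ((1 + t x0)\<^sup>2 * u x0 * (k + 1)\<^sup>2 * q2\<^sup>2 + (1 - t x0)\<^sup>2 * u x0 * (k - 1)\<^sup>2 * q1\<^sup>2) / 2"
        unfolding uq power_mult_distrib using u0 by (simp add: power2_eq_square field_simps)
      have 2: "((1 + t x0) * (dd b u x0)\<^sup>2 + (1 - t x0) * (dd a u x0)\<^sup>2) / u x0 =
        (1 + t x0) * u x0 * (k + 1)\<^sup>2 * q2\<^sup>2 + (1 - t x0) * u x0 * (k - 1)\<^sup>2 * q1\<^sup>2"
        unfolding uq power_mult_distrib using u0 by (simp add: power2_eq_square field_simps)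
      have 3: "d x0 * ((dd b u x0)\<^sup>2 - (dd a u x0)\<^sup>2) = d x0 * (u x0)\<^sup>2 * ((k + 1)\<^sup>2 * q2\<^sup>2 - (k - 1)\<^sup>2 * q1\<^sup>2)"
        unfolding uq power_mult_distrib by (simp add: algebra_simps)
      show ?thesis using simons[of x0] unfolding 1 2 3 .
    qed
    show "0 \<le> R * (((t x0 + k) * dd a (dd a u) x0 + d x0 * (u x0 * (k - 1) * q1)\<^sup>2) - (k - 1) * u x0 * ((H x0 + u x0) * (H x0 + k * u x0) + 1))
      - 2 * ((t x0 + k) * (u x0 * (k - 1) * q1)) * (R * (t x0 + k) * q1) - (k - 1) * u x0 * p x0 * (R * (t x0 + k) * q2)
      + (1 + t x0) * (u x0 * (k - 1) * q1) * (R * (t x0 + k) * q1) + (H x0 + u x0) - hy1"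
      using I1 unfolding uq(1) g1[symmetric] g2[symmetric] P h_eq
      by (rule order_trans[OF _ eq_refl]) (simp add: algebra_simps)
    show "0 \<le> R * (((t x0 + k) * dd b (dd b u) x0 + d x0 * (u x0 * (k + 1) * q2)\<^sup>2) - (k + 1) * u x0 * ((H x0 - u x0) * (H x0 + k * u x0) + 1))
      - 2 * ((t x0 + k) * (u x0 * (k + 1) * q2)) * (R * (t x0 + k) * q2) + (k + 1) * u x0 * r x0 * (R * (t x0 + k) * q1)
      + (t x0 - 1) * (u x0 * (k + 1) * q2) * (R * (t x0 + k) * q2) + (H x0 - u x0) - hy2"
      using I2 unfolding uq(2) g1[symmetric] g2[symmetric] P h_eq
      by (rule order_trans[OF _ eq_refl]) (simp add: algebra_simps)
  qed
qed

end

section \<open>Touching spheres of embedded tori\<close>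

definition hess :: "(real^2 \<Rightarrow> 'b::real_normed_vector) \<Rightarrow> real^2 \<Rightarrow> real^2 \<Rightarrow> 'b" where
  "hess F x v = frechet_derivative (\<lambda>y. frechet_derivative F (at y) v) (at x) v"

lemma frechet_plane:
  assumes "smooth f"
  shows "frechet_derivative f (at x) v = (v $ 1) *\<^sub>R pder 1 f x + (v $ 2) *\<^sub>R pder 2 f x"
proof -
  have l: "linear (frechet_derivative f (at x))"
    using smooth_frechet[OF assms] has_derivative_linear by blast
  have "frechet_derivative f (at x) v = frechet_derivative f (at x) ((v $ 1) *\<^sub>R axis 1 1 + (v $ 2) *\<^sub>R axis 2 1)"
    using pt_eta[of v] by (simp add: pt_def)
  then show ?thesis by (simp add: linear_add[OF l] linear_cmul[OF l] dd_def)
qed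

lemma hess_coords:
  assumes "smooth f"
  shows "hess f x v = (v $ 1)\<^sup>2 *\<^sub>R pder 1 (pder 1 f) x + ((v $ 1) * (v $ 2)) *\<^sub>R (pder 1 (pder 2 f) x + pder 2 (pder 1 f) x)
    + (v $ 2)\<^sup>2 *\<^sub>R pder 2 (pder 2 f) x"
proof -
  have s: "smooth (pder i f)" for i by (rule smooth_pder[OF assms])
  have "(\<lambda>y. frechet_derivative f (at y) v) = (\<lambda>y. (v $ 1) *\<^sub>R pder 1 f y + (v $ 2) *\<^sub>R pder 2 f y)"
    using frechet_plane[OF assms] by blast
  moreover have "frechet_derivative (\<lambda>y. (v $ 1) *\<^sub>R pder 1 f y + (v $ 2) *\<^sub>R pder 2 f y) (at x) v =
      dd (\<lambda>_. v) (\<lambda>y. (v $ 1) *\<^sub>R pder 1 f y + (v $ 2) *\<^sub>R pder 2 f y) x" by (simp add: dd_def)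
  ultimately have "hess f x v = (v $ 1) *\<^sub>R dd (\<lambda>_. v) (pder 1 f) x + (v $ 2) *\<^sub>R dd (\<lambda>_. v) (pder 2 f) x"
    unfolding hess_def by (simp add: dd_add dd_scaleR dd_const smooth_scaleR smooth_const s)
  moreover have "dd (\<lambda>_. v) (pder i f) x = (v $ 1) *\<^sub>R pder 1 (pder i f) x + (v $ 2) *\<^sub>R pder 2 (pder i f) x" for i
    using frechet_plane[OF s[of i], of x v] by (simp only: dd_def[of "\<lambda>_. v"])
  ultimately show ?thesis by (simp add: algebra_simps power2_eq_square)
qed

lemma hess_scaleR: "smooth f \<Longrightarrow> hess f x (c *\<^sub>R v) = c\<^sup>2 *\<^sub>R hess f x v"
  by (simp add: hess_coords power_mult_distrib algebra_simps power2_eq_square)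

lemma line_convex_nonneg:
  fixes g g' g'' :: "real \<Rightarrow> real"
  assumes "\<And>s. (g has_real_derivative g' s) (at s)" "\<And>s. (g' has_real_derivative g'' s) (at s)"
    and "g 0 = 0" "g' 0 = 0" "\<And>s. 0 < s \<Longrightarrow> s < 1 \<Longrightarrow> g'' s > 0"
  shows "g 1 \<ge> 0"
proof -
  have "\<exists>z>0. z < 1 \<and> g 1 - g 0 = (1 - 0) * g' z" by (rule MVT2) (use assms(1) in auto)
  then obtain z where z: "0 < z" "z < 1" "g 1 = g' z" using assms(3) by auto
  have "\<exists>y>0. y < z \<and> g' z - g' 0 = (z - 0) * g'' y" by (rule MVT2) (use assms(2) z in auto)
  then obtain y where y: "0 < y" "y < z" "g' z = z * g'' y" using assms(4) by auto
  then show ?thesis using z assms(5)[of y] by simp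
qed

text \<open>Periodicity is asked only of quantities that do not depend on the choice of the
  principal frame; \<open>E1\<close> and \<open>E2\<close> may change sign along a period.\<close>

locale weingarten_principal = principal_frame +
  assumes perF: "doubly_periodic F" and perN: "doubly_periodic N"
    and perH: "doubly_periodic H" and peru: "doubly_periodic u"
    and embedded: "F x = F y \<Longrightarrow> \<exists>m\<in>\<int>. \<exists>n\<in>\<int>. y = x + pt (2 * pi * m) (2 * pi * n)"
begin

lemma per\<Phi>: "doubly_periodic (\<Phi> k)"
  unfolding \<Phi>_def[abs_def] using perH peru by (simp add: doubly_periodic_def)

lemma same_normal: "F x = F y \<Longrightarrow> N x = N y"
  using embedded[of x y] doubly_periodicD[OF perN] by metis

lemma dist_F: "(F x - F y) \<bullet> (F x - F y) = 2 * (1 - F x \<bullet> F y)"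
  by (simp add: inner_diff_left inner_diff_right orth inner_commute[of "F y"])

lemma one_minus_nonneg: "1 - F x \<bullet> F y \<ge> 0"
proof -
  have "0 \<le> 2 * (1 - F x \<bullet> F y)" unfolding dist_F[symmetric] by simp
  then show ?thesis by simp
qed

lemma one_minus_pos: "F x \<noteq> F y \<Longrightarrow> 1 - F x \<bullet> F y > 0"
proof -
  assume "F x \<noteq> F y"
  then have "0 < 2 * (1 - F x \<bullet> F y)" unfolding dist_F[symmetric] by simp
  then show ?thesis by simp
qed

text \<open>A pair of points of the torus is written as \<open>x\<close> and \<open>x + w\<close>
  with \<open>x\<close> in \<open>fund\<close> and \<open>w\<close> in \<open>cent\<close>. The only
  period in \<open>cent\<close> is 0, so the diagonal is \<open>w = 0\<close> and the rest is
  exhausted by compact sets.\<close>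

abbreviation "fund \<equiv> cbox 0 (pt (2 * pi) (2 * pi))"
abbreviation "cent \<equiv> cbox (pt (- pi) (- pi)) (pt pi pi)"

lemma pair_representative:
  obtains x' w where "x' \<in> fund" "w \<in> cent"
    "\<And>f::real^2 \<Rightarrow> real. doubly_periodic f \<Longrightarrow> f x' = f x" "F x' = F x" "N x' = N x" "F (x' + w) = F y" "N (x' + w) = N y"
proof -
  obtain m n where mn: "m \<in> \<int>" "n \<in> \<int>" "x + pt (2 * pi * m) (2 * pi * n) \<in> fund" by (rule doubly_periodic_box)
  define x' where "x' = x + pt (2 * pi * m) (2 * pi * n)"
  obtain m' n' where mn': "m' \<in> \<int>" "n' \<in> \<int>" "(y - x' + pt pi pi) + pt (2 * pi * m') (2 * pi * n') \<in> fund" by (rule doubly_periodic_box)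
  define w where "w = (y - x') + pt (2 * pi * m') (2 * pi * n')"
  have "w \<in> cent" using mn'(3) by (simp add: w_def mem_box_cart forall_2)
  moreover have "x' + w = y + pt (2 * pi * m') (2 * pi * n')" by (simp add: w_def)
  ultimately show ?thesis
    using that[of x' w] mn mn' doubly_periodicD perF perN unfolding x'_def[symmetric] by (simp add: x'_def doubly_periodic_def)
qed

lemma offdiagonal:
  assumes "\<delta> > 0"
  defines "C \<equiv> {(x, w). x \<in> fund \<and> w \<in> cent \<and> norm w \<ge> \<delta>}"
  shows "compact C" "\<And>x w. (x, w) \<in> C \<Longrightarrow> F x \<noteq> F (x + w)"
proof -
  have "C = (fund \<times> cent) \<inter> {z. \<delta> \<le> norm (snd z)}" by (auto simp: C_def)
  moreover have "closed {z :: (real^2) \<times> (real^2). \<delta> \<le> norm (snd z)}"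
    by (intro closed_Collect_le continuous_intros)
  ultimately show "compact C" by (simp add: compact_Times compact_Int_closed)
  fix x w assume xw: "(x, w) \<in> C"
  show "F x \<noteq> F (x + w)"
  proof
    assume "F x = F (x + w)"
    from embedded[OF this] obtain m n where mn: "m \<in> \<int>" "n \<in> \<int>" "w = pt (2 * pi * m) (2 * pi * n)" by auto
    have z: "k = 0" if k: "k \<in> \<int>" "- pi \<le> 2 * pi * k" "2 * pi * k \<le> pi" for k :: real
    proof -
      obtain i where i: "k = of_int i" using k(1) by (elim Ints_cases)
      have "2 * pi * k \<le> 2 * pi * (1/2)" "2 * pi * (- (1/2)) \<le> 2 * pi * k" using that by simp_all
      then have "k \<le> 1/2" "- (1/2) \<le> k" using pi_gt_zero by (simp_all only: mult_le_cancel_left_pos mult_pos_pos zero_less_numeral)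
      then have "i = 0" unfolding i by linarith
      then show ?thesis using i by simp
    qed
    have "w \<in> cent" using xw by (simp add: C_def)
    then have "m = 0" "n = 0" using z mn by (auto simp: mem_box_cart forall_2)
    then have "w = 0" using mn by (simp add: pt_def)
    then show False using xw assms by (simp add: C_def)
  qed
qed

text \<open>On the segment from \<open>x\<close> to \<open>x + w\<close> the function vanishes to
  first order at \<open>x\<close>, and its second derivative is positive near the diagonal by
  compactness. General \<Psi> and \<open>n\<close> are kept to cover both \<open>Z\<close> and
  spheres on either side of the surface.\<close>

lemma diagonal:
  assumes cont: "continuous_on UNIV \<Psi>" "doubly_periodic \<Psi>" "continuous_on UNIV n" "doubly_periodic n"
    and nF: "\<And>x. n x \<bullet> F x = 0" and nT: "\<And>x v. n x \<bullet> frechet_derivative F (at x) v = 0"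
    and pos: "\<And>x v. v \<noteq> 0 \<Longrightarrow> (n x - \<Psi> x *\<^sub>R F x) \<bullet> hess F x v > 0"
  obtains \<delta> where "\<delta> > 0" "\<And>x w. x \<in> fund \<Longrightarrow> norm w < \<delta> \<Longrightarrow> \<Psi> x * (1 - F x \<bullet> F (x + w)) + n x \<bullet> F (x + w) \<ge> (0::real)"
proof -
  define V where "V = (\<lambda>x. n x - \<Psi> x *\<^sub>R F x)"
  define q where "q = (\<lambda>z :: ((real^2) \<times> (real^2)) \<times> (real^2). V (fst (fst z)) \<bullet> hess F (fst (fst z) + snd (fst z)) (snd z))"
  have cV: "continuous_on UNIV V" unfolding V_def by (intro continuous_intros cont smooth_continuous_on smF)
  have c2: "continuous_on UNIV (pder i (pder j F))" for i j
    by (intro smooth_continuous_on smooth_pder smF)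
  have cq: "continuous_on S q" for S
    unfolding q_def hess_coords[OF smF]
    by (intro continuous_intros continuous_on_compose2[OF cV] continuous_on_compose2[OF c2]) auto
  define K where "K = (fund \<times> cball (0::real^2) 1) \<times> sphere (0::real^2) (1::real)"
  have K: "compact K" unfolding K_def by (intro compact_Times) auto
  define K0 where "K0 = (fund \<times> {0::real^2}) \<times> sphere (0::real^2) (1::real)"
  have K0: "compact K0" unfolding K0_def by (intro compact_Times) auto
  have "(0, 0) \<in> fund \<times> {0::real^2}" by (simp add: mem_box_cart forall_2)
  moreover have "(axis 1 1 :: real^2) \<in> sphere 0 1" by simp
  ultimately have "K0 \<noteq> {}" unfolding K0_def by blast
  from continuous_attains_inf[OF K0 this cq] obtain z0 where z0: "z0 \<in> K0" "\<And>z. z \<in> K0 \<Longrightarrow> q z0 \<le> q z" by blast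
  have q0: "q z0 > 0"
  proof -
    have "snd z0 \<noteq> 0" "snd (fst z0) = 0" using z0(1) by (auto simp: K0_def)
    then show ?thesis using pos[of "snd z0" "fst (fst z0)"] by (simp add: q_def V_def)
  qed
  have "uniformly_continuous_on K q" by (rule compact_uniformly_continuous[OF cq K])
  then obtain d where d: "d > 0" "\<And>z z'. z \<in> K \<Longrightarrow> z' \<in> K \<Longrightarrow> dist z' z < d \<Longrightarrow> dist (q z') (q z) < q z0"
    unfolding uniformly_continuous_on_def using q0 by metis
  have qpos: "q ((x, w), v) > 0" if "x \<in> fund" "norm w < min d 1" "norm v = 1" for x w v
  proof -
    have "dist ((x, w), v) ((x, 0), v) = norm w" by (simp add: dist_Pair_Pair dist_norm)
    then have "dist (q ((x, w), v)) (q ((x, 0), v)) < q z0"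
      using that by (intro d(2)) (auto simp: K_def)
    moreover have "q z0 \<le> q ((x, 0), v)" using that by (intro z0(2)) (auto simp: K0_def)
    ultimately show ?thesis by (simp add: dist_real_def)
  qed
  show ?thesis
  proof (rule that[of "min d 1"])
    show "min d 1 > 0" using d(1) by simp
    fix x w :: "real^2" assume x: "x \<in> fund" and w: "norm w < min d 1"
    show "0 \<le> \<Psi> x * (1 - F x \<bullet> F (x + w)) + n x \<bullet> F (x + w)"
    proof (cases "w = 0")
      case True
      then show ?thesis by (simp add: nF orth)
    next
      case False
      define g where "g = (\<lambda>s. \<Psi> x * (1 - F x \<bullet> F (x + s *\<^sub>R w)) + n x \<bullet> F (x + s *\<^sub>R w))"
      define g' where "g' = (\<lambda>s. V x \<bullet> frechet_derivative F (at (x + s *\<^sub>R w)) w)"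
      define g'' where "g'' = (\<lambda>s. V x \<bullet> hess F (x + s *\<^sub>R w) w)"
      have "g 1 \<ge> 0"
      proof (rule line_convex_nonneg[of g g' g''])
        fix s
        have "g = (\<lambda>s. \<Psi> x + V x \<bullet> F (x + s *\<^sub>R w))"
          by (simp add: g_def V_def inner_diff_left algebra_simps)
        moreover have "((\<lambda>s. \<Psi> x + V x \<bullet> F (x + s *\<^sub>R w)) has_vector_derivative
            0 + V x \<bullet> frechet_derivative F (at (x + s *\<^sub>R w)) w) (at s)"
          by (intro has_vector_derivative_add has_vector_derivative_const
              bounded_linear.has_vector_derivative[OF bounded_linear_inner_right] smooth_along_line smF)
        ultimately show "(g has_real_derivative g' s) (at s)"
          by (simp add: g'_def has_real_derivative_iff_has_vector_derivative)
        have "((\<lambda>s. V x \<bullet> frechet_derivative F (at (x + s *\<^sub>R w)) w) has_vector_derivative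
            V x \<bullet> hess F (x + s *\<^sub>R w) w) (at s)"
          unfolding hess_def
          by (rule bounded_linear.has_vector_derivative[OF bounded_linear_inner_right
                smooth_along_line[OF smooth_frechet_derivative[OF smF]]])
        then show "(g' has_real_derivative g'' s) (at s)"
          by (simp add: g'_def g''_def has_real_derivative_iff_has_vector_derivative)
        show "g 0 = 0" by (simp add: g_def orth nF)
        show "g' 0 = 0" using tangent(2)[of x w] nT[of x w] by (simp add: g'_def V_def inner_diff_left inner_commute)
      next
        fix s :: real assume s: "0 < s" "s < 1"
        define v where "v = w /\<^sub>R norm w"
        have wv: "w = norm w *\<^sub>R v" and v1: "norm v = 1" using False by (simp_all add: v_def)
        have "norm (s *\<^sub>R w) \<le> 1 * norm w" using s by (simp add: mult_left_le_one_le)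
        then have "q ((x, s *\<^sub>R w), v) > 0" using w by (intro qpos x v1) auto
        moreover have "g'' s = (norm w)\<^sup>2 * q ((x, s *\<^sub>R w), v)"
        proof -
          have "hess F (x + s *\<^sub>R w) w = (norm w)\<^sup>2 *\<^sub>R hess F (x + s *\<^sub>R w) v"
            using hess_scaleR[OF smF, of "x + s *\<^sub>R w" "norm w" v] wv by simp
          then show ?thesis by (simp add: g''_def q_def)
        qed
        ultimately show "g'' s > 0" using False by simp
      qed
      then show ?thesis by (simp add: g_def)
    qed
  qed
qed

lemma normal_tangent: "N x \<bullet> frechet_derivative F (at x) v = 0"
  and radial_tangent: "F x \<bullet> frechet_derivative F (at x) v = 0"
  using tangent[of x v] by (simp_all add: inner_commute)

text \<open>Both follow by differentiating the orthogonality of \<open>N\<close>, respectively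
  \<open>F\<close>, to the derivative of \<open>F\<close> along the fixed vector; the derivative
  that falls on \<open>N\<close> is the second fundamental form.\<close>

lemma hess_normal: "N x \<bullet> hess F x (s *\<^sub>R a x + t' *\<^sub>R b x) = - (s\<^sup>2 * h11 x + t'\<^sup>2 * h22 x)"
  and hess_radial: "F x \<bullet> hess F x (s *\<^sub>R a x + t' *\<^sub>R b x) = - (s\<^sup>2 + t'\<^sup>2)"
proof -
  define v where "v = s *\<^sub>R a x + t' *\<^sub>R b x"
  have smd: "smooth (dd (\<lambda>_. v) F)" by (intro smooth_dd smF smooth_const)
  have dF: "dd (\<lambda>_. v) F x = s *\<^sub>R E1 x + t' *\<^sub>R E2 x"
    using frechet_F[of x s t'] by (simp add: dd_def v_def)
  have lN: "linear (frechet_derivative N (at x))"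
    using smooth_frechet[OF smN] has_derivative_linear by blast
  have dN: "dd (\<lambda>_. v) N x = (s * h11 x) *\<^sub>R E1 x + (t' * h22 x) *\<^sub>R E2 x"
    using principal_structure(1,2)[of x] by (simp add: dd_def v_def linear_add[OF lN] linear_cmul[OF lN])
  have h: "hess F x v = dd (\<lambda>_. v) (dd (\<lambda>_. v) F) x" by (simp add: hess_def dd_def[abs_def])
  have "dd (\<lambda>_. v) N x \<bullet> dd (\<lambda>_. v) F x = - (N x \<bullet> hess F x v)"
    unfolding h by (rule dd_inner_const[OF smN smd, of 0]) (simp add: dd_def normal_tangent)
  then show "N x \<bullet> hess F x (s *\<^sub>R a x + t' *\<^sub>R b x) = - (s\<^sup>2 * h11 x + t'\<^sup>2 * h22 x)"
    unfolding dF dN by (simp add: v_def inner_add_left inner_add_right orth power2_eq_square algebra_simps)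
  have "dd (\<lambda>_. v) F x \<bullet> dd (\<lambda>_. v) F x = - (F x \<bullet> hess F x v)"
    unfolding h by (rule dd_inner_const[OF smF smd, of 0]) (simp add: dd_def radial_tangent)
  then show "F x \<bullet> hess F x (s *\<^sub>R a x + t' *\<^sub>R b x) = - (s\<^sup>2 + t'\<^sup>2)"
    unfolding dF by (simp add: v_def inner_add_left inner_add_right orth power2_eq_square)
qed

text \<open>Spheres of curvature \<kappa> touch from both sides at every point, which will give an
  embedded tubular neighbourhood. Near the diagonal any \<open>M\<close> above the absolute
  principal curvatures works; away from it, embeddedness and compactness bound the quotient.\<close>

lemma two_sided_bound:
  obtains \<kappa> where "\<kappa> > 0" "\<And>x y. \<bar>N x \<bullet> F y\<bar> \<le> \<kappa> * (1 - F x \<bullet> F y)"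
proof -
  obtain M1 where M1: "M1 > 0" "\<And>x. \<bar>H x\<bar> \<le> M1" using doubly_periodic_bounded[OF smH perH] by blast
  obtain M2 where M2: "M2 > 0" "\<And>x. \<bar>u x\<bar> \<le> M2" using doubly_periodic_bounded[OF smu peru] by blast
  define M where "M = M1 + M2 + 1"
  have lam: "\<bar>h11 x\<bar> < M" "\<bar>h22 x\<bar> < M" for x
    using M1(2)[of x] M2(2)[of x] unfolding M_def h_eq by linarith+
  have pos: "(e *\<^sub>R N x - M *\<^sub>R F x) \<bullet> hess F x v > 0" if "v \<noteq> 0" "e = 1 \<or> e = -1" for e x v
  proof -
    obtain s t' where v: "v = s *\<^sub>R a x + t' *\<^sub>R b x" by (rule plane_basis)
    have "s \<noteq> 0 \<or> t' \<noteq> 0" using that v by auto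
    moreover have "M - e * h11 x > 0" "M - e * h22 x > 0" using lam[of x] that(2) by (auto simp: abs_less_iff)
    ultimately have "s\<^sup>2 * (M - e * h11 x) + t'\<^sup>2 * (M - e * h22 x) > 0"
      by (auto intro: add_pos_nonneg add_nonneg_pos)
    then show ?thesis unfolding v inner_diff_left inner_scaleR_left hess_normal hess_radial by (simp add: algebra_simps)
  qed
  have diag: "\<exists>\<delta>>0. \<forall>x w. x \<in> fund \<longrightarrow> norm w < \<delta> \<longrightarrow> M * (1 - F x \<bullet> F (x + w)) + e * (N x \<bullet> F (x + w)) \<ge> 0"
    if "e = 1 \<or> e = -1" for e
  proof -
    have nT: "(e *\<^sub>R N x) \<bullet> frechet_derivative F (at x) v = 0" for x v
      by (simp add: normal_tangent)
    have pn: "doubly_periodic (\<lambda>x. e *\<^sub>R N x)" using perN by (simp add: doubly_periodic_def)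
    obtain \<delta> where "\<delta> > 0" "\<And>x w. x \<in> fund \<Longrightarrow> norm w < \<delta> \<Longrightarrow> M * (1 - F x \<bullet> F (x + w)) + (e *\<^sub>R N x) \<bullet> F (x + w) \<ge> 0"
    proof (rule diagonal[where \<Psi> = "\<lambda>_. M", OF continuous_on_const doubly_periodic_const _ pn _ nT])
      show "continuous_on UNIV (\<lambda>x. e *\<^sub>R N x)" by (intro continuous_intros smooth_continuous_on smN)
      show "(e *\<^sub>R N x) \<bullet> F x = 0" for x by (simp add: orth)
      show "(e *\<^sub>R N x - M *\<^sub>R F x) \<bullet> hess F x v > 0" if "v \<noteq> 0" for x v
        using that \<open>e = 1 \<or> e = -1\<close> by (rule pos)
    qed blast
    then show ?thesis by auto
  qed
  obtain \<delta>1 where d1: "\<delta>1 > 0" "\<And>x w. x \<in> fund \<Longrightarrow> norm w < \<delta>1 \<Longrightarrow> M * (1 - F x \<bullet> F (x + w)) + N x \<bullet> F (x + w) \<ge> 0"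
    using diag[of 1] by auto
  obtain \<delta>2 where d2: "\<delta>2 > 0" "\<And>x w. x \<in> fund \<Longrightarrow> norm w < \<delta>2 \<Longrightarrow> M * (1 - F x \<bullet> F (x + w)) - N x \<bullet> F (x + w) \<ge> 0"
    using diag[of "-1"] by auto
  define C where "C = {(x, w). x \<in> fund \<and> w \<in> cent \<and> norm w \<ge> min \<delta>1 \<delta>2}"
  have C: "compact C" "\<And>x w. (x, w) \<in> C \<Longrightarrow> F x \<noteq> F (x + w)"
    unfolding C_def using offdiagonal[of "min \<delta>1 \<delta>2"] d1(1) d2(1) by auto
  define Q where "Q = (\<lambda>z. \<bar>N (fst z) \<bullet> F (fst z + snd z)\<bar> / (1 - F (fst z) \<bullet> F (fst z + snd z)))"
  have cF: "continuous_on UNIV F" and cN: "continuous_on UNIV N" by (intro smooth_continuous_on smF smN)+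
  have "continuous_on C Q"
    unfolding Q_def using one_minus_pos C(2)
    by (intro continuous_intros continuous_on_compose2[OF cF] continuous_on_compose2[OF cN]) fastforce+
  then have "compact (Q ` C)" using C(1) by (rule compact_continuous_image)
  then have "bounded (Q ` C)" by (rule compact_imp_bounded)
  then obtain L where L: "\<And>z. z \<in> C \<Longrightarrow> norm (Q z) \<le> L" unfolding bounded_iff by blast
  show ?thesis
  proof (rule that[of "M + \<bar>L\<bar>"])
    show "M + \<bar>L\<bar> > 0" using M1 M2 by (simp add: M_def)
    fix x y
    obtain x' w where xw: "x' \<in> fund" "w \<in> cent" "F x' = F x" "N x' = N x" "F (x' + w) = F y"
      using pair_representative[of x y] by metis
    have R: "1 - F x \<bullet> F y \<ge> 0" by (rule one_minus_nonneg)
    have "\<bar>N x' \<bullet> F (x' + w)\<bar> \<le> (M + \<bar>L\<bar>) * (1 - F x' \<bullet> F (x' + w))"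
    proof (cases "norm w < min \<delta>1 \<delta>2")
      case True
      then have "\<bar>N x' \<bullet> F (x' + w)\<bar> \<le> M * (1 - F x' \<bullet> F (x' + w))"
        using d1(2)[OF xw(1), of w] d2(2)[OF xw(1), of w] by (simp add: abs_le_iff)
      also have "\<dots> \<le> (M + \<bar>L\<bar>) * (1 - F x' \<bullet> F (x' + w))"
        by (intro mult_right_mono one_minus_nonneg) simp
      finally show ?thesis .
    next
      case False
      then have "(x', w) \<in> C" using xw by (auto simp: C_def)
      then have pos: "1 - F x' \<bullet> F (x' + w) > 0" and "norm (Q (x', w)) \<le> L"
        using C(2) one_minus_pos L by blast+
      then have "\<bar>N x' \<bullet> F (x' + w)\<bar> / (1 - F x' \<bullet> F (x' + w)) \<le> L" by (simp add: Q_def)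
      then have "\<bar>N x' \<bullet> F (x' + w)\<bar> \<le> L * (1 - F x' \<bullet> F (x' + w))" using pos by (simp add: divide_le_eq)
      also have "\<dots> \<le> (M + \<bar>L\<bar>) * (1 - F x' \<bullet> F (x' + w))"
        using M1 M2 pos by (intro mult_right_mono) (auto simp: M_def)
      finally show ?thesis .
    qed
    then show "\<bar>N x \<bullet> F y\<bar> \<le> (M + \<bar>L\<bar>) * (1 - F x \<bullet> F y)" unfolding xw .
  qed
qed

end

text \<open>The cap is the radial projection of the cone \<open>K\<close>, which is convex because
  \<open>c \<ge> 0\<close> makes its defining function sublinear.\<close>

lemma connected_cap:
  fixes V :: "'a::euclidean_space"
  assumes "c \<ge> 0"
  shows "connected {P \<in> sphere 0 1. V \<bullet> P < - c}"
proof -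
  define K where "K = {v. V \<bullet> v + c * norm v < 0}"
  have "convex K"
  proof (rule convexI)
    fix x y :: 'a and s t :: real
    assume xy: "x \<in> K" "y \<in> K" and st: "0 \<le> s" "0 \<le> t" "s + t = 1"
    have "c * norm (s *\<^sub>R x + t *\<^sub>R y) \<le> c * (s * norm x + t * norm y)"
      using assms st norm_triangle_ineq[of "s *\<^sub>R x" "t *\<^sub>R y"] by (intro mult_left_mono) auto
    then have "V \<bullet> (s *\<^sub>R x + t *\<^sub>R y) + c * norm (s *\<^sub>R x + t *\<^sub>R y) \<le>
        s * (V \<bullet> x + c * norm x) + t * (V \<bullet> y + c * norm y)"
      by (simp add: inner_add_right algebra_simps)
    also have "\<dots> < 0"
    proof (cases "s = 0")
      case True
      then show ?thesis using xy st by (simp add: K_def)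
    next
      case False
      then have "s * (V \<bullet> x + c * norm x) < 0" using xy st by (simp add: K_def mult_pos_neg)
      moreover have "t * (V \<bullet> y + c * norm y) \<le> 0" using xy st by (simp add: K_def mult_nonneg_nonpos)
      ultimately show ?thesis by linarith
    qed
    finally show "s *\<^sub>R x + t *\<^sub>R y \<in> K" by (simp add: K_def)
  qed
  then have "connected K" by (rule convex_connected)
  have nz: "norm v \<noteq> 0" if "v \<in> K" for v using that by (auto simp: K_def)
  have "continuous_on K (\<lambda>v. v /\<^sub>R norm v)"
    using nz by (intro continuous_intros) auto
  from connected_continuous_image[OF this \<open>connected K\<close>]
  have "connected ((\<lambda>v. v /\<^sub>R norm v) ` K)" .
  also have "(\<lambda>v. v /\<^sub>R norm v) ` K = {P \<in> sphere 0 1. V \<bullet> P < - c}"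
  proof (intro equalityI subsetI)
    fix P assume "P \<in> (\<lambda>v. v /\<^sub>R norm v) ` K"
    then obtain v where v: "v \<in> K" "P = v /\<^sub>R norm v" by auto
    have n: "norm v > 0" using nz[OF v(1)] by simp
    have "V \<bullet> v < - c * norm v" using v(1) by (simp add: K_def)
    then have "V \<bullet> P < - c" using n by (simp add: v(2) field_simps)
    then show "P \<in> {P \<in> sphere 0 1. V \<bullet> P < - c}" using n by (simp add: v(2))
  next
    fix P assume P: "P \<in> {P \<in> sphere 0 1. V \<bullet> P < - c}"
    then have "P \<in> K" "P = P /\<^sub>R norm P" by (auto simp: K_def)
    then show "P \<in> (\<lambda>v. v /\<^sub>R norm v) ` K" by blast
  qed
  finally show ?thesis .
qed

lemma cis_eq_1: "cis t = 1 \<longleftrightarrow> (\<exists>n::int. t = 2 * pi * of_int n)"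
proof -
  have "cis t = 1 \<longleftrightarrow> exp (\<i> * of_real t) = 1" by (simp add: cis_conv_exp)
  also have "\<dots> \<longleftrightarrow> (\<exists>n::int. t = of_int (2 * n) * pi)" by (simp add: exp_eq_1)
  also have "\<dots> \<longleftrightarrow> (\<exists>n::int. t = 2 * pi * of_int n)" by (simp add: mult_ac)
  finally show ?thesis .
qed

section \<open>The two sides of the surface in the three-sphere\<close>

context weingarten_principal begin

text \<open>A point of the great circle normal to the surface at \<open>F x\<close>;
  \<open>s\<close> is the sine of the signed distance from \<open>F x\<close> along it, for small
  \<open>s\<close>.\<close>

definition "tube x s = sqrt (1 - s\<^sup>2) *\<^sub>R F x + s *\<^sub>R N x"

lemma tube_norm: "s\<^sup>2 \<le> 1 \<Longrightarrow> tube x s \<in> sphere 0 1"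
proof -
  assume "s\<^sup>2 \<le> 1"
  then have "tube x s \<bullet> tube x s = 1"
    by (simp add: tube_def inner_add_left inner_add_right orth power2_eq_square[symmetric])
  then show ?thesis by (simp add: norm_eq_1)
qed

text \<open>If the sphere touching at \<open>F x0\<close> from one side touched at \<open>F y0\<close> from the other one, then the
  cap inside it would join the two sides of the surface in the complement of the surface. But the
  signed distance to the surface, suitably normalised, is a map from the three-sphere to the circle,
  hence lifts to the reals, and the lift separates the two sides.\<close>

lemma no_reverse_touching:
  assumes k: "k > 1" and min: "\<And>x y. Z k x y \<ge> 0"
  shows "N x0 - \<Phi> k x0 *\<^sub>R F x0 + \<Phi> k x0 *\<^sub>R F y0 \<noteq> - N y0"
proof
  assume rev: "N x0 - \<Phi> k x0 *\<^sub>R F x0 + \<Phi> k x0 *\<^sub>R F y0 = - N y0"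
  obtain \<kappa> where \<kappa>: "\<kappa> > 0" "\<And>x y. \<bar>N x \<bullet> F y\<bar> \<le> \<kappa> * (1 - F x \<bullet> F y)" by (rule two_sided_bound) blast
  \<comment> \<open>Chosen so that \<open>sqrt (1 - s\<^sup>2) > \<kappa> * \<bar>s\<bar>\<close>
    for all \<open>\<bar>s\<bar> \<le> \<tau>\<close>, which makes the tube embedded.\<close>
  define \<tau> where "\<tau> = 1 / (2 + \<kappa>)"
  have \<tau>: "0 < \<tau>" "\<tau> < 1" using \<kappa>(1) by (auto simp: \<tau>_def)
  have sq: "s\<^sup>2 \<le> \<tau>\<^sup>2" if "\<bar>s\<bar> \<le> \<tau>" for s
    using power_mono[OF that abs_ge_zero, of 2] by simp
  have \<tau>2: "\<tau>\<^sup>2 < 1" using \<tau> by (simp add: abs_square_less_1)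
  have root: "sqrt (1 - s\<^sup>2) > \<kappa> * \<bar>s\<bar>" if "\<bar>s\<bar> \<le> \<tau>" for s
  proof (rule real_less_rsqrt)
    have "(1 + \<kappa>\<^sup>2) * s\<^sup>2 \<le> (1 + \<kappa>\<^sup>2) * \<tau>\<^sup>2" using sq[OF that] by (intro mult_left_mono) auto
    also have "\<dots> < (2 + \<kappa>)\<^sup>2 * \<tau>\<^sup>2"
    proof (rule mult_strict_right_mono)
      have "(2 + \<kappa>)\<^sup>2 = 4 + 4 * \<kappa> + \<kappa>\<^sup>2" by (simp add: power2_eq_square algebra_simps)
      then show "1 + \<kappa>\<^sup>2 < (2 + \<kappa>)\<^sup>2" using \<kappa>(1) by linarith
    qed (use \<tau> in simp)
    also have "\<dots> = 1" using \<kappa>(1) by (simp add: \<tau>_def power_divide)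
    finally show "(\<kappa> * \<bar>s\<bar>)\<^sup>2 < 1 - s\<^sup>2" by (simp add: power_mult_distrib algebra_simps)
  qed
  have tube_inner: "tube x s \<bullet> F y \<le> sqrt (1 - s\<^sup>2) - (1 - F x \<bullet> F y) * (sqrt (1 - s\<^sup>2) - \<kappa> * \<bar>s\<bar>)" for x y s
  proof -
    have "s * (N x \<bullet> F y) \<le> \<bar>s\<bar> * \<bar>N x \<bullet> F y\<bar>" by (metis abs_ge_self abs_mult)
    also have "\<dots> \<le> \<bar>s\<bar> * (\<kappa> * (1 - F x \<bullet> F y))" using \<kappa>(2) by (intro mult_left_mono) auto
    finally show ?thesis by (simp add: tube_def inner_add_left algebra_simps)
  qed
  \<comment> \<open>Larger inner product means smaller distance on the sphere: the foot
    \<open>F x\<close> is the only surface point nearest to \<open>tube x s\<close>, so foot and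
    parameter can be recovered.\<close>
  have inner_le: "tube x s \<bullet> F y \<le> sqrt (1 - s\<^sup>2)" and inner_eq: "tube x s \<bullet> F y = sqrt (1 - s\<^sup>2) \<Longrightarrow> F x = F y"
    if "\<bar>s\<bar> \<le> \<tau>" for x y s
  proof -
    have p: "sqrt (1 - s\<^sup>2) - \<kappa> * \<bar>s\<bar> > 0" using root[OF that] by simp
    then have "(1 - F x \<bullet> F y) * (sqrt (1 - s\<^sup>2) - \<kappa> * \<bar>s\<bar>) \<ge> 0" using one_minus_nonneg by simp
    then show "tube x s \<bullet> F y \<le> sqrt (1 - s\<^sup>2)" using tube_inner[of x s y] by linarith
    assume e: "tube x s \<bullet> F y = sqrt (1 - s\<^sup>2)"
    show "F x = F y"
    proof (rule ccontr)
      assume "F x \<noteq> F y"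
      then have "(1 - F x \<bullet> F y) * (sqrt (1 - s\<^sup>2) - \<kappa> * \<bar>s\<bar>) > 0" using p one_minus_pos by simp
      then show False using tube_inner[of x s y] e by linarith
    qed
  qed
  have tube_F: "tube x s \<bullet> F x = sqrt (1 - s\<^sup>2)" "tube x s \<bullet> N x = s" for x s
    by (simp_all add: tube_def inner_add_left orth)
  have uniq: "s = s'" if e: "tube x s = tube x' s'" and s: "\<bar>s\<bar> \<le> \<tau>" "\<bar>s'\<bar> \<le> \<tau>" for x x' s s'
  proof -
    have "tube x s \<bullet> F x' = sqrt (1 - s'\<^sup>2)" "tube x' s' \<bullet> F x = sqrt (1 - s\<^sup>2)"
      using tube_F(1)[of x' s'] tube_F(1)[of x s] e by simp_all
    then have "sqrt (1 - s'\<^sup>2) \<le> sqrt (1 - s\<^sup>2)" "sqrt (1 - s\<^sup>2) \<le> sqrt (1 - s'\<^sup>2)"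
      using inner_le[OF s(1), of x x'] inner_le[OF s(2), of x' x] by simp_all
    then have "tube x s \<bullet> F x' = sqrt (1 - s\<^sup>2)" using \<open>tube x s \<bullet> F x' = sqrt (1 - s'\<^sup>2)\<close> by simp
    then have "F x = F x'" by (rule inner_eq[OF s(1)])
    then have "N x = N x'" by (rule same_normal)
    then show ?thesis using tube_F(2)[of x s] tube_F(2)[of x' s'] e by simp
  qed
  have ctube: "continuous_on S (\<lambda>z. tube (fst z) (snd z))" for S
  proof -
    have c: "continuous_on UNIV F" "continuous_on UNIV N" by (intro smooth_continuous_on smF smN)+
    show ?thesis unfolding tube_def
      by (intro continuous_intros continuous_on_compose2[OF c(1)] continuous_on_compose2[OF c(2)]) auto
  qed
  define D where "D = fund \<times> {-\<tau>..\<tau>}"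
  have cD: "compact D" unfolding D_def by (intro compact_Times) auto
  define A where "A = (\<lambda>z. tube (fst z) (snd z)) ` D"
  have cA: "compact A" unfolding A_def by (rule compact_continuous_image[OF ctube cD])
  have tube_A: "tube x s \<in> A" if "\<bar>s\<bar> \<le> \<tau>" for x s
  proof -
    obtain x' w where "x' \<in> fund" "F x' = F x" "N x' = N x" by (rule pair_representative[of x x]) blast
    then have "tube x s = tube x' s" "(x', s) \<in> D" using that by (auto simp: tube_def D_def)
    then show ?thesis unfolding A_def by force
  qed
  define \<sigma> where "\<sigma> P = (THE s. \<bar>s\<bar> \<le> \<tau> \<and> (\<exists>x. P = tube x s))" for P
  have \<sigma>: "\<sigma> (tube x s) = s" if "\<bar>s\<bar> \<le> \<tau>" for x s
    unfolding \<sigma>_def using that uniq by (intro the_equality) blast+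
  have c\<sigma>: "continuous_on A \<sigma>"
  proof (rule continuous_from_closed_graph[of "{-\<tau>..\<tau>}"])
    show "\<sigma> \<in> A \<rightarrow> {-\<tau>..\<tau>}" using \<sigma> by (auto simp: A_def D_def abs_le_iff)
    have "(\<lambda>x. (x, \<sigma> x)) ` A = (\<lambda>z. (tube (fst z) (snd z), snd z)) ` D"
      unfolding A_def image_image using \<sigma> by (intro image_cong) (auto simp: D_def abs_le_iff)
    moreover have "compact \<dots>"
      by (intro compact_continuous_image cD continuous_on_Pair ctube continuous_intros)
    ultimately show "closed ((\<lambda>x. (x, \<sigma> x)) ` A)" by (simp add: compact_imp_closed)
  qed simp
  \<comment> \<open>The points whose distance from the surface is at least that of the boundary of
    the tube.\<close>
  define B where "B = {P \<in> sphere 0 1. \<forall>y. P \<bullet> F y \<le> sqrt (1 - \<tau>\<^sup>2)}"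
  have "B = sphere 0 1 \<inter> (\<Inter>y. {P. P \<bullet> F y \<le> sqrt (1 - \<tau>\<^sup>2)})" by (auto simp: B_def)
  moreover have "closed {P. P \<bullet> F y \<le> sqrt (1 - \<tau>\<^sup>2)}" for y
    by (intro closed_Collect_le continuous_intros)
  ultimately have clB: "closed B" by (auto intro!: closed_Int)
  have AB: "sphere 0 1 = A \<union> B"
  proof (intro equalityI subsetI)
    fix P :: "real^4" assume P: "P \<in> sphere 0 1"
    show "P \<in> A \<union> B"
    proof (cases "P \<in> B")
      case False
      then obtain y1 where y1: "P \<bullet> F y1 > sqrt (1 - \<tau>\<^sup>2)" using P by (auto simp: B_def not_le)
      \<comment> \<open>A minimum of \<open>f\<close> is a surface point nearest to
        \<open>P\<close>; there \<open>P\<close> is orthogonal to the tangent plane and hence lies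
        on the normal great circle.\<close>
      define f where "f = (\<lambda>y. - (P \<bullet> F y))"
      have smf: "smooth f" unfolding f_def by (intro smooth_minus smooth_inner smooth_const smF)
      have "doubly_periodic f" unfolding f_def using perF by (simp add: doubly_periodic_def)
      then obtain y where y: "\<And>x. f y \<le> f x"
        using doubly_periodic_bounds[OF smooth_continuous_on[OF smf]] by metis
      have z: "P \<bullet> dd v F y = 0" for v
      proof -
        have "dd v f y = 0" using frechet_zero_at_minimum[OF smf y] by (simp add: dd_def)
        then show ?thesis unfolding f_def
          by (simp add: dd_minus dd_inner dd_const smooth_inner smooth_const smF)
      qed
      have "P \<bullet> E1 y = 0" "P \<bullet> E2 y = 0" using z[of a] z[of b] by (simp_all add: structure_eqs)
      then have Peq: "P = (P \<bullet> N y) *\<^sub>R N y + (P \<bullet> F y) *\<^sub>R F y"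
        by (intro trans[OF expand[of P y]]) simp
      have gt: "sqrt (1 - \<tau>\<^sup>2) < P \<bullet> F y" using y[of y1] y1 by (simp add: f_def)
      have "(sqrt (1 - \<tau>\<^sup>2))\<^sup>2 < (P \<bullet> F y)\<^sup>2"
        using gt \<tau>2 by (intro power_strict_mono) auto
      then have m2: "(P \<bullet> F y)\<^sup>2 > 1 - \<tau>\<^sup>2" using \<tau>2 by simp
      have "sqrt (1 - \<tau>\<^sup>2) > 0" using \<tau>2 by simp
      with gt have "P \<bullet> F y > 0" by linarith
      note m = this m2
      have "P \<bullet> P = (P \<bullet> N y) * (P \<bullet> N y) + (P \<bullet> F y) * (P \<bullet> F y)"
        using arg_cong[OF Peq, of "\<lambda>v. P \<bullet> v"] by (simp add: inner_add_right)
      then have one: "(P \<bullet> N y)\<^sup>2 + (P \<bullet> F y)\<^sup>2 = 1" using P by (simp add: norm_eq_1 power2_eq_square)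
      then have "(P \<bullet> N y)\<^sup>2 < \<tau>\<^sup>2" using m by simp
      then have "\<bar>P \<bullet> N y\<bar> < \<tau>" using \<tau>(1) by (metis abs_of_pos power2_abs power_less_imp_less_base less_imp_le)
      moreover have "sqrt (1 - (P \<bullet> N y)\<^sup>2) = P \<bullet> F y" using one m by (intro real_sqrt_unique) auto
      ultimately have le: "\<bar>P \<bullet> N y\<bar> \<le> \<tau>" and eq: "tube y (P \<bullet> N y) = (P \<bullet> N y) *\<^sub>R N y + (P \<bullet> F y) *\<^sub>R F y"
        by (simp_all add: tube_def add.commute)
      have "P = tube y (P \<bullet> N y)" using Peq unfolding eq .
      then have "P \<in> A" by (rule ssubst) (rule tube_A[OF le])
      then show ?thesis by simp
    qed simp
  next
    fix P assume "P \<in> A \<union> B"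
    then show "P \<in> sphere 0 1"
    proof
      assume "P \<in> A"
      then obtain x s where "P = tube x s" "\<bar>s\<bar> \<le> \<tau>" by (auto simp: A_def D_def)
      then show ?thesis using tube_norm[of s x] sq[of s] \<tau>2 by simp
    qed (simp add: B_def)
  qed
  \<comment> \<open>The tube is wrapped once around the circle. Both of its ends are sent to
    \<open>- 1\<close>, so the constant extends the map continuously.\<close>
  define g where "g P = (if P \<in> A then cis (pi * \<sigma> P / \<tau>) else - 1)" for P
  have cg: "continuous_on (sphere 0 1) g"
    unfolding AB g_def
  proof (rule continuous_on_If)
    show "continuous_on A (\<lambda>P. cis (pi * \<sigma> P / \<tau>))" using \<tau> by (intro continuous_intros c\<sigma>) auto
    show "closed A" "closed B" by (rule compact_imp_closed[OF cA], rule clB)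
    fix P assume "P \<in> B" "P \<in> A"
    then obtain x s where P: "P = tube x s" and s: "\<bar>s\<bar> \<le> \<tau>" by (auto simp: A_def D_def)
    have "tube x s \<bullet> F x \<le> sqrt (1 - \<tau>\<^sup>2)" using \<open>P \<in> B\<close> unfolding P B_def by blast
    then have "\<tau>\<^sup>2 \<le> s\<^sup>2" unfolding tube_F(1) by simp
    then have "\<bar>s\<bar> = \<tau>" using s \<tau> by (simp add: abs_le_square_iff[symmetric])
    then have "pi * s / \<tau> = pi \<or> pi * s / \<tau> = - pi" using \<tau> by (auto simp: abs_if split: if_splits)
    then show "cis (pi * \<sigma> P / \<tau>) = - 1" unfolding P \<sigma>[OF s] by (auto simp: cis.ctr complex_eq_iff)
  qed simp_all
  have g_norm: "norm (g P) = 1" for P by (simp add: g_def)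
  then have "g P \<noteq> 0" for P by (metis norm_zero zero_neq_one)
  then obtain L where L: "continuous_on (sphere 0 1) L" "\<And>P. P \<in> sphere 0 1 \<Longrightarrow> g P = exp (L P)"
    using continuous_logarithm_on_simply_connected[OF cg _ locally_path_connected_sphere]
    by (auto simp: simply_connected_sphere_eq)
  define \<theta> where "\<theta> P = Im (L P)" for P
  have g\<theta>: "g P = cis (\<theta> P)" if "P \<in> sphere 0 1" for P
  proof -
    have "exp (Re (L P)) = 1" using g_norm[of P] L(2)[OF that] by (simp add: norm_exp_eq_Re)
    then show ?thesis using L(2)[OF that] by (simp add: exp_eq_polar \<theta>_def)
  qed
  have c\<theta>: "continuous_on (sphere 0 1) \<theta>" unfolding \<theta>_def by (intro continuous_intros L)
  have tube_S: "tube x s \<in> sphere 0 1" if "\<bar>s\<bar> \<le> \<tau>" for x s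
    using tube_norm[of s x] sq[OF that] \<tau>2 by simp
  define S where "S = (UNIV :: (real^2) set) \<times> {-\<tau>..\<tau>}"
  \<comment> \<open>The lift and the explicit angle in the tube differ by values in the discrete set
    of multiples of \<open>2 * pi\<close>, hence by a constant on the connected set
    \<open>S\<close>.\<close>
  define h where "h z = \<theta> (tube (fst z) (snd z)) - pi * snd z / \<tau>" for z
  have hint: "\<exists>n::int. h z = 2 * pi * of_int n" if "z \<in> S" for z
  proof -
    have s: "\<bar>snd z\<bar> \<le> \<tau>" using that by (auto simp: S_def abs_le_iff)
    have "cis (h z) = cis (\<theta> (tube (fst z) (snd z))) / cis (pi * snd z / \<tau>)"
      unfolding h_def by (simp add: cis_divide)
    also have "\<dots> = 1" using g\<theta>[OF tube_S[OF s]] tube_A[OF s] \<sigma>[OF s] by (simp add: g_def)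
    finally show ?thesis by (simp add: cis_eq_1)
  qed
  have "h constant_on S"
  proof (rule continuous_discrete_range_constant)
    show "connected S" unfolding S_def by (intro connected_Times) auto
    show "continuous_on S h" unfolding h_def
      using \<tau> by (intro continuous_intros continuous_on_compose2[OF c\<theta>] ctube) (auto simp: S_def abs_le_iff intro!: tube_S)
    fix z assume z: "z \<in> S"
    show "\<exists>e>0. \<forall>y. y \<in> S \<and> h y \<noteq> h z \<longrightarrow> e \<le> norm (h y - h z)"
    proof (intro exI[of _ "2 * pi"] conjI allI impI)
      fix y assume y: "y \<in> S \<and> h y \<noteq> h z"
      obtain m n :: int where mn: "h y = 2 * pi * of_int m" "h z = 2 * pi * of_int n" using hint y z by metis
      have "m \<noteq> n" using y mn by auto
      then have "1 \<le> \<bar>real_of_int (m - n)\<bar>" by linarith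
      then have "2 * pi * 1 \<le> 2 * pi * \<bar>real_of_int (m - n)\<bar>" by (intro mult_left_mono) auto
      also have "\<dots> = norm (h y - h z)"
        unfolding mn by (simp add: right_diff_distrib[symmetric] abs_mult)
      finally show "2 * pi \<le> norm (h y - h z)" by simp
    qed simp
  qed
  then obtain c where c: "\<And>z. z \<in> S \<Longrightarrow> h z = c" unfolding constant_on_def by blast
  have "(x0, 0) \<in> S" using \<tau> by (simp add: S_def)
  then have c1: "cis c = 1" using hint c by (metis cis_eq_1)
  define V where "V = N x0 - \<Phi> k x0 *\<^sub>R F x0"
  have \<Phi>0: "\<Phi> k x0 > 0"
    using w S_pos[of x0] u_pos[of x0] k by (simp add: \<Phi>_def H_val add_nonneg_pos add_pos_pos)
  define cap where "cap = {P \<in> sphere 0 1. V \<bullet> P < - \<Phi> k x0}"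
  have ccap: "connected (\<theta> ` cap)"
    unfolding cap_def using \<Phi>0
    by (intro connected_continuous_image connected_cap continuous_on_subset[OF c\<theta>]) auto
  \<comment> \<open>The value \<open>c\<close> forces \<open>s / \<tau>\<close> to be an even
    integer of absolute value at most 1, so \<open>P\<close> lies on the surface; but
    \<open>Z \<ge> 0\<close> keeps the surface out of the open cap.\<close>
  have cap_avoids: "\<theta> P \<noteq> c" if "P \<in> cap" for P
  proof
    assume "\<theta> P = c"
    then have g1: "g P = 1" using that g\<theta> c1 by (simp add: cap_def)
    then have "P \<in> A" by (auto simp: g_def split: if_splits)
    then obtain x s where P: "P = tube x s" and s: "\<bar>s\<bar> \<le> \<tau>" by (auto simp: A_def D_def)
    have "cis (pi * s / \<tau>) = 1" using g1 \<open>P \<in> A\<close> \<sigma>[OF s] by (simp add: g_def P)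
    then obtain n :: int where n: "pi * s / \<tau> = 2 * pi * of_int n" unfolding cis_eq_1 by blast
    have "s / \<tau> = (pi * s / \<tau>) / pi" by simp
    also have "\<dots> = 2 * of_int n" unfolding n by simp
    finally have "s / \<tau> = 2 * of_int n" .
    moreover have "\<bar>s / \<tau>\<bar> \<le> 1" using s \<tau> by simp
    ultimately have "n = 0" by linarith
    then have "s = 0" using \<open>s / \<tau> = 2 * of_int n\<close> \<tau> by simp
    then have "P = F x" by (simp add: P tube_def)
    moreover have "V \<bullet> F x \<ge> - \<Phi> k x0"
      using min[of x0 x] by (simp add: V_def Z_def inner_diff_left algebra_simps)
    ultimately show False using that by (simp add: cap_def)
  qed
  \<comment> \<open>Then \<open>\<Phi> k x0 * s\<^sup>2 < s\<close>, so that moving by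
    \<open>s\<close> off the surface, at \<open>x0\<close> against \<open>N\<close> and at
    \<open>y0\<close> along \<open>N\<close>, enters the cap.\<close>
  define s where "s = min \<tau> (1 / (2 * \<Phi> k x0))"
  have s: "0 < s" "s \<le> \<tau>" "\<bar>s\<bar> \<le> \<tau>" "\<bar>- s\<bar> \<le> \<tau>" using \<tau> \<Phi>0 by (auto simp: s_def)
  have cap_s: "- s - \<Phi> k x0 * sqrt (1 - s\<^sup>2) < - \<Phi> k x0"
  proof -
    have s2: "s\<^sup>2 < 1" using sq[OF s(3)] \<tau>2 by linarith
    have "1 - s\<^sup>2 \<le> sqrt (1 - s\<^sup>2)"
    proof (rule real_le_rsqrt)
      have "(1 - s\<^sup>2) * (1 - s\<^sup>2) \<le> (1 - s\<^sup>2) * 1" using s2 by (intro mult_left_mono) auto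
      then show "(1 - s\<^sup>2)\<^sup>2 \<le> 1 - s\<^sup>2" by (simp add: power2_eq_square)
    qed
    then have "\<Phi> k x0 * (1 - s\<^sup>2) \<le> \<Phi> k x0 * sqrt (1 - s\<^sup>2)" using \<Phi>0 by (intro mult_left_mono) auto
    moreover have "\<Phi> k x0 * s\<^sup>2 < s"
    proof -
      have "\<Phi> k x0 * s \<le> \<Phi> k x0 * (1 / (2 * \<Phi> k x0))" using \<Phi>0 by (intro mult_left_mono) (auto simp: s_def)
      then have "\<Phi> k x0 * s < 1" using \<Phi>0 by simp
      then have "\<Phi> k x0 * s * s < 1 * s" using s by (intro mult_strict_right_mono) auto
      then show ?thesis by (simp add: power2_eq_square)
    qed
    ultimately show ?thesis by (simp add: algebra_simps)
  qed
  have "tube x0 (- s) \<in> cap"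
    using cap_s tube_S[OF s(4)]
    by (simp add: cap_def V_def tube_def inner_diff_left inner_add_right inner_diff_right orth)
  moreover have "V = - N y0 - \<Phi> k x0 *\<^sub>R F y0"
    using rev by (simp add: V_def algebra_simps)
  then have "tube y0 s \<in> cap"
    using cap_s tube_S[OF s(3)]
    by (simp add: cap_def tube_def inner_diff_left inner_add_right inner_diff_right orth)
  ultimately have "\<theta> (tube x0 (- s)) \<in> \<theta> ` cap" "\<theta> (tube y0 s) \<in> \<theta> ` cap" by blast+
  moreover have "\<theta> (tube x0 (- s)) = c - pi * s / \<tau>" "\<theta> (tube y0 s) = c + pi * s / \<tau>"
    using c[of "(x0, - s)"] c[of "(y0, s)"] s by (simp_all add: h_def S_def)
  moreover have "pi * s / \<tau> \<ge> 0" using s \<tau> by simp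
  ultimately have "c \<in> \<theta> ` cap"
    using connectedD_interval[OF ccap, of "c - pi * s / \<tau>" "c + pi * s / \<tau>" c] by simp
  then show False using cap_avoids by auto
qed

end

section \<open>Rotational symmetry\<close>

text \<open>If \<open>c < 0\<close>, then \<open>f''\<close>, hence \<open>f'\<close>, hence
  \<open>f\<close> would be negative just to the right of 0.\<close>

lemma third_derivative_nonneg:
  fixes f f' f'' :: "real \<Rightarrow> real"
  assumes "\<And>s. (f has_real_derivative f' s) (at s)" "\<And>s. (f' has_real_derivative f'' s) (at s)"
    and "(f'' has_real_derivative c) (at 0)"
    and "f 0 = 0" "f' 0 = 0" "f'' 0 = 0" and nonneg: "\<And>s. f s \<ge> 0"
  shows "c \<ge> 0"
proof (rule ccontr)
  assume "\<not> c \<ge> 0"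
  then have "c < 0" by simp
  from DERIV_neg_dec_right[OF assms(3) this] obtain d where d: "d > 0" "\<And>h. 0 < h \<Longrightarrow> h < d \<Longrightarrow> f'' h < 0"
    using assms(6) by auto
  have neg: "f' z < 0" if z: "0 < z" "z < d" for z
  proof -
    have "\<exists>y>0. y < z \<and> f' z - f' 0 = (z - 0) * f'' y" by (rule MVT2) (use assms(2) z in auto)
    then obtain y where y: "0 < y" "y < z" "f' z = z * f'' y" using assms(5) by auto
    then show ?thesis using d(2)[of y] z by (simp add: mult_pos_neg)
  qed
  have "\<exists>z>0. z < d / 2 \<and> f (d / 2) - f 0 = (d / 2 - 0) * f' z" by (rule MVT2) (use assms(1) d(1) in auto)
  then obtain z where z: "0 < z" "z < d / 2" "f (d / 2) = d / 2 * f' z" using assms(4) by auto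
  then have "d / 2 * f' z < 0" using neg[of z] d(1) by (intro mult_pos_neg) auto
  then show False using z nonneg[of "d / 2"] by simp
qed

abbreviation (input) cdd :: "real^2 \<Rightarrow> (real^2 \<Rightarrow> 'b::real_normed_vector) \<Rightarrow> real^2 \<Rightarrow> 'b" where
  "cdd v \<equiv> dd (\<lambda>_. v)"

context weingarten_principal begin

text \<open>For a pair of distinct surface points, \<open>Z\<close> is affine and increasing in its
  parameter and vanishes at the single value \<open>Q\<close>. If the maximum of \<open>Q\<close>
  over the compact set \<open>C\<close> exceeds \<open>k\<close>, then at this parameter
  \<open>Z\<close> is nonnegative with a zero at distinct points, and both ways of touching are
  excluded.\<close>

lemma Z_nonneg:
  assumes k: "k > 1"
  shows "Z k x y \<ge> 0"
proof -
  have pos: "(N x - \<Phi> k x *\<^sub>R F x) \<bullet> hess F x v > 0" if v0: "v \<noteq> 0" for x v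
  proof -
    obtain s t' where v: "v = s *\<^sub>R a x + t' *\<^sub>R b x" by (rule plane_basis)
    have "s \<noteq> 0 \<or> t' \<noteq> 0" using v0 v by auto
    moreover have "(k - 1) * u x > 0" "(k + 1) * u x > 0" using u_pos[of x] k by simp_all
    ultimately have "s\<^sup>2 * ((k - 1) * u x) + t'\<^sup>2 * ((k + 1) * u x) > 0"
      by (auto intro: add_pos_nonneg add_nonneg_pos)
    then show ?thesis unfolding v inner_diff_left inner_scaleR_left hess_normal hess_radial \<Phi>_def h_eq
      by (simp add: algebra_simps)
  qed
  obtain \<delta> where \<delta>: "\<delta> > 0" "\<And>x w. x \<in> fund \<Longrightarrow> norm w < \<delta> \<Longrightarrow> \<Phi> k x * (1 - F x \<bullet> F (x + w)) + N x \<bullet> F (x + w) \<ge> 0"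
  proof (rule diagonal[OF smooth_continuous_on[OF sm\<Phi>] per\<Phi> smooth_continuous_on[OF smN] perN _ normal_tangent pos])
    show "N x \<bullet> F x = 0" for x by (simp add: orth)
  qed blast+
  define C where "C = {(x, w). x \<in> fund \<and> w \<in> cent \<and> norm w \<ge> \<delta>}"
  have C: "compact C" "\<And>x w. (x, w) \<in> C \<Longrightarrow> F x \<noteq> F (x + w)"
    unfolding C_def using offdiagonal[OF \<delta>(1)] by blast+
  define Q where "Q = (\<lambda>z. (- (N (fst z) \<bullet> F (fst z + snd z)) / (1 - F (fst z) \<bullet> F (fst z + snd z)) - H (fst z)) / u (fst z))"
  have c: "continuous_on UNIV F" "continuous_on UNIV N" "continuous_on UNIV H" "continuous_on UNIV u"
    by (intro smooth_continuous_on smF smN smH smu)+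
  have cQ: "continuous_on C Q"
    unfolding Q_def
  proof (intro continuous_intros continuous_on_compose2[OF c(1)] continuous_on_compose2[OF c(2)]
      continuous_on_compose2[OF c(3)] continuous_on_compose2[OF c(4)] subset_UNIV ballI)
    fix z assume "z \<in> C"
    then have "1 - F (fst z) \<bullet> F (fst z + snd z) > 0" using C(2)[of "fst z" "snd z"] one_minus_pos by simp
    then show "1 - F (fst z) \<bullet> F (fst z + snd z) \<noteq> 0" by simp
    show "u (fst z) \<noteq> 0" using u_pos[of "fst z"] by simp
  qed
  have Q_Z: "Z k' x (x + w) = (k' - Q (x, w)) * u x * (1 - F x \<bullet> F (x + w))" if "(x, w) \<in> C" for k' x w
    using one_minus_pos[OF C(2)[OF that]] u_pos[of x]
    by (simp add: Z_def \<Phi>_def Q_def field_simps)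
  have Z_rep: "\<exists>x' w. x' \<in> fund \<and> w \<in> cent \<and> (\<forall>k. Z k x' (x' + w) = Z k x y)" for x y
  proof -
    obtain x' w where xw: "x' \<in> fund" "w \<in> cent" "\<And>f::real^2 \<Rightarrow> real. doubly_periodic f \<Longrightarrow> f x' = f x"
      "F x' = F x" "N x' = N x" "F (x' + w) = F y"
      by (rule pair_representative[of x y]) blast
    have "\<Phi> k x' = \<Phi> k x" for k by (rule xw(3)[OF per\<Phi>])
    then show ?thesis using xw by (intro exI[of _ x'] exI[of _ w] conjI allI) (simp_all add: Z_def)
  qed
  \<comment> \<open>The radius \<delta> belongs to \<open>k\<close>; monotonicity carries the
    estimate near the diagonal to every larger parameter.\<close>
  have Z_mono: "Z k1 x y \<le> Z k2 x y" if "k1 \<le> k2" for k1 k2 x y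
    using mult_right_mono[OF mult_right_mono[OF that less_imp_le[OF u_pos[of x]]] one_minus_nonneg[of x y]]
    by (simp add: Z_def \<Phi>_def algebra_simps)
  have all: "Z k' x y \<ge> 0" if k': "k \<le> k'" "\<And>z. z \<in> C \<Longrightarrow> Q z \<le> k'" for k' x y
  proof -
    obtain x' w where xw: "x' \<in> fund" "w \<in> cent" "\<And>k. Z k x' (x' + w) = Z k x y" using Z_rep by blast
    have "Z k' x' (x' + w) \<ge> 0"
    proof (cases "norm w < \<delta>")
      case True
      then have "Z k x' (x' + w) \<ge> 0" using \<delta>(2)[OF xw(1)] by (simp add: Z_def)
      then show ?thesis using Z_mono[OF k'(1), of x' "x' + w"] by simp
    next
      case False
      then have inC: "(x', w) \<in> C" using xw by (simp add: C_def)
      show ?thesis unfolding Q_Z[OF inC]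
        using k'(2)[OF inC] u_pos[of x'] one_minus_nonneg by (intro mult_nonneg_nonneg) auto
    qed
    then show ?thesis by (simp add: xw(3))
  qed
  show ?thesis
  proof (cases "C = {}")
    case True
    then show ?thesis by (intro all) auto
  next
    case False
    from continuous_attains_sup[OF C(1) False cQ]
    obtain z where z: "z \<in> C" "\<And>z'. z' \<in> C \<Longrightarrow> Q z' \<le> Q z" by blast
    show ?thesis
    proof (cases "Q z \<le> k")
      case True
      then show ?thesis using z(2) by (intro all) (auto intro: order_trans)
    next
      case False
      define k' where "k' = Q z"
      obtain x0 w0 where xw: "z = (x0, w0)" by (cases z)
      have k1: "k' > 1" using False k by (simp add: k'_def)
      have min: "Z k' x y \<ge> 0" for x y
        by (rule all) (use False z(2) in \<open>auto simp: k'_def\<close>)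
      have inC: "(x0, w0) \<in> C" using z(1) xw by simp
      have zero: "Z k' x0 (x0 + w0) = 0" unfolding Q_Z[OF inC] by (simp add: k'_def xw)
      from touching_normal[OF min zero] no_touching[OF k1 min zero C(2)[OF inC]] no_reverse_touching[OF k1 min, of x0 "x0 + w0"]
      show ?thesis by blast
    qed
  qed
qed

text \<open>The limit from parameters above 1, made explicit: \<open>e\<close> is so small that
  raising the parameter by \<open>e\<close> makes up for at most half of a negative value.\<close>

lemma Z1_nonneg: "Z 1 x y \<ge> 0"
proof (rule ccontr)
  assume neg: "\<not> Z 1 x y \<ge> 0"
  define c where "c = u x * (1 - F x \<bullet> F y)"
  have c: "c \<ge> 0" using u_pos[of x] one_minus_nonneg[of x y] by (simp add: c_def)
  define e where "e = - Z 1 x y / (2 * (c + 1))"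
  have e: "e > 0" unfolding e_def using neg c by (intro divide_pos_pos) auto
  have "Z (1 + e) x y = Z 1 x y + e * c"
    by (simp add: Z_def \<Phi>_def c_def algebra_simps)
  also have "e * c \<le> e * (2 * (c + 1)) / 2" using e c by simp
  also have "e * (2 * (c + 1)) = - Z 1 x y" using c by (simp add: e_def)
  finally have "Z (1 + e) x y \<le> Z 1 x y / 2" by simp
  then show False using Z_nonneg[of "1 + e" x y] e neg by simp
qed

text \<open>The two sides differ by terms in which a derivative falls on the coefficients of \<open>a\<close>; as \<open>a\<close> is
  principal, \<open>V\<close> annihilates them.\<close>

lemma normal_third:
  fixes x
  defines "V \<equiv> N x - h11 x *\<^sub>R F x"
  shows "V \<bullet> cdd (a x) (cdd (a x) (cdd (a x) F)) x = V \<bullet> dd a (dd a E1) x"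
proof -
  have VT: "V \<bullet> frechet_derivative F (at x) v = 0" for v
    by (simp add: V_def inner_diff_left normal_tangent radial_tangent)
  have VE: "V \<bullet> frechet_derivative E1 (at x) v = 0" for v
  proof -
    have "V \<bullet> dd a E1 x = 0" "V \<bullet> dd b E1 x = 0"
      by (simp_all add: principal_structure V_def inner_diff_left inner_diff_right orth)
    then show ?thesis unfolding frechet_coords[OF smE1, of x v] by (simp add: inner_add_right)
  qed
  have s: "smooth (pder i F)" for i by (rule smooth_pder[OF smF])
  have sc: "smooth (\<lambda>y. a y $ i)" for i by (rule smooth_nth[OF sma])
  have sD: "smooth (cdd (a x) g)" if "smooth g" for g :: "real^2 \<Rightarrow> 'c::real_normed_vector"
    by (rule smooth_dd[OF that smooth_const])
  have VD: "V \<bullet> cdd (a x) (pder i F) x = 0" for i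
  proof -
    have "pder i E1 x = frechet_derivative (\<lambda>y. frechet_derivative F (at y) (a x)) (at x) (axis i 1)
        + frechet_derivative F (at x) (pder i a x)"
      unfolding daF[symmetric] by (rule dd_dd[OF smF sma])
    moreover have "V \<bullet> pder i E1 x = 0" unfolding dd_def by (rule VE)
    ultimately have "V \<bullet> frechet_derivative (\<lambda>y. frechet_derivative F (at y) (a x)) (at x) (axis i 1) = 0"
      by (simp add: inner_add_right VT)
    moreover have "frechet_derivative (\<lambda>y. frechet_derivative F (at y) (a x)) (at x) (axis i 1) = cdd (a x) (pder i F) x"
      using frechet_symmetric[OF smF, of "a x" x "axis i 1"] by (simp add: dd_def[abs_def])
    ultimately show ?thesis by simp
  qed
  have E1: "E1 = (\<lambda>y. (a y $ 1) *\<^sub>R pder 1 F y + (a y $ 2) *\<^sub>R pder 2 F y)"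
  proof
    fix y show "E1 y = (a y $ 1) *\<^sub>R pder 1 F y + (a y $ 2) *\<^sub>R pder 2 F y"
      using frechet_plane[OF smF, of y "a y"] daF'[of y] by (simp add: dd_def[of a])
  qed
  have DF: "cdd (a x) F = (\<lambda>y. (a x $ 1) *\<^sub>R pder 1 F y + (a x $ 2) *\<^sub>R pder 2 F y)"
  proof
    fix y show "cdd (a x) F y = (a x $ 1) *\<^sub>R pder 1 F y + (a x $ 2) *\<^sub>R pder 2 F y"
      using frechet_plane[OF smF, of y "a x"] by (simp add: dd_def[of "\<lambda>_. a x"])
  qed
  have D1: "cdd (a x) E1 = (\<lambda>y. cdd (a x) (\<lambda>y. a y $ 1) y *\<^sub>R pder 1 F y + (a y $ 1) *\<^sub>R cdd (a x) (pder 1 F) y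
      + (cdd (a x) (\<lambda>y. a y $ 2) y *\<^sub>R pder 2 F y + (a y $ 2) *\<^sub>R cdd (a x) (pder 2 F) y))"
    unfolding E1 by (simp add: fun_eq_iff dd_add dd_scaleR smooth_scaleR s sc)
  have DD: "cdd (a x) (cdd (a x) E1) x = cdd (a x) (cdd (a x) (\<lambda>y. a y $ 1)) x *\<^sub>R pder 1 F x + (cdd (a x) (\<lambda>y. a y $ 1) x *\<^sub>R cdd (a x) (pder 1 F) x + cdd (a x) (\<lambda>y. a y $ 1) x *\<^sub>R cdd (a x) (pder 1 F) x)
      + (a x $ 1) *\<^sub>R cdd (a x) (cdd (a x) (pder 1 F)) x
      + (cdd (a x) (cdd (a x) (\<lambda>y. a y $ 2)) x *\<^sub>R pder 2 F x + (cdd (a x) (\<lambda>y. a y $ 2) x *\<^sub>R cdd (a x) (pder 2 F) x + cdd (a x) (\<lambda>y. a y $ 2) x *\<^sub>R cdd (a x) (pder 2 F) x)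
      + (a x $ 2) *\<^sub>R cdd (a x) (cdd (a x) (pder 2 F)) x)"
    unfolding D1
    by (simp add: dd_add dd_scaleR smooth_add smooth_scaleR s sc smooth_dd smooth_const)
  have Vp: "V \<bullet> pder i F x = 0" for i unfolding dd_def by (rule VT)
  have "V \<bullet> cdd (a x) (cdd (a x) E1) x =
      (a x $ 1) * (V \<bullet> cdd (a x) (cdd (a x) (pder 1 F)) x) + (a x $ 2) * (V \<bullet> cdd (a x) (cdd (a x) (pder 2 F)) x)"
    unfolding DD inner_add_right inner_scaleR_right VD Vp by simp
  also have "\<dots> = V \<bullet> cdd (a x) (cdd (a x) (cdd (a x) F)) x"
  proof -
    have lin: "cdd (a x) (\<lambda>y. k *\<^sub>R f y + l *\<^sub>R g y) = (\<lambda>y. k *\<^sub>R cdd (a x) f y + l *\<^sub>R cdd (a x) g y)"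
      if "smooth f" "smooth g" for k l and f g :: "real^2 \<Rightarrow> real^4"
      using that by (simp add: fun_eq_iff dd_add dd_scaleR dd_const smooth_scaleR smooth_const)
    show ?thesis unfolding DF by (simp add: lin s sD inner_add_right)
  qed
  finally have 1: "V \<bullet> cdd (a x) (cdd (a x) E1) x = V \<bullet> cdd (a x) (cdd (a x) (cdd (a x) F)) x" .
  have "dd a (dd a E1) x = cdd (a x) (cdd (a x) E1) x + frechet_derivative E1 (at x) (dd a a x)"
    using dd_dd[OF smE1 sma, of a x] by (simp add: dd_def[abs_def])
  then show ?thesis using VE 1 by (simp add: inner_add_right)
qed

text \<open>For \<open>k = 1\<close> the nonnegative function \<open>s \<mapsto> Z 1 x (x + s a)\<close> vanishes to second order at \<open>s = 0\<close>,
  so its third derivative vanishes as well.\<close>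

lemma dd_a_u: "dd a u x = 0"
proof -
  define V where "V = N x - h11 x *\<^sub>R F x"
  define T where "T = V \<bullet> dd (\<lambda>_. a x) (dd (\<lambda>_. a x) (dd (\<lambda>_. a x) F)) x"
  \<comment> \<open>The third derivative is odd in the direction, so the inequalities for
    \<open>a x\<close> and \<open>- a x\<close> together force it to vanish.\<close>
  have third: "0 \<le> V \<bullet> dd (\<lambda>_. v) (dd (\<lambda>_. v) (dd (\<lambda>_. v) F)) x" if v: "v = a x \<or> v = - a x" for v
  proof (rule third_derivative_nonneg)
    let ?D = "dd (\<lambda>_. v)"
    have sD: "smooth (?D g)" if "smooth g" for g :: "real^2 \<Rightarrow> real^4"
      by (rule smooth_dd[OF that smooth_const])
    have line: "((\<lambda>s. k + V \<bullet> g (x + s *\<^sub>R v)) has_real_derivative V \<bullet> ?D g (x + s *\<^sub>R v)) (at s)"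
      if "smooth g" for g :: "real^2 \<Rightarrow> real^4" and s k
    proof -
      have "((\<lambda>s. k + V \<bullet> g (x + s *\<^sub>R v)) has_vector_derivative
          0 + V \<bullet> frechet_derivative g (at (x + s *\<^sub>R v)) v) (at s)"
        by (intro has_vector_derivative_add has_vector_derivative_const
            bounded_linear.has_vector_derivative[OF bounded_linear_inner_right] smooth_along_line that)
      then show ?thesis by (simp add: dd_def has_real_derivative_iff_has_vector_derivative)
    qed
    show "((\<lambda>s. h11 x + V \<bullet> F (x + s *\<^sub>R v)) has_real_derivative (0 + V \<bullet> ?D F (x + s *\<^sub>R v))) (at s)" for s
      using line[OF smF] by simp
    show "((\<lambda>s. 0 + V \<bullet> ?D F (x + s *\<^sub>R v)) has_real_derivative (0 + V \<bullet> ?D (?D F) (x + s *\<^sub>R v))) (at s)" for s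
      using line[OF sD[OF smF], of 0] by simp
    show "((\<lambda>s. 0 + V \<bullet> ?D (?D F) (x + s *\<^sub>R v)) has_real_derivative V \<bullet> ?D (?D (?D F)) x) (at 0)"
      using line[OF sD[OF sD[OF smF]], of 0 0] by simp
    show "h11 x + V \<bullet> F (x + 0 *\<^sub>R v) = 0" by (simp add: V_def inner_diff_left orth)
    show "0 + V \<bullet> ?D F (x + 0 *\<^sub>R v) = 0"
      by (simp add: dd_def V_def inner_diff_left normal_tangent radial_tangent)
    have "?D (?D F) x = hess F x v" by (simp add: hess_def dd_def[abs_def])
    also have "\<dots> = hess F x (a x)" using v hess_scaleR[OF smF, of x "-1" "a x"] by auto
    also have "V \<bullet> \<dots> = 0"
      using hess_normal[of x 1 0] hess_radial[of x 1 0] by (simp add: V_def inner_diff_left)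
    finally show "0 + V \<bullet> ?D (?D F) (x + 0 *\<^sub>R v) = 0" by simp
    show "h11 x + V \<bullet> F (x + s *\<^sub>R v) \<ge> 0" for s
      using Z1_nonneg[of x "x + s *\<^sub>R v"]
      by (simp add: Z_def \<Phi>_def h_eq V_def inner_diff_left algebra_simps)
  qed
  have neg: "dd (\<lambda>_. - a x) g = (\<lambda>y. - dd (\<lambda>_. a x) g y)" if "smooth g" for g :: "real^2 \<Rightarrow> real^4"
    using dd_field_diff[OF that, of "\<lambda>_. 0" "\<lambda>_. a x"] linear_0[OF has_derivative_linear[OF smooth_frechet[OF that]]]
    by (simp add: fun_eq_iff dd_def)
  have sD: "smooth (dd (\<lambda>_. a x) g)" if "smooth g" for g :: "real^2 \<Rightarrow> real^4"
    by (rule smooth_dd[OF that smooth_const])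
  have "dd (\<lambda>_. - a x) (dd (\<lambda>_. - a x) (dd (\<lambda>_. - a x) F)) x = - dd (\<lambda>_. a x) (dd (\<lambda>_. a x) (dd (\<lambda>_. a x) F)) x"
    by (simp add: neg smF sD smooth_minus dd_minus)
  then have "T \<ge> 0" "- T \<ge> 0" using third[of "a x"] third[of "- a x"] by (simp_all add: T_def)
  then have "V \<bullet> dd a (dd a E1) x = 0" using normal_third[of x] by (simp add: T_def V_def)
  moreover have "dd a E1 = (\<lambda>y. p y *\<^sub>R E2 y - h11 y *\<^sub>R N y - F y)" by (simp add: fun_eq_iff principal_structure)
  then have "dd a (dd a E1) x = dd a p x *\<^sub>R E2 x + p x *\<^sub>R (- p x *\<^sub>R E1 x) - (dd a h11 x *\<^sub>R N x + h11 x *\<^sub>R (h11 x *\<^sub>R E1 x)) - E1 x"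
    by (simp add: dd_diff dd_scaleR smooth_diff smooth_scaleR sm principal_structure structure_eqs(1))
  \<comment> \<open>Among the terms of \<open>dd a (dd a E1) x\<close>, only
    \<open>- dd a h11 x *\<^sub>R N x\<close> has a nonzero product with \<open>V\<close>.\<close>
  ultimately have "dd a h11 x = 0"
    by (simp add: V_def inner_diff_left inner_diff_right inner_add_right orth)
  then show ?thesis using t_bounds(1)[of x] by (simp add: dh)
qed

lemma r_zero: "r x = 0"
  by (simp add: r_val dd_a_u)

text \<open>As \<open>dd a u\<close> and \<open>r\<close> vanish, the commutator makes
  \<open>dd b u\<close> constant along \<open>a\<close>, and with it the formula for
  \<open>p\<close>.\<close>

lemma dd_a_p: "dd a p x = 0"
proof -
  have u0: "u x \<noteq> 0" using u_pos[of x] by simp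
  have z: "dd a u = (\<lambda>x. 0)" using dd_a_u by blast
  have "dd a (dd b u) x = 0"
    using commutator[OF smu, of x] by (simp add: z dd_const r_zero)
  moreover have "dd a t x = 0" by (simp add: dt dd_a_u)
  moreover have "p = (\<lambda>x. (1 + t x) * dd b u x / (2 * u x))" using p_val by blast
  ultimately show ?thesis
    using u0 by (simp add: dd_divide dd_mult dd_add dd_const smooth_mult smooth_add smooth_const smt smu smooth_dd smb dd_a_u)
qed

text \<open>The curvature line in direction \<open>a\<close> is a circle in the plane spanned by \<open>E1\<close> and its derivative
  \<open>W\<close>. This plane does not depend on the point, and the rotation in it is the required symmetry.\<close>

definition "W x = p x *\<^sub>R E2 x - h11 x *\<^sub>R N x - F x"
definition "\<omega> x = 1 + (p x)\<^sup>2 + (h11 x)\<^sup>2"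

lemma smW: "smooth W" and sm\<omega>: "smooth \<omega>"
  unfolding W_def[abs_def] \<omega>_def[abs_def] by (intro smooth_intros sm)+

lemma \<omega>_pos: "\<omega> x > 0" by (simp add: \<omega>_def add_pos_nonneg)

text \<open>The span of \<open>E1\<close> and \<open>W\<close> is preserved by both derivatives.
  Moreover \<open>\<omega>\<close> is the squared length of \<open>W\<close>; its rate
  \<open>2 * p x\<close> along \<open>b\<close> is twice that of \<open>W\<close>.\<close>

lemma W_derivs: "dd a E1 x = W x" "dd b E1 x = 0" "dd a W x = - \<omega> x *\<^sub>R E1 x" "dd b W x = p x *\<^sub>R W x"
  "dd a \<omega> x = 0" "dd b \<omega> x = 2 * p x * \<omega> x"
proof -
  show "dd a E1 x = W x" "dd b E1 x = 0" by (simp_all add: principal_structure W_def r_zero)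
  have ha: "dd a h11 x = 0" by (simp add: dh dd_a_u)
  have "h12 = (\<lambda>x. 0)" using h12z by blast
  then have hb: "dd b h11 x = p x * (h11 x - h22 x)"
    using codazzi(1)[of x] by (simp add: dd_const algebra_simps)
  have "r = (\<lambda>x. 0)" using r_zero by blast
  then have pb: "dd b p x = 1 + h11 x * h22 x + (p x)\<^sup>2"
    using gauss[of x] by (simp add: dd_const h12z)
  show "dd a W x = - \<omega> x *\<^sub>R E1 x"
    unfolding W_def[abs_def] \<omega>_def
    by (simp add: dd_diff dd_scaleR smooth_diff smooth_scaleR sm principal_structure structure_eqs(1) dd_a_p ha)
      (simp add: algebra_simps power2_eq_square)
  show "dd b W x = p x *\<^sub>R W x"
    unfolding W_def[abs_def]
    by (simp add: dd_diff dd_scaleR smooth_diff smooth_scaleR sm principal_structure structure_eqs(2) pb hb r_zero)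
      (simp add: algebra_simps power2_eq_square)
  show "dd a \<omega> x = 0" "dd b \<omega> x = 2 * p x * \<omega> x"
    unfolding \<omega>_def[abs_def] power2_eq_square
    by (simp_all add: dd_add dd_mult dd_const smooth_add smooth_mult smooth_const sm dd_a_p ha pb hb)
      (simp add: algebra_simps power2_eq_square)
qed

lemma constant_if_dd_zero:
  fixes f :: "real^2 \<Rightarrow> real"
  assumes "smooth f" "\<And>x. dd a f x = 0" "\<And>x. dd b f x = 0"
  shows "f x = f y"
proof -
  have "(f has_derivative (\<lambda>v. 0)) (at x within UNIV)" for x
  proof -
    have "frechet_derivative f (at x) = (\<lambda>v. 0)"
      by (simp add: fun_eq_iff frechet_coords[OF assms(1)] assms(2,3))
    then show ?thesis using smooth_frechet[OF assms(1), of x] by simp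
  qed
  then have "\<exists>c. \<forall>x\<in>UNIV. f x = c"
    by (intro has_derivative_zero_constant) auto
  then show ?thesis by auto
qed

text \<open>These are the Pluecker coordinates of the plane of \<open>E1\<close> and
  \<open>W\<close>. Along \<open>a\<close> the bivector is constant; along \<open>b\<close> it
  scales at the rate \<open>p\<close>, just as \<open>sqrt \<omega>\<close> does.\<close>

lemma bivector_constant:
  "(E1 x $ i * W x $ j - W x $ i * E1 x $ j) / sqrt (\<omega> x) = (E1 y $ i * W y $ j - W y $ i * E1 y $ j) / sqrt (\<omega> y)"
proof (rule constant_if_dd_zero[of "\<lambda>x. (E1 x $ i * W x $ j - W x $ i * E1 x $ j) / sqrt (\<omega> x)"])
  have s0: "sqrt (\<omega> x) \<noteq> 0" for x using \<omega>_pos[of x] by simp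
  have sms: "smooth (\<lambda>x. sqrt (\<omega> x))" by (intro smooth_sqrt sm\<omega> \<omega>_pos)
  have smn: "smooth (\<lambda>x. E1 x $ i * W x $ j - W x $ i * E1 x $ j)" by (intro smooth_intros sm smW)
  show "smooth (\<lambda>x. (E1 x $ i * W x $ j - W x $ i * E1 x $ j) / sqrt (\<omega> x))"
    by (intro smooth_divide smn sms s0)
  have ds: "dd v (\<lambda>x. sqrt (\<omega> x)) x = (inverse (sqrt (\<omega> x)) / 2) * dd v \<omega> x" for v x
    by (rule dd_real_compose[OF DERIV_real_sqrt[OF \<omega>_pos] sm\<omega>])
  have sq: "sqrt (\<omega> x) * sqrt (\<omega> x) = \<omega> x" for x using \<omega>_pos[of x] by simp
  have dn: "dd v (\<lambda>x. E1 x $ i * W x $ j - W x $ i * E1 x $ j) x =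
      dd v E1 x $ i * W x $ j + E1 x $ i * dd v W x $ j - (dd v W x $ i * E1 x $ j + W x $ i * dd v E1 x $ j)" for v x
    by (simp add: dd_diff dd_mult dd_nth smooth_mult smooth_nth sm smW)
  fix x
  show "dd a (\<lambda>x. (E1 x $ i * W x $ j - W x $ i * E1 x $ j) / sqrt (\<omega> x)) x = 0"
    unfolding dd_divide[OF smn sms s0] ds dn by (simp add: W_derivs algebra_simps)
  have K: "inverse (sqrt (\<omega> x)) / 2 * (2 * p x * \<omega> x) = p x * sqrt (\<omega> x)"
    using s0[of x] sq[of x] by (simp add: field_simps)
  show "dd b (\<lambda>x. (E1 x $ i * W x $ j - W x $ i * E1 x $ j) / sqrt (\<omega> x)) x = 0"
    unfolding dd_divide[OF smn sms s0] ds dn W_derivs K by (simp add: algebra_simps)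
qed

text \<open>The normalised bivector, read as a matrix, generates the rotations of the plane of
  \<open>E1\<close> and \<open>W\<close>. Since \<open>E1\<close> is orthogonal to \<open>F\<close>
  and \<open>W \<bullet> F = -1\<close>, it maps \<open>F\<close> to the tangent vector
  \<open>- E1 / sqrt \<omega>\<close>.\<close>

theorem rotationally_symmetric:
  obtains Q :: "real^4^4" where "transpose Q = - Q" "rank Q = 2"
    "\<And>x. Q *v F x \<in> span {pder 1 F x, pder 2 F x}"
proof -
  define Q :: "real^4^4" where "Q = (\<chi> i j. (E1 0 $ i * W 0 $ j - W 0 $ i * E1 0 $ j) / sqrt (\<omega> 0))"
  have Q: "Q = (\<chi> i j. (E1 x $ i * W x $ j - W x $ i * E1 x $ j) / sqrt (\<omega> x))" for x
    unfolding Q_def using bivector_constant[of 0 _ _ x] by (simp add: vec_eq_iff)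
  have Qv: "Q *v y = ((W x \<bullet> y) / sqrt (\<omega> x)) *\<^sub>R E1 x - ((E1 x \<bullet> y) / sqrt (\<omega> x)) *\<^sub>R W x" for x y
  proof -
    have "(Q *v y) $ i = (\<Sum>j\<in>UNIV. (E1 x $ i * W x $ j - W x $ i * E1 x $ j) / sqrt (\<omega> x) * y $ j)" for i
      by (simp add: Q[of x] matrix_vector_mult_def)
    also have "(\<Sum>j\<in>UNIV. (E1 x $ i * W x $ j - W x $ i * E1 x $ j) / sqrt (\<omega> x) * y $ j) =
       (\<Sum>j\<in>UNIV. (E1 x $ i / sqrt (\<omega> x)) * (W x $ j * y $ j) - (W x $ i / sqrt (\<omega> x)) * (E1 x $ j * y $ j))" for i
      by (intro sum.cong) (simp_all add: diff_divide_distrib algebra_simps)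
    also have "(\<Sum>j\<in>UNIV. (E1 x $ i / sqrt (\<omega> x)) * (W x $ j * y $ j) - (W x $ i / sqrt (\<omega> x)) * (E1 x $ j * y $ j)) =
       (E1 x $ i / sqrt (\<omega> x)) * (W x \<bullet> y) - (W x $ i / sqrt (\<omega> x)) * (E1 x \<bullet> y)" for i
      unfolding sum_subtractf sum_distrib_left[symmetric] inner_vec_def by simp
    finally show ?thesis by (simp add: vec_eq_iff mult.commute)
  qed
  have s0: "sqrt (\<omega> x) > 0" for x using \<omega>_pos[of x] by simp
  have WE: "W x \<bullet> E1 x = 0" "E1 x \<bullet> W x = 0" "W x \<bullet> F x = -1" "W x \<bullet> W x = \<omega> x" for x
    by (simp_all add: W_def \<omega>_def inner_diff_left inner_diff_right orth power2_eq_square)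
  have "transpose Q = - Q"
    by (simp add: Q_def transpose_def vec_eq_iff minus_divide_left)
  moreover have "rank Q = 2"
  proof -
    have ne: "E1 0 \<noteq> W 0" using WE(1)[of 0] orth(3)[of 0] by (metis zero_neq_one)
    have "range ((*v) Q) = span {E1 0, W 0}"
    proof
      show "range ((*v) Q) \<subseteq> span {E1 0, W 0}"
      proof
        fix z assume "z \<in> range ((*v) Q)"
        then obtain y where "z = Q *v y" by blast
        then show "z \<in> span {E1 0, W 0}"
          unfolding Qv[of _ 0] by (simp add: span_diff span_scale span_base)
      qed
      have "E1 0 = Q *v ((1 / sqrt (\<omega> 0)) *\<^sub>R W 0)" "W 0 = Q *v ((- sqrt (\<omega> 0)) *\<^sub>R E1 0)"
        unfolding Qv[of _ 0] using s0[of 0] \<omega>_pos[of 0] by (simp_all add: WE orth)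
      then have "E1 0 \<in> range ((*v) Q)" "W 0 \<in> range ((*v) Q)" by blast+
      moreover have "subspace (range ((*v) Q))"
        by (intro linear_subspace_image matrix_vector_mul_linear subspace_UNIV)
      ultimately show "span {E1 0, W 0} \<subseteq> range ((*v) Q)"
        by (intro span_minimal) auto
    qed
    moreover have "independent {E1 0, W 0}"
    proof (rule pairwise_orthogonal_independent)
      show "pairwise orthogonal {E1 0, W 0}" by (auto simp: pairwise_def orthogonal_def WE)
      show "0 \<notin> {E1 0, W 0}" using WE(4)[of 0] \<omega>_pos[of 0] orth(3)[of 0] by auto
    qed
    ultimately have "dim (range ((*v) Q)) = card {E1 0, W 0}"
      by (simp add: dim_eq_card_independent)
    then show ?thesis using ne by (simp add: rank_dim_range)
  qed
  moreover have "Q *v F x \<in> span {pder 1 F x, pder 2 F x}" for x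
  proof -
    have "Q *v F x = (- 1 / sqrt (\<omega> x)) *\<^sub>R E1 x"
      unfolding Qv[of _ x] by (simp add: WE orth)
    moreover have "E1 x = (a x $ 1) *\<^sub>R pder 1 F x + (a x $ 2) *\<^sub>R pder 2 F x"
      using frechet_plane[OF smF, of x "a x"] daF' by (simp add: dd_def[of a])
    then have "E1 x \<in> span {pder 1 F x, pder 2 F x}" by (simp add: span_add span_scale span_base)
    ultimately show ?thesis by (metis span_scale)
  qed
  ultimately show ?thesis using that by blast
qed

end

section \<open>Lifting to the plane\<close>

text \<open>The angular coordinate fields are globally defined on the torus, so orthonormalising
  their images gives a doubly periodic frame; dividing the fields in the same way keeps them
  triangular.\<close>

lemma gram_schmidt_frame:
  fixes F N :: "real^2 \<Rightarrow> real^4"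
  assumes F: "smooth F" "doubly_periodic F" and N: "smooth N" "doubly_periodic N"
    and unit: "\<And>x. F x \<bullet> F x = 1" "\<And>x. N x \<bullet> N x = 1" "\<And>x. F x \<bullet> N x = 0"
    and normal: "\<And>x v. N x \<bullet> frechet_derivative F (at x) v = 0"
    and immersion: "\<And>x v. frechet_derivative F (at x) v = 0 \<Longrightarrow> v = 0"
  obtains E1 E2 a b where "periodic_frame F N E1 E2 a b"
proof -
  have lin: "linear (frechet_derivative F (at x))" for x
    using smooth_frechet[OF F(1)] has_derivative_linear by blast
  have Ft: "F x \<bullet> frechet_derivative F (at x) v = 0" for x v
    using dd_inner_const[OF F(1) F(1) unit(1), of "\<lambda>_. v" x] by (simp add: dd_def inner_commute)
  have sp: "smooth (pder i F)" and pp: "doubly_periodic (pder i F)" for i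
    by (rule smooth_pder[OF F(1)], intro dd_periodic F doubly_periodic_const)
  define l where "l = (\<lambda>x. sqrt (pder 1 F x \<bullet> pder 1 F x))"
  have p1: "pder 1 F x \<bullet> pder 1 F x > 0" for x
  proof -
    have "pder 1 F x \<noteq> 0" using immersion[of x "axis 1 1"] by (auto simp: dd_def)
    then show ?thesis by simp
  qed
  have l: "l x > 0" "l x * l x = pder 1 F x \<bullet> pder 1 F x" for x using p1[of x] by (simp_all add: l_def)
  have l0: "l x \<noteq> 0" for x using l(1)[of x] by simp
  have sl: "smooth l" unfolding l_def by (intro smooth_sqrt smooth_inner sp p1)
  define a where "a = (\<lambda>x. (1 / l x) *\<^sub>R (axis 1 1 :: real^2))"
  define E1 where "E1 = (\<lambda>x. (1 / l x) *\<^sub>R pder 1 F x)"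
  define m where "m = (\<lambda>x. pder 2 F x \<bullet> E1 x)"
  define g where "g = (\<lambda>x. pder 2 F x - m x *\<^sub>R E1 x)"
  have sa: "smooth a" unfolding a_def by (intro smooth_scaleR smooth_divide smooth_const sl l0)
  have sE1: "smooth E1" unfolding E1_def by (intro smooth_scaleR smooth_divide smooth_const sl l0 sp)
  have sg: "smooth g" and smm: "smooth m" unfolding g_def m_def by (intro smooth_diff smooth_scaleR smooth_inner sE1 sp)+
  have geq: "g x = frechet_derivative F (at x) (axis 2 1 - (m x / l x) *\<^sub>R axis 1 1)" for x
    by (simp add: g_def E1_def dd_def linear_diff[OF lin] linear_cmul[OF lin])
  have g0: "g x \<bullet> g x > 0" for x
  proof -
    have "g x \<noteq> 0"
    proof
      assume "g x = 0"
      then have "axis 2 1 - (m x / l x) *\<^sub>R axis 1 1 = (0 :: real^2)" unfolding geq by (rule immersion)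
      then have "(axis 2 1 - (m x / l x) *\<^sub>R axis 1 1 :: real^2) $ 2 = 0" by simp
      then show False by (simp add: axis_def)
    qed
    then show ?thesis by simp
  qed
  define k where "k = (\<lambda>x. sqrt (g x \<bullet> g x))"
  have k: "k x > 0" "k x * k x = g x \<bullet> g x" for x using g0[of x] by (simp_all add: k_def)
  have k0: "k x \<noteq> 0" for x using k(1)[of x] by simp
  have sk: "smooth k" unfolding k_def by (intro smooth_sqrt smooth_inner sg g0)
  define b where "b = (\<lambda>x. (1 / k x) *\<^sub>R (axis 2 1 - (m x / l x) *\<^sub>R axis 1 1 :: real^2))"
  define E2 where "E2 = (\<lambda>x. (1 / k x) *\<^sub>R g x)"
  have sb: "smooth b" unfolding b_def by (intro smooth_scaleR smooth_diff smooth_divide smooth_const sl l0 sk k0 smm)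
  have sE2: "smooth E2" unfolding E2_def by (intro smooth_scaleR smooth_divide smooth_const sk k0 sg)
  have da: "dd a F x = E1 x" for x by (simp add: dd_def a_def E1_def linear_cmul[OF lin])
  have db: "dd b F x = E2 x" for x unfolding dd_def by (simp add: b_def E2_def geq linear_cmul[OF lin])
  have E11: "E1 x \<bullet> E1 x = 1" for x using l0[of x] by (simp add: E1_def l(2)[symmetric])
  have E22: "E2 x \<bullet> E2 x = 1" for x using k0[of x] by (simp add: E2_def k(2)[symmetric])
  have E12: "E1 x \<bullet> E2 x = 0" for x
    by (simp add: E2_def g_def inner_diff_right E11 m_def inner_commute)
  have "doubly_periodic l" unfolding l_def using pp by (simp add: doubly_periodic_def)
  then have pa: "doubly_periodic a" and pE1: "doubly_periodic E1"
    unfolding a_def E1_def using pp by (simp_all add: doubly_periodic_def)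
  then have "doubly_periodic m" unfolding m_def using pp by (simp add: doubly_periodic_def)
  moreover from this have "doubly_periodic g" unfolding g_def using pp pE1 by (simp add: doubly_periodic_def)
  then have "doubly_periodic k" unfolding k_def by (simp add: doubly_periodic_def)
  ultimately have pb: "doubly_periodic b"
    unfolding b_def using \<open>doubly_periodic l\<close> by (simp add: doubly_periodic_def)
  have "periodic_frame F N E1 E2 a b"
  proof
    show "F x \<bullet> E1 x = 0" "F x \<bullet> E2 x = 0" "N x \<bullet> E1 x = 0" "N x \<bullet> E2 x = 0" for x
      unfolding da[symmetric] db[symmetric] dd_def by (rule Ft normal)+
    show "a x $ 2 = 0" "a x $ 1 > 0" "b x $ 2 > 0" for x
      using l(1)[of x] k(1)[of x] by (simp_all add: a_def b_def axis_def)
  qed (fact F N unit sE1 sE2 sa sb E11 E22 E12 da db pa pb)+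
  then show ?thesis by (rule that)
qed

text \<open>The eigenvalues are the roots of \<open>(k - x) * (k - z) = y\<^sup>2\<close>, namely
  half of \<open>x + z\<close> plus or minus \<open>d\<close>. Equality of sets covers a double root
  as well, because then \<open>d = 0\<close>.\<close>

lemma symmetric_2x2_eigenvalues:
  fixes x y z l m :: real
  assumes "{k. \<exists>s t. (s \<noteq> 0 \<or> t \<noteq> 0) \<and> x * s + y * t = k * s \<and> y * s + z * t = k * t} = {l, m}" "l \<ge> m"
  shows "l + m = x + z" "(l - m)\<^sup>2 = (x - z)\<^sup>2 + 4 * y\<^sup>2"
proof -
  let ?E = "{k. \<exists>s t. (s \<noteq> 0 \<or> t \<noteq> 0) \<and> x * s + y * t = k * s \<and> y * s + z * t = k * t}"
  define d where "d = sqrt ((x - z)\<^sup>2 + 4 * y\<^sup>2)"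
  have d: "d \<ge> 0" "d\<^sup>2 = (x - z)\<^sup>2 + 4 * y\<^sup>2" by (simp_all add: d_def)
  have in_E: "k \<in> ?E \<longleftrightarrow> (k - x) * (k - z) = y\<^sup>2" for k
  proof
    assume "k \<in> ?E"
    then obtain s t where st: "s \<noteq> 0 \<or> t \<noteq> 0" "x * s + y * t = k * s" "y * s + z * t = k * t" by blast
    have e: "(k - x) * s = y * t" "(k - z) * t = y * s" using st by (simp_all add: algebra_simps)
    have "((k - x) * (k - z) - y\<^sup>2) * s = (k - z) * ((k - x) * s) - y * (y * s)"
      by (simp add: power2_eq_square algebra_simps)
    moreover have "\<dots> = 0" unfolding e(1) e(2)[symmetric] by simp
    moreover have "((k - x) * (k - z) - y\<^sup>2) * t = (k - x) * ((k - z) * t) - y * (y * t)"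
      by (simp add: power2_eq_square algebra_simps)
    moreover have "\<dots> = 0" unfolding e(2) e(1)[symmetric] by simp
    ultimately have "((k - x) * (k - z) - y\<^sup>2) * s = 0" "((k - x) * (k - z) - y\<^sup>2) * t = 0" by simp_all
    then show "(k - x) * (k - z) = y\<^sup>2" using st(1) by auto
  next
    assume k: "(k - x) * (k - z) = y\<^sup>2"
    show "k \<in> ?E"
    proof (cases "y \<noteq> 0 \<or> k \<noteq> x")
      case True
      \<comment> \<open>The eigenvector is \<open>(y, k - x)\<close>; it degenerates only for
        \<open>y = 0\<close> and \<open>k = x\<close>, where \<open>(1, 0)\<close> serves
        instead.\<close>
      then have "(y \<noteq> 0 \<or> k - x \<noteq> 0) \<and> x * y + y * (k - x) = k * y \<and> y * y + z * (k - x) = k * (k - x)"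
        using k by (auto simp: algebra_simps power2_eq_square)
      then show ?thesis by blast
    next
      case False
      then have "(1 \<noteq> (0::real) \<or> (0::real) \<noteq> 0) \<and> x * 1 + y * 0 = k * 1 \<and> y * 1 + z * 0 = k * 0" by simp
      then show ?thesis by blast
    qed
  qed
  have char: "(k - x) * (k - z) = y\<^sup>2 \<longleftrightarrow> (2 * k - (x + z))\<^sup>2 = d\<^sup>2" for k
    unfolding d(2) by (auto simp: power2_eq_square algebra_simps)
  have "(x + z + d) / 2 \<in> ?E" "(x + z - d) / 2 \<in> ?E"
  proof -
    have "2 * ((x + z + d) / 2) - (x + z) = d" "2 * ((x + z - d) / 2) - (x + z) = - d" by (simp_all add: field_simps)
    then show "(x + z + d) / 2 \<in> ?E" "(x + z - d) / 2 \<in> ?E" unfolding in_E char by (simp_all only: power2_minus)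
  qed
  then have "(x + z + d) / 2 = l \<or> (x + z + d) / 2 = m" "(x + z - d) / 2 = l \<or> (x + z - d) / 2 = m"
    unfolding assms(1) by blast+
  then have 1: "2 * l = x + z + d \<or> 2 * m = x + z + d" "2 * l = x + z - d \<or> 2 * m = x + z - d" by auto
  have "l \<in> ?E" "m \<in> ?E" unfolding assms(1) by blast+
  then have "2 * l - (x + z) = d \<or> 2 * l - (x + z) = - d" "2 * m - (x + z) = d \<or> 2 * m - (x + z) = - d"
    unfolding in_E char power2_eq_iff .
  with 1 assms(2) d(1) have lm: "2 * l = x + z + d" "2 * m = x + z - d" by argo+
  show "l + m = x + z" using lm by simp
  have "l - m = d" using lm by simp
  then show "(l - m)\<^sup>2 = (x - z)\<^sup>2 + 4 * y\<^sup>2" using d(2) by simp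
qed

context frame begin

text \<open>In coordinates the eigenvalue problem is relative to the metric; it says that the
  differential of \<open>N\<close> maps \<open>v\<close> to \<open>l\<close> times the image of
  \<open>v\<close> under that of \<open>F\<close>. Expanding \<open>v\<close> in \<open>a\<close>
  and \<open>b\<close>, whose images are orthonormal, makes it an ordinary one.\<close>

lemma eigenvalues_in_frame:
  "{l. \<exists>v. v \<noteq> 0 \<and> (\<chi> i j. pder i N x \<bullet> pder j F x) *v v = l *\<^sub>R ((\<chi> i j. pder i F x \<bullet> pder j F x) *v v)} =
   {l. \<exists>s t. (s \<noteq> 0 \<or> t \<noteq> 0) \<and> h11 x * s + h12 x * t = l * s \<and> h12 x * s + h22 x * t = l * t}"
proof -
  let ?DF = "frechet_derivative F (at x)" and ?DN = "frechet_derivative N (at x)"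
  have lF: "linear ?DF" and lN: "linear ?DN"
    using smooth_frechet[OF smF] smooth_frechet[OF smN] has_derivative_linear by blast+
  have DN: "?DN (s *\<^sub>R a x + t *\<^sub>R b x) = (h11 x * s + h12 x * t) *\<^sub>R E1 x + (h12 x * s + h22 x * t) *\<^sub>R E2 x" for s t
    using structure_eqs(3,4)[of x] by (simp add: linear_add[OF lN] linear_cmul[OF lN] dd_def algebra_simps)
  have sym: "?DN v \<bullet> ?DF w = ?DF v \<bullet> ?DN w" for v w
  proof -
    obtain s t where v: "v = s *\<^sub>R a x + t *\<^sub>R b x" by (rule plane_basis)
    obtain s' t' where w: "w = s' *\<^sub>R a x + t' *\<^sub>R b x" by (rule plane_basis)
    show ?thesis unfolding v w DN frechet_F by (simp add: inner_add_left inner_add_right orth algebra_simps)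
  qed
  have plane: "(v $ 1) *\<^sub>R axis 1 1 + (v $ 2) *\<^sub>R axis 2 1 = v" for v :: "real^2"
    using pt_eta[of v] by (simp add: pt_def)
  have mv: "((\<chi> i j. G i \<bullet> pder j F x) *v v) $ i = G i \<bullet> ?DF v" for G :: "2 \<Rightarrow> real^4" and v i
  proof -
    have "?DF v = (v $ 1) *\<^sub>R pder 1 F x + (v $ 2) *\<^sub>R pder 2 F x"
      by (subst plane[of v, symmetric]) (simp add: linear_add[OF lF] linear_cmul[OF lF] dd_def)
    then show ?thesis by (simp add: matrix_vector_mult_def sum_2 inner_add_right mult.commute)
  qed
  have "(\<chi> i j. pder i N x \<bullet> pder j F x) *v v = l *\<^sub>R ((\<chi> i j. pder i F x \<bullet> pder j F x) *v v) \<longleftrightarrow> ?DN v = l *\<^sub>R ?DF v" for v l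
  proof -
    have "(\<chi> i j. pder i N x \<bullet> pder j F x) *v v = l *\<^sub>R ((\<chi> i j. pder i F x \<bullet> pder j F x) *v v) \<longleftrightarrow>
        (\<forall>i. pder i N x \<bullet> ?DF v = l * (pder i F x \<bullet> ?DF v))"
      by (simp add: vec_eq_iff mv)
    also have "\<dots> \<longleftrightarrow> (\<forall>i. pder i F x \<bullet> (?DN v - l *\<^sub>R ?DF v) = 0)"
      unfolding dd_def sym by (simp add: inner_diff_right)
    also have "\<dots> \<longleftrightarrow> (\<forall>w. ?DF w \<bullet> (?DN v - l *\<^sub>R ?DF v) = 0)"
    proof safe
      fix w assume "\<forall>i. pder i F x \<bullet> (?DN v - l *\<^sub>R ?DF v) = 0"
      then show "?DF w \<bullet> (?DN v - l *\<^sub>R ?DF v) = 0"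
        by (subst plane[of w, symmetric]) (simp add: linear_add[OF lF] linear_cmul[OF lF] dd_def inner_add_left)
    qed (simp add: dd_def)
    also have "\<dots> \<longleftrightarrow> ?DN v = l *\<^sub>R ?DF v"
    proof
      assume H: "\<forall>w. ?DF w \<bullet> (?DN v - l *\<^sub>R ?DF v) = 0"
      obtain s t where v: "v = s *\<^sub>R a x + t *\<^sub>R b x" by (rule plane_basis)
      define y where "y = ?DN v - l *\<^sub>R ?DF v"
      have "E1 x \<bullet> y = 0" "E2 x \<bullet> y = 0"
        using H[rule_format, of "a x"] H[rule_format, of "b x"] structure_eqs(1,2)[of x] by (simp_all add: dd_def y_def)
      moreover have "y \<bullet> N x = 0" "y \<bullet> F x = 0"
        unfolding y_def v DN frechet_F by (simp_all add: inner_diff_left inner_add_left orth)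
      ultimately have "y = 0" by (intro trans[OF expand[of y x]]) (simp add: inner_commute)
      then show "?DN v = l *\<^sub>R ?DF v" by (simp add: y_def)
    qed simp
    finally show ?thesis .
  qed
  moreover have "(\<exists>v. v \<noteq> 0 \<and> ?DN v = l *\<^sub>R ?DF v) \<longleftrightarrow>
      (\<exists>s t. (s \<noteq> 0 \<or> t \<noteq> 0) \<and> h11 x * s + h12 x * t = l * s \<and> h12 x * s + h22 x * t = l * t)" for l
  proof -
    have 1: "?DN (s *\<^sub>R a x + t *\<^sub>R b x) = l *\<^sub>R ?DF (s *\<^sub>R a x + t *\<^sub>R b x) \<longleftrightarrow>
        h11 x * s + h12 x * t = l * s \<and> h12 x * s + h22 x * t = l * t" (is "?L \<longleftrightarrow> ?R") for s t
    proof
      assume ?L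
      note L = this[unfolded DN frechet_F]
      from arg_cong[OF L, of "\<lambda>v. v \<bullet> E1 x"] arg_cong[OF L, of "\<lambda>v. v \<bullet> E2 x"]
      show ?R by (simp add: inner_add_left orth)
    next
      assume ?R
      then show ?L unfolding DN frechet_F by (simp add: scaleR_right_distrib)
    qed
    have 2: "s *\<^sub>R a x + t *\<^sub>R b x = 0 \<longleftrightarrow> s = 0 \<and> t = 0" for s t
    proof
      assume "s *\<^sub>R a x + t *\<^sub>R b x = 0"
      then have "s *\<^sub>R E1 x + t *\<^sub>R E2 x = 0" using frechet_F[of x s t] linear_0[OF lF] by simp
      then have "(s *\<^sub>R E1 x + t *\<^sub>R E2 x) \<bullet> E1 x = 0" "(s *\<^sub>R E1 x + t *\<^sub>R E2 x) \<bullet> E2 x = 0" by simp_all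
      then show "s = 0 \<and> t = 0" by (simp add: inner_add_left orth)
    qed simp
    have "(\<exists>v. v \<noteq> 0 \<and> ?DN v = l *\<^sub>R ?DF v) \<longleftrightarrow>
        (\<exists>s t. s *\<^sub>R a x + t *\<^sub>R b x \<noteq> 0 \<and> ?DN (s *\<^sub>R a x + t *\<^sub>R b x) = l *\<^sub>R ?DF (s *\<^sub>R a x + t *\<^sub>R b x))"
    proof
      assume "\<exists>v. v \<noteq> 0 \<and> ?DN v = l *\<^sub>R ?DF v"
      then obtain v where v: "v \<noteq> 0" "?DN v = l *\<^sub>R ?DF v" by blast
      obtain s t where "v = s *\<^sub>R a x + t *\<^sub>R b x" by (rule plane_basis)
      with v show "\<exists>s t. s *\<^sub>R a x + t *\<^sub>R b x \<noteq> 0 \<and> ?DN (s *\<^sub>R a x + t *\<^sub>R b x) = l *\<^sub>R ?DF (s *\<^sub>R a x + t *\<^sub>R b x)"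
        by blast
    qed blast
    then show ?thesis unfolding 1 2 by simp
  qed
  ultimately show ?thesis by simp
qed

end

section \<open>The covering of the torus by the plane\<close>

lemma torus_lift:
  fixes x :: "real^2"
  shows "torus_chart (1, 1) x \<in> torus"
  by (simp add: torus_chart_def torus_def)

lemma torus_lift_surj:
  assumes "p \<in> torus"
  obtains x :: "real^2" where "p = torus_chart (1, 1) x"
proof -
  have unit: "z = cis (Arg z)" if "norm z = 1" for z
  proof -
    have "z \<noteq> 0" using that by auto
    then show ?thesis using cis_Arg[of z] that by (simp add: sgn_eq)
  qed
  obtain s t where s: "fst p = cis s" and t: "snd p = cis t"
    using assms unit[of "fst p"] unit[of "snd p"] by (auto simp: torus_def mem_Times_iff)
  show ?thesis by (rule that[of "pt s t"]) (simp add: torus_chart_def prod_eq_iff s t)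
qed

lemma torus_chart_shift: "torus_chart (torus_chart (1, 1) x) y = torus_chart (1, 1) (y + x)"
  by (simp add: torus_chart_def cis_mult add.commute)

lemma torus_chart_periodic: "m \<in> \<int> \<Longrightarrow> n \<in> \<int> \<Longrightarrow> torus_chart p (x + pt (2 * pi * m) (2 * pi * n)) = torus_chart p x"
proof -
  have "cis (t + 2 * pi * k) = cis t" if "k \<in> \<int>" for t k
  proof -
    have "cis (2 * pi * k) = 1" using that unfolding cis_eq_1 by (elim Ints_cases) blast
    then show ?thesis unfolding cis_mult[symmetric] by simp
  qed
  then show "m \<in> \<int> \<Longrightarrow> n \<in> \<int> \<Longrightarrow> ?thesis" by (simp add: torus_chart_def)
qed

lemma torus_chart_eqD:
  assumes "torus_chart (1, 1) x = torus_chart (1, 1) y"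
  shows "\<exists>m\<in>\<int>. \<exists>n\<in>\<int>. y = x + pt (2 * pi * m) (2 * pi * n)"
proof -
  have c: "\<exists>k\<in>\<int>. t = s + 2 * pi * k" if "cis s = cis t" for s t :: real
  proof -
    have "cis (t - s) = 1" using that by (simp add: cis_divide[symmetric])
    then obtain n :: int where "t - s = 2 * pi * of_int n" unfolding cis_eq_1 by blast
    then show ?thesis by (intro bexI[of _ "of_int n"]) auto
  qed
  have "cis (x $ 1) = cis (y $ 1)" "cis (x $ 2) = cis (y $ 2)"
    using assms by (simp_all add: torus_chart_def)
  then obtain m n where "m \<in> \<int>" "y $ 1 = x $ 1 + 2 * pi * m" "n \<in> \<int>" "y $ 2 = x $ 2 + 2 * pi * n"
    using c by meson
  then show ?thesis by (intro bexI[of _ m] bexI[of _ n]) (auto simp: vec_eq_iff forall_2)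
qed

text \<open>The chart centred at a point is the covering map preceded by a translation, so
  derivatives at its centre are derivatives of the lift.\<close>

lemma pd_lift:
  assumes "smooth (f \<circ> torus_chart (1, 1))"
  shows "pd i f (torus_chart (1, 1) x) = pder i (f \<circ> torus_chart (1, 1)) x"
    "frechet_derivative (f \<circ> torus_chart (torus_chart (1, 1) x)) (at 0) = frechet_derivative (f \<circ> torus_chart (1, 1)) (at x)"
proof -
  have eq: "f \<circ> torus_chart (torus_chart (1, 1) x) = (\<lambda>y. (f \<circ> torus_chart (1, 1)) (y + x))"
    by (simp add: fun_eq_iff torus_chart_shift)
  show "frechet_derivative (f \<circ> torus_chart (torus_chart (1, 1) x)) (at 0) = frechet_derivative (f \<circ> torus_chart (1, 1)) (at x)"
    unfolding eq using frechet_affine[OF bounded_linear_ident assms, of x 0] by (auto simp only: add_0_left)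
  then show "pd i f (torus_chart (1, 1) x) = pder i (f \<circ> torus_chart (1, 1)) x"
    by (simp add: pd_def dd_def)
qed

theorem corollary2:
  fixes a b c :: real
    and F \<nu> :: "complex \<times> complex \<Rightarrow> real^4"
    and \<kappa>\<^sub>1 \<kappa>\<^sub>2 :: "complex \<times> complex \<Rightarrow> real"
  assumes "0 < a" and "0 \<le> b" and "b \<le> 1" and "0 \<le> c"
    and "smooth_embedding_S3 F"
    and "unit_normal_field F \<nu>"
    and "\<And>p. p \<in> torus \<Longrightarrow> principal_curvatures F \<nu> p = {\<kappa>\<^sub>1 p, \<kappa>\<^sub>2 p} \<and> \<kappa>\<^sub>1 p \<ge> \<kappa>\<^sub>2 p"
    and "\<And>p. p \<in> torus \<Longrightarrow> (\<kappa>\<^sub>1 p + \<kappa>\<^sub>2 p - c)\<^sup>2 = a + b * (\<kappa>\<^sub>1 p - \<kappa>\<^sub>2 p)\<^sup>2"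
    and "\<And>p. p \<in> torus \<Longrightarrow> \<kappa>\<^sub>1 p + \<kappa>\<^sub>2 p \<ge> c"
  shows "\<exists>Q :: real^4^4. transpose Q = - Q \<and> rank Q = 2 \<and>
    (\<forall>p\<in>torus. Q *v F p \<in> span {pd 1 F p, pd 2 F p})"
proof -
  define L where "L = (torus_chart (1, 1) :: real^2 \<Rightarrow> complex \<times> complex)"
  define G where "G = F \<circ> L"
  define M where "M = \<nu> \<circ> L"
  have LT: "L x \<in> torus" for x unfolding L_def by (rule torus_lift)
  have e: "F \<in> torus \<rightarrow> sphere 0 1" "smooth_on_torus F"
    "\<And>p. p \<in> torus \<Longrightarrow> inj (frechet_derivative (F \<circ> torus_chart p) (at 0))"
    "\<exists>G. homeomorphism torus (F ` torus) F G"
    using assms(5) unfolding smooth_embedding_S3_def by blast+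
  have n: "smooth_on_torus \<nu>" "\<And>p. p \<in> torus \<Longrightarrow> norm (\<nu> p) = 1" "\<And>p. p \<in> torus \<Longrightarrow> \<nu> p \<bullet> F p = 0"
    "\<And>p i. p \<in> torus \<Longrightarrow> \<nu> p \<bullet> pd i F p = 0"
    using assms(6) unfolding unit_normal_field_def by blast+
  have one: "(1, 1) \<in> torus" by (simp add: torus_def)
  have smG: "smooth G" and smM: "smooth M"
    using e(2) n(1) one unfolding G_def M_def L_def smooth_on_torus_def by blast+
  have perG: "doubly_periodic G" and perM: "doubly_periodic M"
    unfolding doubly_periodic_def G_def M_def L_def by (simp_all add: torus_chart_periodic)
  have pdG: "pd i F (L x) = pder i G x" "pd i \<nu> (L x) = pder i M x" for i x
    using pd_lift(1)[of F i x] pd_lift(1)[of \<nu> i x] smG smM by (simp_all add: G_def M_def L_def)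
  have DG: "frechet_derivative G (at x) v = (v $ 1) *\<^sub>R pder 1 G x + (v $ 2) *\<^sub>R pder 2 G x" for x v
    by (rule frechet_plane[OF smG])
  have unit: "G x \<bullet> G x = 1" "M x \<bullet> M x = 1" "G x \<bullet> M x = 0" for x
    using e(1) n(2,3) LT[of x] by (auto simp: G_def M_def norm_eq_1 inner_commute Pi_iff)
  have normal: "M x \<bullet> frechet_derivative G (at x) v = 0" for x v
    using n(4)[OF LT[of x]] unfolding DG by (simp add: inner_add_right pdG M_def)
  have immersion: "v = 0" if "frechet_derivative G (at x) v = 0" for x v
  proof -
    have "inj (frechet_derivative G (at x))"
      using e(3)[OF LT[of x]] pd_lift(2)[of F x] smG by (simp add: G_def L_def)
    moreover have "frechet_derivative G (at x) 0 = 0" by (simp add: DG)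
    ultimately show ?thesis using that by (metis injD)
  qed
  obtain E1 E2 e1 e2 where "periodic_frame G M E1 E2 e1 e2"
    by (rule gram_schmidt_frame[OF smG perG smM perM unit normal immersion])
  then interpret P: periodic_frame G M E1 E2 e1 e2 .
  have kap: "\<kappa>\<^sub>1 (L x) + \<kappa>\<^sub>2 (L x) = P.h11 x + P.h22 x"
    "(\<kappa>\<^sub>1 (L x) - \<kappa>\<^sub>2 (L x))\<^sup>2 = (P.h11 x - P.h22 x)\<^sup>2 + 4 * (P.h12 x)\<^sup>2" for x
  proof -
    have "{k. \<exists>s t. (s \<noteq> 0 \<or> t \<noteq> 0) \<and> P.h11 x * s + P.h12 x * t = k * s \<and> P.h12 x * s + P.h22 x * t = k * t} =
        principal_curvatures F \<nu> (L x)"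
      unfolding principal_curvatures_def first_form_def second_form_def pdG P.eigenvalues_in_frame ..
    also have "\<dots> = {\<kappa>\<^sub>1 (L x), \<kappa>\<^sub>2 (L x)}" using assms(7)[OF LT] by blast
    finally show "\<kappa>\<^sub>1 (L x) + \<kappa>\<^sub>2 (L x) = P.h11 x + P.h22 x"
      "(\<kappa>\<^sub>1 (L x) - \<kappa>\<^sub>2 (L x))\<^sup>2 = (P.h11 x - P.h22 x)\<^sup>2 + 4 * (P.h12 x)\<^sup>2"
      using symmetric_2x2_eigenvalues assms(7)[OF LT] by blast+
  qed
  have W: "(P.h11 x + P.h22 x - c)\<^sup>2 = a + b * ((P.h11 x - P.h22 x)\<^sup>2 + 4 * (P.h12 x)\<^sup>2)"
    "P.h11 x + P.h22 x \<ge> c" for x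
    using assms(8)[OF LT[of x]] assms(9)[OF LT[of x]] unfolding kap .
  have "P.h11 x \<noteq> P.h22 x \<or> P.h12 x \<noteq> 0" for x
    by (rule P.no_umbilics[OF assms(1-3) W])
  then obtain E1' E2' e1' e2' where fr: "frame G M E1' E2' e1' e2'"
    and h: "\<And>x. frame.h12 M E2' e1' x = 0"
    "\<And>x. frame.h11 M E1' e1' x > frame.h22 M E2' e2' x"
    "\<And>x. frame.h11 M E1' e1' x + frame.h22 M E2' e2' x = P.h11 x + P.h22 x"
    "\<And>x. (frame.h11 M E1' e1' x - frame.h22 M E2' e2' x)\<^sup>2 = (P.h11 x - P.h22 x)\<^sup>2 + 4 * (P.h12 x)\<^sup>2"
    using P.principal_frame_exists by blast
  interpret R: frame G M E1' E2' e1' e2' by (rule fr)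
  interpret R: principal_frame G M E1' E2' e1' e2' a b c
    by unfold_locales (use assms(1-4) W h in auto)
  have inj: "inj_on F torus" using e(4) by (auto simp: homeomorphism_def intro: inj_on_inverseI)
  interpret R: weingarten_principal G M E1' E2' e1' e2' a b c
  proof
    show "doubly_periodic G" "doubly_periodic M" by (rule perG, rule perM)
    \<comment> \<open>\<open>H\<close> and \<open>u\<close> are symmetric expressions in the
      principal curvatures and thus given by the periodic coefficients of the Gram-Schmidt frame,
      whatever the principal frame does along a period.\<close>
    have "R.H = (\<lambda>x. (P.h11 x + P.h22 x) / 2)" unfolding R.H_def[abs_def] h ..
    then show "doubly_periodic R.H" using P.per_coeffs by (simp add: doubly_periodic_def)
    have "R.u = (\<lambda>x. sqrt ((P.h11 x - P.h22 x)\<^sup>2 + 4 * (P.h12 x)\<^sup>2) / 2)"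
    proof
      fix x show "R.u x = sqrt ((P.h11 x - P.h22 x)\<^sup>2 + 4 * (P.h12 x)\<^sup>2) / 2"
        unfolding h(4)[symmetric] R.u_def using h(2)[of x] by simp
    qed
    then show "doubly_periodic R.u" using P.per_coeffs by (simp add: doubly_periodic_def)
    fix x y assume "G x = G y"
    then have "L x = L y" using inj LT by (auto simp: G_def inj_on_def)
    then show "\<exists>m\<in>\<int>. \<exists>n\<in>\<int>. y = x + pt (2 * pi * m) (2 * pi * n)"
      unfolding L_def by (rule torus_chart_eqD)
  qed
  obtain Q :: "real^4^4" where Q: "transpose Q = - Q" "rank Q = 2"
    "\<And>x. Q *v G x \<in> span {pder 1 G x, pder 2 G x}"
    by (rule R.rotationally_symmetric) blast
  have "Q *v F p \<in> span {pd 1 F p, pd 2 F p}" if p: "p \<in> torus" for p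
  proof -
    obtain x where "p = L x" unfolding L_def by (rule torus_lift_surj[OF p])
    then show ?thesis using Q(3)[of x] by (simp add: pdG G_def)
  qed
  then show ?thesis using Q by blast
qed

end
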